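(* Let $p$ be a prime and let $G$ be an elementary abelian $p$-group of order $p^n$. Let $A$ be a primitive ($n$-dimensional nilpotent) $\mathbb{F}_p$-algebra structure on $G$, and let $(G,\circ)$ be the corresponding group structure on $G\cong\mathbb{F}_p^n$. Suppose $L/K$ is a Galois extension of fields with Galois group $\Gamma\cong(G,\circ)$. Then $A$ corresponds to an $H$-Hopf Galois structure on $L/K$ for some $K$-Hopf algebra $H$, and the $K$-sub-Hopf algebras of $H$ form a descending chain $$H=H_1\supset H_2\supset\cdots\supset H_n\supset K.$$ Hence the Galois correspondence $\mathcal F$ for $H$ maps onto exactly $n+1$ fields $F$ with $K\subseteq F\subseteq L$.
   Context: Primitive algebra. The primitive $n$-dimensional nilpotent $\mathbb{F}_p$-algebra is the commutative associative non-unital algebra $A$ generated by one element $z$ with $z^{n+1}=0$, i.e. with $\mathbb{F}_p$-basis $z,z^2,\dots,z^n$ (and $z^iz^j=z^{i+j}$, which is $0$ if $i+j>n$). A primitive algebra structure on $G$ is a multiplication on $(G,+)\cong(\mathbb{F}_p^n,+)$ making it isomorphic to this algebra. The group operation $\circ$ on $G$ is $a\circ b=a+b+a\cdot b$. Hopf Galois structures. For a finite-dimensional cocommutative $K$-Hopf algebra $H$ with counit $\epsilon$, a finite extension $L/K$ is $H$-Hopf Galois if $L$ is an $H$-module algebra and the map $L\otimes_K H\to\mathrm{End}_K(L)$, $x\otimes h\mapsto(y\mapsto x\,(hy))$, is bijective. The Galois correspondence $\mathcal F$ sends a $K$-sub-Hopf algebra $J$ of $H$ to the intermediate field $\mathcal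 F(J)=L^J=\{x\in L: hx=\epsilon(h)x\ \text{for all }h\in J\}$; by Chase–Sweedler it is injective. Correspondence of $A$ with $H$. $\mathrm{Perm}(\Gamma)$ is the permutation group of $\Gamma$, and $\lambda(\gamma)(\delta)=\gamma\delta$. A subgroup of $\mathrm{Perm}(\Gamma)$ is regular if it acts simply transitively. By Greither–Pareigis, Hopf Galois structures on $L/K$ correspond bijectively to regular subgroups $N$ of $\mathrm{Perm}(\Gamma)$ normalized by $\lambda(\Gamma)$: $N$ corresponds to $H=L[N]^\Gamma$, where $\Gamma$ acts on $L$ as Galois group and on $N$ by conjugation via $\lambda$, with action on $L$ given by $(\sum_\eta s_\eta\eta)x=\sum_\eta s_\eta\,\eta^{-1}(1_\Gamma)(x)$. Given an isomorphism $\xi:\Gamma\to(G,\circ)$, the algebra $A$ yields the regular embedding (injective homomorphism with regular image) $\alpha:(G,+)\to\mathrm{Perm}(\Gamma)$, $\alpha(g)(\gamma)=\xi^{-1}(g+\xi(\gamma))$, whose image is normalized by $\lambda(\Gamma)$; the Hopf Galois structure corresponding to $A$ is the one given by $N=\alpha(G)$. *)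

theory Defs
  imports
    Complex_Main
    "HOL-Library.Poly_Mapping"
    "HOL-Combinatorics.Permutations"
    "HOL-Algebra.Group"
    "HOL-Computational_Algebra.Primes"
begin

section \<open>Tensor products\<close>

text \<open>
  The finitely supported functions \<open>'x \<Rightarrow>\<^sub>0 'k\<close> are the free \<open>'k\<close>-module on \<open>'x\<close>.
  For a subspace \<open>U\<close> (with scalar multiplication \<open>sU\<close>) and a subspace \<open>V\<close> (with \<open>sV\<close>),
  the tensor product of \<open>U\<close> and \<open>V\<close> is the free module on \<open>U \<times> V\<close> modulo the bilinearity
  relations; its elements are represented as cosets of the submodule of relations.
\<close>

definition free_scale :: "'k::field \<Rightarrow> ('x \<Rightarrow>\<^sub>0 'k) \<Rightarrow> ('x \<Rightarrow>\<^sub>0 'k)" where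
  "free_scale c f = Poly_Mapping.map (\<lambda>x. c * x) f"

abbreviation pure2 :: "'u \<Rightarrow> 'v \<Rightarrow> ('u \<times> 'v \<Rightarrow>\<^sub>0 'k::field)" where
  "pure2 u v \<equiv> Poly_Mapping.single (u, v) 1"

abbreviation pure3 :: "'u \<Rightarrow> 'v \<Rightarrow> 'w \<Rightarrow> ('u \<times> 'v \<times> 'w \<Rightarrow>\<^sub>0 'k::field)" where
  "pure3 u v w \<equiv> Poly_Mapping.single (u, v, w) 1"

definition lin_ext :: "('k::field \<Rightarrow> 'w::ab_group_add \<Rightarrow> 'w) \<Rightarrow> ('x \<Rightarrow> 'w) \<Rightarrow> ('x \<Rightarrow>\<^sub>0 'k) \<Rightarrow> 'w" where
  "lin_ext sW b f = (\<Sum>x\<in>Poly_Mapping.keys f. sW (Poly_Mapping.lookup f x) (b x))"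

definition tensor_rel ::
  "('k::field \<Rightarrow> 'u::ab_group_add \<Rightarrow> 'u) \<Rightarrow> 'u set \<Rightarrow>
   ('k \<Rightarrow> 'v::ab_group_add \<Rightarrow> 'v) \<Rightarrow> 'v set \<Rightarrow> ('u \<times> 'v \<Rightarrow>\<^sub>0 'k) set" where
  "tensor_rel sU U sV V = module.span free_scale
    ({pure2 (u + u') v - pure2 u v - pure2 u' v | u u' v. u \<in> U \<and> u' \<in> U \<and> v \<in> V} \<union>
     {pure2 u (v + v') - pure2 u v - pure2 u v' | u v v'. u \<in> U \<and> v \<in> V \<and> v' \<in> V} \<union>
     {pure2 (sU c u) v - free_scale c (pure2 u v) | c u v. u \<in> U \<and> v \<in> V} \<union>
     {pure2 u (sV c v) - free_scale c (pure2 u v) | c u v. u \<in> U \<and> v \<in> V})"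

definition tensor_rel3 ::
  "('k::field \<Rightarrow> 'u::ab_group_add \<Rightarrow> 'u) \<Rightarrow> 'u set \<Rightarrow> ('u \<times> 'u \<times> 'u \<Rightarrow>\<^sub>0 'k) set" where
  "tensor_rel3 s U = module.span free_scale
    ({pure3 (u + u') v w - pure3 u v w - pure3 u' v w | u u' v w.
        u \<in> U \<and> u' \<in> U \<and> v \<in> U \<and> w \<in> U} \<union>
     {pure3 u (v + v') w - pure3 u v w - pure3 u v' w | u v v' w.
        u \<in> U \<and> v \<in> U \<and> v' \<in> U \<and> w \<in> U} \<union>
     {pure3 u v (w + w') - pure3 u v w - pure3 u v w' | u v w w'.
        u \<in> U \<and> v \<in> U \<and> w \<in> U \<and> w' \<in> U} \<union>
     {pure3 (s c u) v w - free_scale c (pure3 u v w) | c u v w. u \<in> U \<and> v \<in> U \<and> w \<in> U} \<union>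
     {pure3 u (s c v) w - free_scale c (pure3 u v w) | c u v w. u \<in> U \<and> v \<in> U \<and> w \<in> U} \<union>
     {pure3 u v (s c w) - free_scale c (pure3 u v w) | c u v w. u \<in> U \<and> v \<in> U \<and> w \<in> U})"

definition coset :: "'a::ab_group_add set \<Rightarrow> 'a \<Rightarrow> 'a set" where
  "coset R f = {g. g - f \<in> R}"

definition tensor ::
  "('k::field \<Rightarrow> 'u::ab_group_add \<Rightarrow> 'u) \<Rightarrow> 'u set \<Rightarrow>
   ('k \<Rightarrow> 'v::ab_group_add \<Rightarrow> 'v) \<Rightarrow> 'v set \<Rightarrow> ('u \<times> 'v \<Rightarrow>\<^sub>0 'k) set set" where
  "tensor sU U sV V = {coset (tensor_rel sU U sV V) f | f. Poly_Mapping.keys f \<subseteq> U \<times> V}"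

text \<open>
  A chosen representative of a tensor as a formal sum. It is only used in expressions
  whose value does not depend on the choice: the value of \<open>tensor_eval sW b t\<close> depends only
  on \<open>t\<close> as soon as \<open>b\<close> is bilinear (possibly only modulo the relations of a further
  tensor product, whose coset is then formed). In Sweedler notation, \<open>tensor_eval sW b t\<close>
  is the sum of the \<open>b t\<^sub>1 t\<^sub>2\<close>.
\<close>

definition rep :: "'a set \<Rightarrow> 'a" where
  "rep t = (SOME f. f \<in> t)"

definition tensor_eval ::
  "('k::field \<Rightarrow> 'w::ab_group_add \<Rightarrow> 'w) \<Rightarrow> ('u \<Rightarrow> 'v \<Rightarrow> 'w) \<Rightarrow> ('u \<times> 'v \<Rightarrow>\<^sub>0 'k) set \<Rightarrow> 'w" where
  "tensor_eval sW b t = lin_ext sW (\<lambda>(u, v). b u v) (rep t)"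


section \<open>Hopf algebras\<close>

text \<open>
  The underlying set \<open>carrier H\<close> is a subspace of an ambient vector space of type \<open>'h\<close>,
  from which the addition is taken.
\<close>

record (overloaded) ('k, 'h) hopf = "'h monoid" +
  scale :: "'k \<Rightarrow> 'h \<Rightarrow> 'h"
  comult :: "'h \<Rightarrow> ('h \<times> 'h \<Rightarrow>\<^sub>0 'k) set"
  counit :: "'h \<Rightarrow> 'k"
  antipode :: "'h \<Rightarrow> 'h"

definition hopf_tensor :: "('k::field, 'h::ab_group_add) hopf \<Rightarrow> ('h \<times> 'h \<Rightarrow>\<^sub>0 'k) set set" where
  "hopf_tensor H = tensor (scale H) (carrier H) (scale H) (carrier H)"

definition tclass :: "('k::field, 'h::ab_group_add) hopf \<Rightarrow> ('h \<times> 'h \<Rightarrow>\<^sub>0 'k) \<Rightarrow> ('h \<times> 'h \<Rightarrow>\<^sub>0 'k) set" where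
  "tclass H = coset (tensor_rel (scale H) (carrier H) (scale H) (carrier H))"

definition tclass3 ::
  "('k::field, 'h::ab_group_add) hopf \<Rightarrow> ('h \<times> 'h \<times> 'h \<Rightarrow>\<^sub>0 'k) \<Rightarrow> ('h \<times> 'h \<times> 'h \<Rightarrow>\<^sub>0 'k) set" where
  "tclass3 H = coset (tensor_rel3 (scale H) (carrier H))"

locale assoc_unital_algebra =
  fixes H :: "('k::field, 'h::ab_group_add) hopf" (structure)
  assumes vector_space: "vector_space (scale H)"
    and subspace: "module.subspace (scale H) (carrier H)"
    and monoid: "monoid H"
    and distrib_left:
      "\<lbrakk>x \<in> carrier H; y \<in> carrier H; z \<in> carrier H\<rbrakk> \<Longrightarrow> x \<otimes> (y + z) = x \<otimes> y + x \<otimes> z"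
    and distrib_right:
      "\<lbrakk>x \<in> carrier H; y \<in> carrier H; z \<in> carrier H\<rbrakk> \<Longrightarrow> (x + y) \<otimes> z = x \<otimes> z + y \<otimes> z"
    and scale_left:
      "\<lbrakk>x \<in> carrier H; y \<in> carrier H\<rbrakk> \<Longrightarrow> scale H c x \<otimes> y = scale H c (x \<otimes> y)"
    and scale_right:
      "\<lbrakk>x \<in> carrier H; y \<in> carrier H\<rbrakk> \<Longrightarrow> x \<otimes> scale H c y = scale H c (x \<otimes> y)"

locale coalgebra =
  fixes H :: "('k::field, 'h::ab_group_add) hopf" (structure)
  assumes comult_closed: "x \<in> carrier H \<Longrightarrow> comult H x \<in> hopf_tensor H"
    and comult_add:
      "\<lbrakk>x \<in> carrier H; y \<in> carrier H\<rbrakk> \<Longrightarrow>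
        comult H (x + y) = tclass H (rep (comult H x) + rep (comult H y))"
    and comult_scale:
      "x \<in> carrier H \<Longrightarrow> comult H (scale H c x) = tclass H (free_scale c (rep (comult H x)))"
    and counit_add:
      "\<lbrakk>x \<in> carrier H; y \<in> carrier H\<rbrakk> \<Longrightarrow> counit H (x + y) = counit H x + counit H y"
    and counit_scale: "x \<in> carrier H \<Longrightarrow> counit H (scale H c x) = c * counit H x"
    and coassoc:
      "x \<in> carrier H \<Longrightarrow>
        tclass3 H (tensor_eval free_scale
          (\<lambda>a b. tensor_eval free_scale (\<lambda>a1 a2. pure3 a1 a2 b) (comult H a)) (comult H x)) =
        tclass3 H (tensor_eval free_scale
          (\<lambda>a b. tensor_eval free_scale (\<lambda>b1 b2. pure3 a b1 b2) (comult H b)) (comult H x))"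
    and counit_left:
      "x \<in> carrier H \<Longrightarrow> tensor_eval (scale H) (\<lambda>a b. scale H (counit H a) b) (comult H x) = x"
    and counit_right:
      "x \<in> carrier H \<Longrightarrow> tensor_eval (scale H) (\<lambda>a b. scale H (counit H b) a) (comult H x) = x"

locale hopf_algebra = assoc_unital_algebra H + coalgebra H
  for H :: "('k::field, 'h::ab_group_add) hopf" (structure) +
  assumes comult_one: "comult H \<one> = tclass H (pure2 \<one> \<one>)"
    and comult_mult:
      "\<lbrakk>x \<in> carrier H; y \<in> carrier H\<rbrakk> \<Longrightarrow>
        comult H (x \<otimes> y) =
        tclass H (tensor_eval free_scale
          (\<lambda>a b. tensor_eval free_scale (\<lambda>c d. pure2 (a \<otimes> c) (b \<otimes> d)) (comult H y)) (comult H x))"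
    and counit_one: "counit H \<one> = 1"
    and counit_mult:
      "\<lbrakk>x \<in> carrier H; y \<in> carrier H\<rbrakk> \<Longrightarrow> counit H (x \<otimes> y) = counit H x * counit H y"
    and antipode_closed: "x \<in> carrier H \<Longrightarrow> antipode H x \<in> carrier H"
    and antipode_add:
      "\<lbrakk>x \<in> carrier H; y \<in> carrier H\<rbrakk> \<Longrightarrow> antipode H (x + y) = antipode H x + antipode H y"
    and antipode_scale:
      "x \<in> carrier H \<Longrightarrow> antipode H (scale H c x) = scale H c (antipode H x)"
    and antipode_left:
      "x \<in> carrier H \<Longrightarrow>
        tensor_eval (scale H) (\<lambda>a b. antipode H a \<otimes> b) (comult H x) = scale H (counit H x) \<one>"
    and antipode_right:
      "x \<in> carrier H \<Longrightarrow>
        tensor_eval (scale H) (\<lambda>a b. a \<otimes> antipode H b) (comult H x) = scale H (counit H x) \<one>"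

definition cocommutative :: "('k::field, 'h::ab_group_add) hopf \<Rightarrow> bool" where
  "cocommutative H \<longleftrightarrow>
    (\<forall>x\<in>carrier H. comult H x = tclass H (tensor_eval free_scale (\<lambda>a b. pure2 b a) (comult H x)))"

definition finite_dim :: "('k::field \<Rightarrow> 'v::ab_group_add \<Rightarrow> 'v) \<Rightarrow> 'v set \<Rightarrow> bool" where
  "finite_dim s V \<longleftrightarrow> (\<exists>B. finite B \<and> module.span s B = V)"

text \<open>
  The condition on the comultiplication says that it maps \<open>J\<close> into the image of the tensor
  square of \<open>J\<close> in that of \<open>H\<close> (these may be identified, the base ring being a field).
\<close>

definition sub_hopf_algebra :: "('k::field, 'h::ab_group_add) hopf \<Rightarrow> 'h set \<Rightarrow> bool" where
  "sub_hopf_algebra H J \<longleftrightarrow>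
    J \<subseteq> carrier H \<and> module.subspace (scale H) J \<and>
    \<one>\<^bsub>H\<^esub> \<in> J \<and> (\<forall>x\<in>J. \<forall>y\<in>J. x \<otimes>\<^bsub>H\<^esub> y \<in> J) \<and>
    (\<forall>x\<in>J. \<exists>f. Poly_Mapping.keys f \<subseteq> J \<times> J \<and> comult H x = tclass H f) \<and>
    (\<forall>x\<in>J. antipode H x \<in> J)"


section \<open>Galois extensions and Hopf Galois structures\<close>

text \<open>A field extension is given by its embedding \<open>emb\<close> of the base field \<open>'k\<close> into \<open>'l\<close>.\<close>

definition field_embedding :: "('k::field \<Rightarrow> 'l::field) \<Rightarrow> bool" where
  "field_embedding emb \<longleftrightarrow>
    emb 1 = 1 \<and> (\<forall>x y. emb (x + y) = emb x + emb y) \<and> (\<forall>x y. emb (x * y) = emb x * emb y)"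

definition ext_scale :: "('k::field \<Rightarrow> 'l::field) \<Rightarrow> 'k \<Rightarrow> 'l \<Rightarrow> 'l" where
  "ext_scale emb c x = emb c * x"

definition Gal :: "('k::field \<Rightarrow> 'l::field) \<Rightarrow> ('l \<Rightarrow> 'l) set" where
  "Gal emb = {\<sigma>. bij \<sigma> \<and> (\<forall>x y. \<sigma> (x + y) = \<sigma> x + \<sigma> y) \<and> (\<forall>x y. \<sigma> (x * y) = \<sigma> x * \<sigma> y) \<and>
    (\<forall>c. \<sigma> (emb c) = emb c)}"

definition galois_group :: "('k::field \<Rightarrow> 'l::field) \<Rightarrow> ('l \<Rightarrow> 'l) monoid" where
  "galois_group emb = \<lparr>carrier = Gal emb, mult = (\<circ>), one = id\<rparr>"

text \<open>Galois in the sense of Artin: finite, with the base field as fixed field of the automorphisms.\<close>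

definition galois_extension :: "('k::field \<Rightarrow> 'l::field) \<Rightarrow> bool" where
  "galois_extension emb \<longleftrightarrow>
    field_embedding emb \<and> finite_dim (ext_scale emb) UNIV \<and>
    {x. \<forall>\<sigma>\<in>Gal emb. \<sigma> x = x} = range emb"

definition intermediate_field :: "('k::field \<Rightarrow> 'l::field) \<Rightarrow> 'l set \<Rightarrow> bool" where
  "intermediate_field emb F \<longleftrightarrow>
    range emb \<subseteq> F \<and> (\<forall>x\<in>F. \<forall>y\<in>F. x - y \<in> F \<and> x * y \<in> F) \<and> (\<forall>x\<in>F. inverse x \<in> F)"

definition module_algebra ::
  "('k::field \<Rightarrow> 'l::field) \<Rightarrow> ('k, 'h::ab_group_add) hopf \<Rightarrow> ('h \<Rightarrow> 'l \<Rightarrow> 'l) \<Rightarrow> bool" where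
  "module_algebra emb H act \<longleftrightarrow>
    (\<forall>h\<in>carrier H. \<forall>x y. act h (x + y) = act h x + act h y) \<and>
    (\<forall>h\<in>carrier H. \<forall>k\<in>carrier H. \<forall>x. act (h + k) x = act h x + act k x) \<and>
    (\<forall>h\<in>carrier H. \<forall>c x. act (scale H c h) x = emb c * act h x \<and> act h (emb c * x) = emb c * act h x) \<and>
    (\<forall>x. act \<one>\<^bsub>H\<^esub> x = x) \<and>
    (\<forall>h\<in>carrier H. \<forall>k\<in>carrier H. \<forall>x. act (h \<otimes>\<^bsub>H\<^esub> k) x = act h (act k x)) \<and>
    (\<forall>h\<in>carrier H. \<forall>x y.
      act h (x * y) = tensor_eval (ext_scale emb) (\<lambda>a b. act a x * act b y) (comult H h)) \<and>
    (\<forall>h\<in>carrier H. act h 1 = emb (counit H h))"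

definition hopf_galois ::
  "('k::field \<Rightarrow> 'l::field) \<Rightarrow> ('k, 'h::ab_group_add) hopf \<Rightarrow> ('h \<Rightarrow> 'l \<Rightarrow> 'l) \<Rightarrow> bool" where
  "hopf_galois emb H act \<longleftrightarrow>
    field_embedding emb \<and> finite_dim (ext_scale emb) UNIV \<and>
    hopf_algebra H \<and> cocommutative H \<and> finite_dim (scale H) (carrier H) \<and>
    module_algebra emb H act \<and>
    bij_betw (\<lambda>t y. tensor_eval (ext_scale emb) (\<lambda>x h. x * act h y) t)
      (tensor (ext_scale emb) UNIV (scale H) (carrier H))
      {\<phi>. Vector_Spaces.linear (ext_scale emb) (ext_scale emb) \<phi>}"

definition fixed_field ::
  "('k::field \<Rightarrow> 'l::field) \<Rightarrow> ('k, 'h::ab_group_add) hopf \<Rightarrow> ('h \<Rightarrow> 'l \<Rightarrow> 'l) \<Rightarrow> 'h set \<Rightarrow> 'l set" where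
  "fixed_field emb H act J = {x. \<forall>h\<in>J. act h x = emb (counit H h) * x}"


section \<open>The Greither--Pareigis construction\<close>

text \<open>
  A permutation of a set \<open>S\<close> is a function on the whole type which is the identity outside \<open>S\<close>.
  Inverses of permutations are written \<open>inv_into UNIV\<close>.
\<close>

definition perm_group :: "'a set \<Rightarrow> ('a \<Rightarrow> 'a) monoid" where
  "perm_group S = \<lparr>carrier = {\<pi>. \<pi> permutes S}, mult = (\<circ>), one = id\<rparr>"

definition regular_subgroup :: "'a set \<Rightarrow> ('a \<Rightarrow> 'a) set \<Rightarrow> bool" where
  "regular_subgroup S N \<longleftrightarrow>
    subgroup N (perm_group S) \<and> (\<forall>x\<in>S. \<forall>y\<in>S. \<exists>!\<eta>. \<eta> \<in> N \<and> \<eta> x = y)"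

definition left_regular :: "('k::field \<Rightarrow> 'l::field) \<Rightarrow> ('l \<Rightarrow> 'l) \<Rightarrow> ('l \<Rightarrow> 'l) \<Rightarrow> ('l \<Rightarrow> 'l)" where
  "left_regular emb \<gamma> = (\<lambda>\<delta>. if \<delta> \<in> Gal emb then \<gamma> \<circ> \<delta> else \<delta>)"

definition conj_left ::
  "('k::field \<Rightarrow> 'l::field) \<Rightarrow> ('l \<Rightarrow> 'l) \<Rightarrow> (('l \<Rightarrow> 'l) \<Rightarrow> ('l \<Rightarrow> 'l)) \<Rightarrow> (('l \<Rightarrow> 'l) \<Rightarrow> ('l \<Rightarrow> 'l))" where
  "conj_left emb \<gamma> \<eta> = left_regular emb \<gamma> \<circ> \<eta> \<circ> inv_into UNIV (left_regular emb \<gamma>)"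

definition normalized_by_left ::
  "('k::field \<Rightarrow> 'l::field) \<Rightarrow> (('l \<Rightarrow> 'l) \<Rightarrow> ('l \<Rightarrow> 'l)) set \<Rightarrow> bool" where
  "normalized_by_left emb N \<longleftrightarrow> (\<forall>\<gamma>\<in>Gal emb. conj_left emb \<gamma> ` N = N)"

definition group_algebra :: "('a \<Rightarrow> 'a) set \<Rightarrow> ('l::field, ('a \<Rightarrow> 'a) \<Rightarrow>\<^sub>0 'l) hopf" where
  "group_algebra N =
    (let A = {s. Poly_Mapping.keys s \<subseteq> N} in
     \<lparr>carrier = A,
      mult = (\<lambda>s t. \<Sum>\<eta>\<in>Poly_Mapping.keys s. \<Sum>\<theta>\<in>Poly_Mapping.keys t.
        Poly_Mapping.single (\<eta> \<circ> \<theta>) (Poly_Mapping.lookup s \<eta> * Poly_Mapping.lookup t \<theta>)),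
      one = Poly_Mapping.single id 1,
      scale = free_scale,
      comult = (\<lambda>s. coset (tensor_rel free_scale A free_scale A)
        (lin_ext free_scale (\<lambda>\<eta>. pure2 (Poly_Mapping.single \<eta> 1) (Poly_Mapping.single \<eta> 1)) s)),
      counit = (\<lambda>s. \<Sum>\<eta>\<in>Poly_Mapping.keys s. Poly_Mapping.lookup s \<eta>),
      antipode = lin_ext free_scale (\<lambda>\<eta>. Poly_Mapping.single (inv_into UNIV \<eta>) 1)\<rparr>)"

definition gal_act ::
  "('k::field \<Rightarrow> 'l::field) \<Rightarrow> ('l \<Rightarrow> 'l) \<Rightarrow>
   ((('l \<Rightarrow> 'l) \<Rightarrow> ('l \<Rightarrow> 'l)) \<Rightarrow>\<^sub>0 'l) \<Rightarrow> ((('l \<Rightarrow> 'l) \<Rightarrow> ('l \<Rightarrow> 'l)) \<Rightarrow>\<^sub>0 'l)" where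
  "gal_act emb \<gamma> s = (\<Sum>\<eta>\<in>Poly_Mapping.keys s.
    Poly_Mapping.single (conj_left emb \<gamma> \<eta>) (\<gamma> (Poly_Mapping.lookup s \<eta>)))"

text \<open>
  The \<open>K\<close>-Hopf algebra \<open>H = L[N]\<^sup>\<Gamma>\<close>. Its structure maps are those of the \<open>L\<close>-Hopf algebra \<open>L[N]\<close>,
  restricted to \<open>H\<close>: the comultiplication of \<open>h\<close> is the tensor over \<open>K\<close> that is mapped to the
  comultiplication of \<open>h\<close> in \<open>L[N]\<close> by the canonical map from the tensor square of \<open>H\<close>
  over \<open>K\<close> to the tensor square of \<open>L[N]\<close> over \<open>L\<close>.
\<close>

definition gp_hopf ::
  "('k::field \<Rightarrow> 'l::field) \<Rightarrow> (('l \<Rightarrow> 'l) \<Rightarrow> ('l \<Rightarrow> 'l)) set \<Rightarrow>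
   ('k, (('l \<Rightarrow> 'l) \<Rightarrow> ('l \<Rightarrow> 'l)) \<Rightarrow>\<^sub>0 'l) hopf" where
  "gp_hopf emb N =
    (let LN = group_algebra N;
         C = {s \<in> carrier LN. \<forall>\<gamma>\<in>Gal emb. gal_act emb \<gamma> s = s};
         sc = (\<lambda>c. free_scale (emb c))
     in
     \<lparr>carrier = C,
      mult = mult LN,
      one = one LN,
      scale = sc,
      comult = (\<lambda>h. THE t. t \<in> tensor sc C sc C \<and>
        tclass LN (tensor_eval (\<lambda>c. free_scale (emb c)) (\<lambda>a b. pure2 a b) t) = comult LN h),
      counit = (\<lambda>h. THE c. emb c = counit LN h),
      antipode = antipode LN\<rparr>)"

definition gp_act ::
  "((('l \<Rightarrow> 'l) \<Rightarrow> ('l \<Rightarrow> 'l)) \<Rightarrow>\<^sub>0 'l::field) \<Rightarrow> 'l \<Rightarrow> 'l" where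
  "gp_act s x = (\<Sum>\<eta>\<in>Poly_Mapping.keys s. Poly_Mapping.lookup s \<eta> * (inv_into UNIV \<eta> id) x)"


section \<open>Primitive nilpotent algebras\<close>

definition elementary_abelian :: "nat \<Rightarrow> nat \<Rightarrow> 'g::ab_group_add itself \<Rightarrow> bool" where
  "elementary_abelian p n _ \<longleftrightarrow> card (UNIV :: 'g set) = p ^ n \<and> (\<forall>g::'g. (\<Sum>i<p. g) = 0)"

text \<open>
  The primitive algebra: \<open>a\<close> stands for the sum of the \<open>a k z\<^sup>k\<close> over \<open>1 \<le> k \<le> n\<close>, the
  coefficients being residues modulo \<open>p\<close>.
\<close>

definition prim_carrier :: "nat \<Rightarrow> nat \<Rightarrow> (nat \<Rightarrow> int) set" where
  "prim_carrier p n =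
    {a. (\<forall>k\<in>{1..n}. 0 \<le> a k \<and> a k < int p) \<and> (\<forall>k. k \<notin> {1..n} \<longrightarrow> a k = 0)}"

definition prim_add :: "nat \<Rightarrow> (nat \<Rightarrow> int) \<Rightarrow> (nat \<Rightarrow> int) \<Rightarrow> (nat \<Rightarrow> int)" where
  "prim_add p a b = (\<lambda>k. (a k + b k) mod int p)"

definition prim_mult :: "nat \<Rightarrow> nat \<Rightarrow> (nat \<Rightarrow> int) \<Rightarrow> (nat \<Rightarrow> int) \<Rightarrow> (nat \<Rightarrow> int)" where
  "prim_mult p n a b = (\<lambda>k. if k \<in> {1..n} then (\<Sum>i=1..<k. a i * b (k - i)) mod int p else 0)"

text \<open>Additive maps between elementary abelian \<open>p\<close>-groups are linear over the prime field.\<close>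

definition primitive_algebra_structure :: "nat \<Rightarrow> nat \<Rightarrow> ('g::ab_group_add \<Rightarrow> 'g \<Rightarrow> 'g) \<Rightarrow> bool" where
  "primitive_algebra_structure p n mul \<longleftrightarrow>
    (\<exists>\<phi>. bij_betw \<phi> (prim_carrier p n) UNIV \<and>
      (\<forall>a\<in>prim_carrier p n. \<forall>b\<in>prim_carrier p n.
        \<phi> (prim_add p a b) = \<phi> a + \<phi> b \<and> \<phi> (prim_mult p n a b) = mul (\<phi> a) (\<phi> b)))"

definition additive_group :: "'g::ab_group_add monoid" where
  "additive_group = \<lparr>carrier = UNIV, mult = (+), one = 0\<rparr>"

definition circle_group :: "('g::ab_group_add \<Rightarrow> 'g \<Rightarrow> 'g) \<Rightarrow> 'g monoid" where
  "circle_group mul = \<lparr>carrier = UNIV, mult = (\<lambda>a b. a + b + mul a b), one = 0\<rparr>"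

definition alpha ::
  "('k::field \<Rightarrow> 'l::field) \<Rightarrow> (('l \<Rightarrow> 'l) \<Rightarrow> 'g::ab_group_add) \<Rightarrow> 'g \<Rightarrow> (('l \<Rightarrow> 'l) \<Rightarrow> ('l \<Rightarrow> 'l))" where
  "alpha emb \<xi> g = (\<lambda>\<gamma>. if \<gamma> \<in> Gal emb then inv_into (Gal emb) \<xi> (g + \<xi> \<gamma>) else \<gamma>)"

definition regular_embedding ::
  "('k::field \<Rightarrow> 'l::field) \<Rightarrow> ('g::ab_group_add \<Rightarrow> (('l \<Rightarrow> 'l) \<Rightarrow> ('l \<Rightarrow> 'l))) \<Rightarrow> bool" where
  "regular_embedding emb \<alpha> \<longleftrightarrow>
    \<alpha> \<in> hom additive_group (perm_group (Gal emb)) \<and> inj \<alpha> \<and> regular_subgroup (Gal emb) (range \<alpha>)"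

end

theory Submission
  imports Defs "HOL-Number_Theory.Cong"
begin

text \<open>
  Elements of \<open>L[N]\<close> are functions on \<open>N\<close>, and \<open>H = L[N]\<^sup>\<Gamma>\<close> consists of the equivariant ones. All descent
  from \<open>L\<close> to \<open>K\<close> is made explicit by Galois coordinates: finite families \<open>c\<^sub>i, d\<^sub>i\<close> in \<open>L\<close> with
  \<open>\<Sum>\<^sub>i d\<^sub>i \<gamma>(c\<^sub>i) = 0\<close> for \<open>\<gamma> \<noteq> 1\<close> and \<open>1\<close> for \<open>\<gamma> = 1\<close>. They show that \<open>H \<otimes> H\<close> embeds into the functions
  on \<open>N \<times> N\<close>, so that identities between tensors can be checked by evaluation. The \<open>L\<close>-span of a sub-Hopf
  algebra is spanned by the elements of \<open>N\<close> that it contains, whence the sub-Hopf algebras are the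
  \<open>L[M]\<^sup>\<Gamma>\<close> for the \<open>\<Gamma>\<close>-stable subgroups \<open>M\<close> of \<open>N\<close>. For \<open>N = \<alpha>(G)\<close>, the automorphism \<open>\<gamma>\<close> acts on \<open>G\<close> as
  multiplication by \<open>1 + \<xi>(\<gamma>)\<close>, so these are the ideals of \<open>A\<close>, that is, the powers of \<open>A\<close>.
  Distinct \<open>M\<close> have distinct fixed fields by linear independence of automorphisms.
\<close>

section \<open>Linear algebra of formal sums\<close>

text \<open>Tensors are cosets of formal sums read through an arbitrary representative, and the
  coproduct of \<open>gp_hopf\<close> is a definite description, so nothing computes until
  congruence of formal sums can be tested. A frame suffices for that: given vectors together with
  functionals that supply the coefficients of an expansion. No basis of \<open>L\<close> or
  \<open>H\<close> over \<open>K\<close> is ever chosen; the \<open>d i\<close> with the functionals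
  \<open>trK (c i * x)\<close> form a frame of \<open>L\<close>. The coordinates also isolate one
  automorphism in a sum of several, which yields Dedekind independence and, with it, distinct fixed
  fields without the classical Galois correspondence. On the side of \<open>A\<close>: \<xi> is
  onto, so stability under all multiplications by 1 + \<xi>(\<gamma>) is stability under
  multiplication by all of \<open>A\<close>; and leading coefficients are invertible modulo p, so an
  ideal is determined by the least order of its elements.\<close>

type_synonym 'l perm = "('l \<Rightarrow> 'l) \<Rightarrow> ('l \<Rightarrow> 'l)"

abbreviation lookup :: "('a \<Rightarrow>\<^sub>0 'b::zero) \<Rightarrow> 'a \<Rightarrow> 'b" where "lookup \<equiv> Poly_Mapping.lookup"
abbreviation keys :: "('a \<Rightarrow>\<^sub>0 'b::zero) \<Rightarrow> 'a set" where "keys \<equiv> Poly_Mapping.keys"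
abbreviation single :: "'a \<Rightarrow> 'b \<Rightarrow> 'a \<Rightarrow>\<^sub>0 'b::zero" where "single \<equiv> Poly_Mapping.single"

lemma lookup_free_scale [simp]:
  "lookup (free_scale c f) x = c * lookup f x"
  by (simp add: free_scale_def Poly_Mapping.map.rep_eq when_def)

lemma free_scale_single [simp]:
  "free_scale c (single x d) = single x (c * d)"
  by (rule poly_mapping_eqI) (simp add: lookup_single when_def)

interpretation free: vector_space "free_scale :: 'k::field \<Rightarrow> ('x \<Rightarrow>\<^sub>0 'k) \<Rightarrow> _"
  by unfold_locales (auto intro!: poly_mapping_eqI simp: lookup_add algebra_simps)

lemma keys_free_scale: "keys (free_scale c f) \<subseteq> keys f"
  by (auto simp: in_keys_iff)

lemma vector_space_times: "vector_space ((*) :: 'k::field \<Rightarrow> 'k \<Rightarrow> 'k)"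
  by unfold_locales (auto simp: algebra_simps)

lemma subspace_keys: "free.subspace {f :: 'x \<Rightarrow>\<^sub>0 'k::field. keys f \<subseteq> S}"
proof (rule free.subspaceI)
  fix f g :: "'x \<Rightarrow>\<^sub>0 'k" and c
  assume f: "f \<in> {f. keys f \<subseteq> S}" and g: "g \<in> {f. keys f \<subseteq> S}"
  show "f + g \<in> {f. keys f \<subseteq> S}"
    using f g keys_add[of f g] by blast
  show "free_scale c f \<in> {f. keys f \<subseteq> S}"
    using f keys_free_scale[of c f] by blast
qed simp

lemma sum_single_lookup:
  assumes "finite S" "keys f \<subseteq> S"
  shows "f = (\<Sum>x\<in>S. single x (lookup f x))"
  using assms
  by (auto intro!: poly_mapping_eqI simp: lookup_sum lookup_single when_def in_keys_iff)

text \<open>Linearity is relative to a subset because carriers are subsets of an ambient type,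
  whereas \<open>module_hom\<close> speaks of whole types.\<close>

definition linear_map_on ::
  "('k::field \<Rightarrow> 'u::ab_group_add \<Rightarrow> 'u) \<Rightarrow> 'u set \<Rightarrow> ('k \<Rightarrow> 'w::ab_group_add \<Rightarrow> 'w) \<Rightarrow> ('u \<Rightarrow> 'w) \<Rightarrow> bool" where
  "linear_map_on sU U sW F \<longleftrightarrow>
    (\<forall>x\<in>U. \<forall>y\<in>U. F (x + y) = F x + F y) \<and> (\<forall>c. \<forall>x\<in>U. F (sU c x) = sW c (F x))"

lemma linear_map_on_sum:
  assumes "vector_space sU" "vector_space sW" "module.subspace sU U" "linear_map_on sU U sW F"
    and "\<And>i. i \<in> I \<Longrightarrow> g i \<in> U"
  shows "F (\<Sum>i\<in>I. g i) = (\<Sum>i\<in>I. F (g i))"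
proof -
  interpret u: vector_space sU by fact
  interpret w: vector_space sW by fact
  have F0: "F 0 = 0"
    using assms(4) u.subspace_0[OF assms(3)] unfolding linear_map_on_def
    by (metis u.scale_zero_left w.scale_zero_left)
  show ?thesis
    using assms(5)
  proof (induction I rule: infinite_finite_induct)
    case (insert i I)
    then have "(\<Sum>i\<in>I. g i) \<in> U" by (intro u.subspace_sum assms(3)) auto
    with insert assms(4) show ?case by (simp add: linear_map_on_def)
  qed (simp_all add: F0)
qed

context
  fixes s :: "'k::field \<Rightarrow> 'w::ab_group_add \<Rightarrow> 'w"
  assumes vs: "vector_space s"
begin

interpretation w: vector_space s by (rule vs)

lemma lin_ext_superset:
  assumes "finite S" "keys f \<subseteq> S"
  shows "lin_ext s b f = (\<Sum>x\<in>S. s (lookup f x) (b x))"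
  unfolding lin_ext_def using assms
  by (intro sum.mono_neutral_left) (auto simp: in_keys_iff)

lemma lin_ext_zero [simp]: "lin_ext s b 0 = 0"
  by (simp add: lin_ext_def)

lemma lin_ext_single: "lin_ext s b (single x c) = s c (b x)"
  by (simp add: lin_ext_superset[of "{x}"])

lemma lin_ext_add: "lin_ext s b (f + g) = lin_ext s b f + lin_ext s b g"
  using lin_ext_superset[of "keys f \<union> keys g"] keys_add[of f g]
  by (simp add: lookup_add w.scale_left_distrib sum.distrib)

lemma lin_ext_scale: "lin_ext s b (free_scale c f) = s c (lin_ext s b f)"
  using lin_ext_superset[of "keys f"] keys_free_scale[of c f]
  by (simp add: w.scale_sum_right)

lemma lin_ext_diff: "lin_ext s b (f - g) = lin_ext s b f - lin_ext s b g"
  using lin_ext_add[of b "f - g" g] by simp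

lemma lin_ext_sum: "lin_ext s b (\<Sum>i\<in>I. f i) = (\<Sum>i\<in>I. lin_ext s b (f i))"
  by (induction I rule: infinite_finite_induct) (simp_all add: lin_ext_add)

lemma linear_map_on_lin_ext: "linear_map_on free_scale U s (lin_ext s b)"
  by (simp add: linear_map_on_def lin_ext_add lin_ext_scale)

lemma lin_ext_in_subspace:
  assumes "module.subspace s U" "\<And>x. x \<in> keys f \<Longrightarrow> b x \<in> U"
  shows "lin_ext s b f \<in> U"
  unfolding lin_ext_def using assms by (intro w.subspace_sum w.subspace_scale)

lemma lin_ext_sum_right: "lin_ext s (\<lambda>x. \<Sum>i\<in>I. b i x) f = (\<Sum>i\<in>I. lin_ext s (b i) f)"
  unfolding lin_ext_def w.scale_sum_right by (rule sum.swap)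

lemma lin_ext_hom:
  assumes "vector_space s'" "module.subspace s U" "linear_map_on s U s' F"
    and "\<And>x. x \<in> keys f \<Longrightarrow> b x \<in> U"
  shows "F (lin_ext s b f) = lin_ext s' (\<lambda>x. F (b x)) f"
proof -
  have "F (lin_ext s b f) = (\<Sum>x\<in>keys f. F (s (lookup f x) (b x)))"
    unfolding lin_ext_def
    by (rule linear_map_on_sum[OF vs assms(1-3)]) (use assms(2,4) w.subspace_scale in blast)
  also have "\<dots> = lin_ext s' (\<lambda>x. F (b x)) f"
    unfolding lin_ext_def by (rule sum.cong) (use assms(3,4) in \<open>auto simp: linear_map_on_def\<close>)
  finally show ?thesis .
qed

lemma lin_ext_hom_UNIV:
  assumes "vector_space s'" "linear_map_on s UNIV s' F"
  shows "F (lin_ext s b f) = lin_ext s' (\<lambda>x. F (b x)) f"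
  using lin_ext_hom[OF assms(1) w.subspace_UNIV assms(2)] by simp

end

lemma lin_ext_cong:
  "(\<And>x. x \<in> keys f \<Longrightarrow> b x = b' x) \<Longrightarrow> lin_ext s b f = lin_ext s b' f"
  unfolding lin_ext_def by (rule sum.cong) auto

lemma lookup_lin_ext:
  "lookup (lin_ext free_scale b f) y = lin_ext (*) (\<lambda>x. lookup (b x) y) f"
  by (simp add: lin_ext_def lookup_sum)

section \<open>Tensor products\<close>

text \<open>The \<open>e i\<close> need not be linearly independent.\<close>

definition dual_frame ::
  "('k::field \<Rightarrow> 'u::ab_group_add \<Rightarrow> 'u) \<Rightarrow> 'u set \<Rightarrow> 'i set \<Rightarrow> ('i \<Rightarrow> 'u) \<Rightarrow> ('i \<Rightarrow> 'u \<Rightarrow> 'k) \<Rightarrow> bool" where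
  "dual_frame s U I e \<phi> \<longleftrightarrow>
    finite I \<and> (\<forall>i\<in>I. e i \<in> U \<and> linear_map_on s U (*) (\<phi> i)) \<and>
    (\<forall>u\<in>U. (\<Sum>i\<in>I. s (\<phi> i u) (e i)) = u)"

definition bilinear_map_on where
  "bilinear_map_on sU U sV V sW b \<longleftrightarrow>
    (\<forall>v\<in>V. linear_map_on sU U sW (\<lambda>u. b u v)) \<and> (\<forall>u\<in>U. linear_map_on sV V sW (b u))"

text \<open>For \<open>q\<close> the pure tensor as a function of one slot and \<open>R\<close> the
  relations, this permits expanding that slot in a frame modulo \<open>R\<close>.\<close>

lemma linear_mod_sum:
  assumes "vector_space s" "module.subspace s U" "vector_space sW" "module.subspace sW R"
    and add: "\<And>u u'. u \<in> U \<Longrightarrow> u' \<in> U \<Longrightarrow> q (u + u') - q u - q u' \<in> R"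
    and scale: "\<And>c u. u \<in> U \<Longrightarrow> q (s c u) - sW c (q u) \<in> R"
    and e: "\<And>i. i \<in> I \<Longrightarrow> e i \<in> U"
  shows "q (\<Sum>i\<in>I. s (c i) (e i)) - (\<Sum>i\<in>I. sW (c i) (q (e i))) \<in> R"
proof -
  interpret u: vector_space s by fact
  interpret w: vector_space sW by fact
  \<comment> \<open>Scaling by zero: \<open>q 0 - 0\<close> is one of the elements assumed to lie in
    \<open>R\<close>.\<close>
  have 0: "q 0 \<in> R"
    using scale[of 0 0] u.subspace_0[OF assms(2)] by simp
  show ?thesis
    using e
  proof (induction I rule: infinite_finite_induct)
    case (insert i I)
    have *: "(\<Sum>i\<in>I. s (c i) (e i)) \<in> U" "s (c i) (e i) \<in> U"
      using insert.prems assms(2) by (auto intro!: u.subspace_sum u.subspace_scale)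
    have "q (\<Sum>i\<in>insert i I. s (c i) (e i)) - (\<Sum>i\<in>insert i I. sW (c i) (q (e i))) =
      (q (s (c i) (e i) + (\<Sum>i\<in>I. s (c i) (e i))) - q (s (c i) (e i)) - q (\<Sum>i\<in>I. s (c i) (e i)))
      + (q (s (c i) (e i)) - sW (c i) (q (e i)))
      + (q (\<Sum>i\<in>I. s (c i) (e i)) - (\<Sum>i\<in>I. sW (c i) (q (e i))))"
      using insert.hyps by simp
    also have "\<dots> \<in> R"
      using insert * by (intro w.subspace_add assms(4) add scale) auto
    finally show ?case .
  qed (simp_all add: 0)
qed

lemma subspace_tensor_rel: "free.subspace (tensor_rel sU U sV V)"
  unfolding tensor_rel_def by (rule free.subspace_span)

lemma subspace_tensor_rel3: "free.subspace (tensor_rel3 s U)"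
  unfolding tensor_rel3_def by (rule free.subspace_span)

lemma lin_ext_tensor_rel:
  assumes "vector_space sW" "bilinear_map_on sU U sV V sW b" "f \<in> tensor_rel sU U sV V"
  shows "lin_ext sW (\<lambda>(u, v). b u v) f = 0"
proof -
  interpret w: vector_space sW by fact
  have sub: "free.subspace {f. lin_ext sW (\<lambda>(u, v). b u v) f = 0}"
    by (rule free.subspaceI)
      (auto simp: assms(1) lin_ext_zero lin_ext_add lin_ext_scale)
  have "tensor_rel sU U sV V \<subseteq> {f. lin_ext sW (\<lambda>(u, v). b u v) f = 0}"
    unfolding tensor_rel_def
    by (rule free.span_minimal[OF _ sub]) (use assms(2) in
      \<open>auto simp: lin_ext_diff[OF assms(1)] lin_ext_scale[OF assms(1)] lin_ext_single[OF assms(1)]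
        bilinear_map_on_def linear_map_on_def\<close>)
  then show ?thesis using assms(3) by auto
qed

text \<open>A coset of the relations could a priori contain formal sums with pairs outside
  \<open>U \<times> V\<close>. Excluding this is what keeps the entries of a representative chosen
  by \<open>rep\<close> inside the carriers (\<open>tensor_rep\<close>).\<close>

lemma keys_tensor_rel:
  assumes "vector_space sU" "module.subspace sU U" "vector_space sV" "module.subspace sV V"
    and "f \<in> tensor_rel sU U sV V"
  shows "keys f \<subseteq> U \<times> V"
proof -
  interpret u: vector_space sU by fact
  interpret v: vector_space sV by fact
  have *: "single (u, v) c \<in> {f. keys f \<subseteq> U \<times> V}"
    if "u \<in> U" "v \<in> V" for u v and c :: 'a using that by auto
  have "tensor_rel sU U sV V \<subseteq> {f. keys f \<subseteq> U \<times> V}"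
    unfolding tensor_rel_def
    by (rule free.span_minimal[OF _ subspace_keys], intro Un_least subsetI)
      (elim CollectE exE conjE, hypsubst, (intro free.subspace_diff[OF subspace_keys];
        (unfold free_scale_single)?; intro *; (assumption |
        rule u.subspace_add v.subspace_add u.subspace_scale v.subspace_scale assms)+))+
  then show ?thesis using assms(5) by auto
qed

lemma formal_sum_in_subspace:
  assumes "free.subspace P" "\<And>x. x \<in> keys f \<Longrightarrow> single x 1 \<in> P"
  shows "f \<in> P"
proof -
  have "(\<Sum>x\<in>keys f. free_scale (lookup f x) (single x 1)) \<in> P"
    by (intro free.subspace_sum assms(1) free.subspace_scale assms(2))
  then show ?thesis
    using sum_single_lookup[OF finite_keys order_refl, of f] by simp
qed

text \<open>Expand the first slot of a pure tensor in one frame, then the second slot in the other.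
  Both terms of the difference are linear in \<open>f\<close>, so pure tensors decide.\<close>

lemma tensor_rel_reduce:
  assumes "vector_space sU" "module.subspace sU U" "vector_space sV" "module.subspace sV V"
    and I: "dual_frame sU U I e \<phi>" and J: "dual_frame sV V J e' \<psi>"
    and f: "keys f \<subseteq> U \<times> V"
  shows "f - (\<Sum>i\<in>I. \<Sum>j\<in>J. single (e i, e' j)
      (lin_ext (*) (\<lambda>(u, v). \<phi> i u * \<psi> j v) f)) \<in> tensor_rel sU U sV V"
proof -
  let ?R = "tensor_rel sU U sV V"
  let ?g = "\<lambda>f. \<Sum>i\<in>I. \<Sum>j\<in>J. single (e i, e' j) (lin_ext (*) (\<lambda>(u, v). \<phi> i u * \<psi> j v) f)"
  note R = subspace_tensor_rel[of sU U sV V]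
  have e: "e i \<in> U" if "i \<in> I" for i using I that by (auto simp: dual_frame_def)
  have e': "e' j \<in> V" if "j \<in> J" for j using J that by (auto simp: dual_frame_def)
  have base: "pure2 u v - ?g (pure2 u v) \<in> ?R" if uv: "u \<in> U" "v \<in> V" for u v
  proof -
    have u: "(\<Sum>i\<in>I. sU (\<phi> i u) (e i)) = u" and v: "(\<Sum>j\<in>J. sV (\<psi> j v) (e' j)) = v"
      using I J uv by (auto simp: dual_frame_def)
    have 1: "pure2 (\<Sum>i\<in>I. sU (\<phi> i u) (e i)) v - (\<Sum>i\<in>I. free_scale (\<phi> i u) (pure2 (e i) v)) \<in> ?R"
      by (rule linear_mod_sum[OF assms(1,2) free.vector_space_axioms R])
        (auto simp: tensor_rel_def intro!: free.span_base e, (use uv in blast)+)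
    have 2: "pure2 (e i) (\<Sum>j\<in>J. sV (\<psi> j v) (e' j)) - (\<Sum>j\<in>J. free_scale (\<psi> j v) (pure2 (e i) (e' j))) \<in> ?R"
      if "i \<in> I" for i
      by (rule linear_mod_sum[OF assms(3,4) free.vector_space_axioms R])
        (auto simp: tensor_rel_def intro!: free.span_base e', (use uv e[OF that] in blast)+)
    have "pure2 u v - ?g (pure2 u v) =
      (pure2 u v - (\<Sum>i\<in>I. free_scale (\<phi> i u) (pure2 (e i) v))) +
      (\<Sum>i\<in>I. free_scale (\<phi> i u) (pure2 (e i) v - (\<Sum>j\<in>J. free_scale (\<psi> j v) (pure2 (e i) (e' j)))))"
      by (simp add: free.scale_right_diff_distrib free.scale_sum_right sum_subtractf
          lin_ext_single[OF vector_space_times] del: free_scale_single)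
        (simp add: sum_subtractf)
    also have "\<dots> \<in> ?R"
      using 1 2 unfolding u v by (intro free.subspace_add R free.subspace_sum free.subspace_scale) auto
    finally show ?thesis .
  qed
  have "?g (f + f') = ?g f + ?g f'" for f f'
    by (simp add: lin_ext_add[OF vector_space_times] single_add sum.distrib)
  moreover have "?g (free_scale c f) = free_scale c (?g f)" for c f
    by (simp add: lin_ext_scale[OF vector_space_times] free.scale_sum_right)
  moreover have "?g 0 = 0"
    by (simp add: lin_ext_zero[OF vector_space_times])
  ultimately have "free.subspace {f. f - ?g f \<in> ?R}"
    using free.subspace_0[OF R] free.subspace_add[OF R] free.subspace_scale[OF R]
    by (intro free.subspaceI)
      (simp_all only: mem_Collect_eq add_diff_add diff_zero flip: free.scale_right_diff_distrib)
  from formal_sum_in_subspace[OF this] show ?thesis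
    using base f by blast
qed


text \<open>The product functionals are bilinear, so they kill every relation; conversely, if all of
  them vanish on \<open>f\<close>, the normal form from \<open>tensor_rel_reduce\<close> is zero.
  This takes the place of a basis of the tensor product.\<close>

lemma tensor_rel_iff:
  assumes "vector_space sU" "module.subspace sU U" "vector_space sV" "module.subspace sV V"
    and I: "dual_frame sU U I e \<phi>" and J: "dual_frame sV V J e' \<psi>"
  shows "f \<in> tensor_rel sU U sV V \<longleftrightarrow> keys f \<subseteq> U \<times> V \<and>
    (\<forall>i\<in>I. \<forall>j\<in>J. lin_ext (*) (\<lambda>(u, v). \<phi> i u * \<psi> j v) f = 0)"
proof (intro iffI conjI ballI)
  fix i j assume f: "f \<in> tensor_rel sU U sV V" and ij: "i \<in> I" "j \<in> J"
  have "bilinear_map_on sU U sV V (*) (\<lambda>u v. \<phi> i u * \<psi> j v)"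
    using I J ij by (auto simp: dual_frame_def bilinear_map_on_def linear_map_on_def algebra_simps)
  from lin_ext_tensor_rel[OF vector_space_times this f]
  show "lin_ext (*) (\<lambda>(u, v). \<phi> i u * \<psi> j v) f = 0" .
next
  assume "keys f \<subseteq> U \<times> V \<and>
    (\<forall>i\<in>I. \<forall>j\<in>J. lin_ext (*) (\<lambda>(u, v). \<phi> i u * \<psi> j v) f = 0)"
  with tensor_rel_reduce[OF assms, of f] show "f \<in> tensor_rel sU U sV V" by simp
qed (rule keys_tensor_rel[OF assms(1-4)])

lemma tensor_rel3_intros:
  assumes "u \<in> U" "v \<in> U" "w \<in> U"
  shows "u' \<in> U \<Longrightarrow> pure3 (u + u') v w - pure3 u v w - pure3 u' v w \<in> tensor_rel3 s U"
    and "v' \<in> U \<Longrightarrow> pure3 u (v + v') w - pure3 u v w - pure3 u v' w \<in> tensor_rel3 s U"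
    and "w' \<in> U \<Longrightarrow> pure3 u v (w + w') - pure3 u v w - pure3 u v w' \<in> tensor_rel3 s U"
    and "pure3 (s c u) v w - free_scale c (pure3 u v w) \<in> tensor_rel3 s U"
    and "pure3 u (s c v) w - free_scale c (pure3 u v w) \<in> tensor_rel3 s U"
    and "pure3 u v (s c w) - free_scale c (pure3 u v w) \<in> tensor_rel3 s U"
  unfolding tensor_rel3_def
  subgoal by (rule free.span_base, rule UnI1, rule UnI1, rule UnI1, rule UnI1, rule UnI1, intro CollectI exI conjI, rule refl, (rule assms | assumption)+)
  subgoal by (rule free.span_base, rule UnI1, rule UnI1, rule UnI1, rule UnI1, rule UnI2, intro CollectI exI conjI, rule refl, (rule assms | assumption)+)
  subgoal by (rule free.span_base, rule UnI1, rule UnI1, rule UnI1, rule UnI2, intro CollectI exI conjI, rule refl, (rule assms | assumption)+)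
  subgoal by (rule free.span_base, rule UnI1, rule UnI1, rule UnI2, intro CollectI exI conjI, rule refl, (rule assms | assumption)+)
  subgoal by (rule free.span_base, rule UnI1, rule UnI2, intro CollectI exI conjI, rule refl, (rule assms | assumption)+)
  subgoal by (rule free.span_base, rule UnI2, intro CollectI exI conjI, rule refl, (rule assms | assumption)+)
  done

text \<open>One slot more than in \<open>tensor_rel_reduce\<close>, treated in the same way.
  Coassociativity is tested with it.\<close>

lemma tensor_rel3_if:
  assumes "vector_space s" "module.subspace s U" and I: "dual_frame s U I e \<phi>"
    and f: "keys f \<subseteq> U \<times> U \<times> U"
    and 0: "\<And>i j k. i \<in> I \<Longrightarrow> j \<in> I \<Longrightarrow> k \<in> I \<Longrightarrow>
      lin_ext (*) (\<lambda>(u, v, w). \<phi> i u * (\<phi> j v * \<phi> k w)) f = 0"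
  shows "f \<in> tensor_rel3 s U"
proof -
  let ?R = "tensor_rel3 s U"
  let ?g = "\<lambda>f. \<Sum>i\<in>I. \<Sum>j\<in>I. \<Sum>k\<in>I. single (e i, e j, e k)
    (lin_ext (*) (\<lambda>(u, v, w). \<phi> i u * (\<phi> j v * \<phi> k w)) f)"
  note R = subspace_tensor_rel3[of s U]
  have e: "e i \<in> U" if "i \<in> I" for i using I that by (auto simp: dual_frame_def)
  have base: "pure3 u v w - ?g (pure3 u v w) \<in> ?R" if uv: "u \<in> U" "v \<in> U" "w \<in> U" for u v w
  proof -
    have u: "(\<Sum>i\<in>I. s (\<phi> i u) (e i)) = u" and v: "(\<Sum>i\<in>I. s (\<phi> i v) (e i)) = v"
      and w: "(\<Sum>i\<in>I. s (\<phi> i w) (e i)) = w"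
      using I uv by (auto simp: dual_frame_def)
    have 1: "pure3 (\<Sum>i\<in>I. s (\<phi> i u) (e i)) v w - (\<Sum>i\<in>I. free_scale (\<phi> i u) (pure3 (e i) v w)) \<in> ?R"
      by (rule linear_mod_sum[OF assms(1,2) free.vector_space_axioms R])
        (use uv in \<open>auto intro!: tensor_rel3_intros e simp del: free_scale_single\<close>)
    have 2: "pure3 (e i) (\<Sum>j\<in>I. s (\<phi> j v) (e j)) w
        - (\<Sum>j\<in>I. free_scale (\<phi> j v) (pure3 (e i) (e j) w)) \<in> ?R"
      if "i \<in> I" for i
      by (rule linear_mod_sum[OF assms(1,2) free.vector_space_axioms R])
        (use uv that in \<open>auto intro!: tensor_rel3_intros e simp del: free_scale_single\<close>)
    have 3: "pure3 (e i) (e j) (\<Sum>k\<in>I. s (\<phi> k w) (e k))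
        - (\<Sum>k\<in>I. free_scale (\<phi> k w) (pure3 (e i) (e j) (e k))) \<in> ?R"
      if "i \<in> I" "j \<in> I" for i j
      by (rule linear_mod_sum[OF assms(1,2) free.vector_space_axioms R])
        (use uv that in \<open>auto intro!: tensor_rel3_intros e simp del: free_scale_single\<close>)
    have lift: "(\<Sum>i\<in>I. free_scale (c i) (B i)) - (\<Sum>i\<in>I. free_scale (c i) (X i)) \<in> ?R"
      if "\<And>i. i \<in> I \<Longrightarrow> B i - X i \<in> ?R" for c B X
      unfolding sum_subtractf[symmetric] free.scale_right_diff_distrib[symmetric]
      by (intro free.subspace_sum free.subspace_scale R that)
    have trans: "A - Z \<in> ?R" if "A - X \<in> ?R" "X - Z \<in> ?R" for A X Z
      using free.subspace_add[OF R that] by simp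
    have "?g (pure3 u v w) = (\<Sum>i\<in>I. free_scale (\<phi> i u) (\<Sum>j\<in>I. free_scale (\<phi> j v)
        (\<Sum>k\<in>I. free_scale (\<phi> k w) (pure3 (e i) (e j) (e k)))))"
      by (simp add: free.scale_sum_right lin_ext_single[OF vector_space_times])
    \<comment> \<open>The three congruences modulo \<open>?R\<close> are chained from the outermost
      slot inwards.\<close>
    also have "pure3 u v w - \<dots> \<in> ?R"
      by (rule trans[OF 1[unfolded u]], rule lift, rule trans[OF 2[unfolded v]], assumption,
        rule lift, rule 3[unfolded w], assumption+)
    finally show ?thesis .
  qed
  have "?g (f + f') = ?g f + ?g f'" for f f'
    by (simp add: lin_ext_add[OF vector_space_times] single_add sum.distrib)
  moreover have "?g (free_scale c f) = free_scale c (?g f)" for c f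
    by (simp add: lin_ext_scale[OF vector_space_times] free.scale_sum_right)
  moreover have "?g 0 = 0"
    by (simp add: lin_ext_zero[OF vector_space_times])
  ultimately have "free.subspace {f. f - ?g f \<in> ?R}"
    using free.subspace_0[OF R] free.subspace_add[OF R] free.subspace_scale[OF R]
    by (intro free.subspaceI)
      (simp_all only: mem_Collect_eq add_diff_add diff_zero flip: free.scale_right_diff_distrib)
  from formal_sum_in_subspace[OF this] have "f - ?g f \<in> ?R"
    using base f by blast
  with 0 show ?thesis by simp
qed

section \<open>Cosets and their chosen representatives\<close>

lemma coset_eq_iff:
  assumes "free.subspace R"
  shows "coset R f = coset R g \<longleftrightarrow> f - g \<in> R"
proof
  assume "coset R f = coset R g"
  moreover have "f \<in> coset R f" using free.subspace_0[OF assms] by (simp add: coset_def)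
  ultimately show "f - g \<in> R" by (simp add: coset_def)
next
  assume *: "f - g \<in> R"
  have "h - f \<in> R \<longleftrightarrow> h - g \<in> R" for h
    using free.subspace_add[OF assms _ *, of "h - f"] free.subspace_diff[OF assms _ *, of "h - g"]
    by auto
  then show "coset R f = coset R g" by (simp add: coset_def)
qed

lemma rep_coset:
  assumes "free.subspace R"
  shows "rep (coset R f) - f \<in> R"
proof -
  have "f \<in> coset R f" using free.subspace_0[OF assms] by (simp add: coset_def)
  then have "rep (coset R f) \<in> coset R f" unfolding rep_def by (rule someI)
  then show ?thesis by (simp add: coset_def)
qed

lemma coset_rep:
  assumes "free.subspace R"
  shows "coset R (rep (coset R f)) = coset R f"
  using rep_coset[OF assms] coset_eq_iff[OF assms] by blast

lemma tensor_rep: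
  assumes "vector_space sU" "module.subspace sU U" "vector_space sV" "module.subspace sV V"
    and "t \<in> tensor sU U sV V"
  shows "keys (rep t) \<subseteq> U \<times> V" "t = coset (tensor_rel sU U sV V) (rep t)"
proof -
  obtain f where f: "t = coset (tensor_rel sU U sV V) f" "keys f \<subseteq> U \<times> V"
    using assms(5) unfolding tensor_def by blast
  show "t = coset (tensor_rel sU U sV V) (rep t)"
    unfolding f(1) by (rule coset_rep[OF subspace_tensor_rel, symmetric])
  have "keys (rep t - f) \<subseteq> U \<times> V"
    using keys_tensor_rel[OF assms(1-4)] rep_coset[OF subspace_tensor_rel] unfolding f(1) by blast
  with f(2) keys_add[of "rep t - f" f] show "keys (rep t) \<subseteq> U \<times> V" by auto
qed

text \<open>A bilinear \<open>b\<close> kills the relations, so the choice made by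
  \<open>rep\<close> drops out.\<close>

lemma tensor_eval_coset:
  assumes "vector_space sW" "bilinear_map_on sU U sV V sW b"
  shows "tensor_eval sW b (coset (tensor_rel sU U sV V) f) = lin_ext sW (\<lambda>(u, v). b u v) f"
  using lin_ext_tensor_rel[OF assms rep_coset[OF subspace_tensor_rel]]
  by (simp add: tensor_eval_def lin_ext_diff[OF assms(1)])

lemma vector_space_restrict_scalars:
  assumes "field_embedding emb" "vector_space s"
  shows "vector_space (\<lambda>c. s (emb c))"
proof -
  interpret vector_space s by fact
  show ?thesis
    using assms(1) unfolding field_embedding_def
    by unfold_locales (simp_all add: scale_right_distrib scale_left_distrib)
qed

lemma vector_space_ext_scale: "field_embedding emb \<Longrightarrow> vector_space (ext_scale emb)"
  using vector_space_restrict_scalars[OF _ vector_space_times, of emb]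
  unfolding ext_scale_def[abs_def] .

section \<open>Galois coordinates\<close>

lemma GalD:
  assumes "\<gamma> \<in> Gal emb"
  shows "\<gamma> (x + y) = \<gamma> x + \<gamma> y" "\<gamma> (x * y) = \<gamma> x * \<gamma> y" "\<gamma> (emb k) = emb k" "bij \<gamma>"
  using assms by (auto simp: Gal_def)

lemma Gal_basic:
  assumes "\<gamma> \<in> Gal emb"
  shows Gal_0: "\<gamma> 0 = 0" and Gal_1: "\<gamma> 1 = 1" and Gal_minus: "\<gamma> (x - y) = \<gamma> x - \<gamma> y"
    and Gal_inverse: "\<gamma> (inverse x) = inverse (\<gamma> x)" and Gal_sum: "\<gamma> (\<Sum>i\<in>I. f i) = (\<Sum>i\<in>I. \<gamma> (f i))"
proof -
  note [simp] = GalD[OF assms]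
  show 0: "\<gamma> 0 = 0" using GalD(1)[OF assms, of 0 0] by (metis add_cancel_left_left add_0)
  have "inj \<gamma>" using GalD(4)[OF assms] by (simp add: bij_is_inj)
  then have ne: "\<gamma> x \<noteq> 0" if "x \<noteq> 0" for x using that 0 by (metis injD)
  show 1: "\<gamma> 1 = 1" using GalD(2)[OF assms, of 1 1] ne[of 1] by simp
  show "\<gamma> (x - y) = \<gamma> x - \<gamma> y" using GalD(1)[OF assms, of "x - y" y] by simp
  show "\<gamma> (inverse x) = inverse (\<gamma> x)"
  proof (cases "x = 0")
    case False
    then have "\<gamma> x * \<gamma> (inverse x) = 1" using 1 by (simp flip: GalD(2)[OF assms])
    then show ?thesis by (metis inverse_unique)
  qed (simp add: 0)
  show "\<gamma> (\<Sum>i\<in>I. f i) = (\<Sum>i\<in>I. \<gamma> (f i))"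
    by (induction I rule: infinite_finite_induct) (simp_all add: 0)
qed

lemma id_Gal: "id \<in> Gal emb"
  by (simp add: Gal_def)

lemma comp_Gal: "\<gamma> \<in> Gal emb \<Longrightarrow> \<delta> \<in> Gal emb \<Longrightarrow> \<gamma> \<circ> \<delta> \<in> Gal emb"
  by (simp add: Gal_def bij_comp)

lemma inv_Gal:
  assumes "\<gamma> \<in> Gal emb"
  shows "inv_into UNIV \<gamma> \<in> Gal emb" "\<gamma> \<circ> inv_into UNIV \<gamma> = id" "inv_into UNIV \<gamma> \<circ> \<gamma> = id"
proof -
  have b: "bij \<gamma>" by (rule GalD(4)[OF assms])
  show 1: "\<gamma> \<circ> inv_into UNIV \<gamma> = id" using bij_is_surj[OF b] by (simp add: surj_iff)
  show 2: "inv_into UNIV \<gamma> \<circ> \<gamma> = id" using bij_is_inj[OF b] by (simp add: inj_iff)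
  have \<gamma>: "\<gamma> (inv_into UNIV \<gamma> x) = x" "inv_into UNIV \<gamma> (\<gamma> x) = x" for x
    using 1 2 by (metis comp_apply id_apply)+
  note \<gamma>' = GalD(1-3)[OF assms]
  have inj: "y = z" if "\<gamma> y = \<gamma> z" for y z
    using that bij_is_inj[OF b] by (rule injD[rotated])
  show "inv_into UNIV \<gamma> \<in> Gal emb"
    unfolding Gal_def
  proof (intro CollectI conjI allI)
    show "bij (inv_into UNIV \<gamma>)" by (rule bij_imp_bij_inv[OF b])
  qed (rule inj, simp only: \<gamma> \<gamma>')+
qed

lemma bij_betw_comp_Gal:
  assumes "\<gamma> \<in> Gal emb"
  shows "bij_betw (\<lambda>\<delta>. \<gamma> \<circ> \<delta>) (Gal emb) (Gal emb)"
  by (rule bij_betw_byWitness[where f' = "\<lambda>\<delta>. inv_into UNIV \<gamma> \<circ> \<delta>"])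
    (auto simp: o_assoc inv_Gal[OF assms] comp_Gal assms)

text \<open>In the theorem, finiteness of the Galois group is inherited from the finite group
  \<open>G\<close> through the bijection \<open>\<xi>\<close>.\<close>

locale finite_galois =
  fixes emb :: "'k::field \<Rightarrow> 'l::field"
  assumes galois: "galois_extension emb"
    and finite_Gal: "finite (Gal emb)"
begin

lemma emb: "field_embedding emb"
  using galois by (simp add: galois_extension_def)

lemma emb_simps: "emb 1 = 1" "emb (x + y) = emb x + emb y" "emb (x * y) = emb x * emb y"
  using emb by (simp_all add: field_embedding_def)

lemma emb_0: "emb 0 = 0"
  using emb_simps(2)[of 0 0] by (metis add_cancel_left_left add_0)

lemma inj_emb: "inj emb"
proof (rule injI)
  fix x y assume *: "emb x = emb y"
  have "emb (x - y) = 0" using emb_simps(2)[of "x - y" y] * by simp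
  moreover have "emb (x - y) * emb (inverse (x - y)) = 1" if "x \<noteq> y"
    using that by (simp flip: emb_simps)
  ultimately show "x = y" by force
qed

lemma emb_eq_iff [simp]: "emb x = emb y \<longleftrightarrow> x = y"
  using inj_emb by (auto dest: injD)

lemma in_range_emb: "(\<And>\<gamma>. \<gamma> \<in> Gal emb \<Longrightarrow> \<gamma> x = x) \<Longrightarrow> x \<in> range emb"
  using galois unfolding galois_extension_def by blast

lemma separating_function:
  assumes "\<gamma> \<in> Gal emb" "\<gamma> \<noteq> id"
  obtains x where "\<gamma> x \<noteq> x"
  using assms by (metis eq_id_iff)

text \<open>
  The functions \<open>\<gamma> \<mapsto> \<Sum>\<^sub>i d\<^sub>i \<gamma>(c\<^sub>i)\<close> are closed under products, so it suffices to separate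
  the identity from one automorphism \<open>\<delta>\<close> at a time, by \<open>\<gamma> \<mapsto> (\<gamma>(x) - \<delta>(x)) / (x - \<delta>(x))\<close>.
\<close>

lemma evaluation_product:
  assumes "\<And>\<gamma>. \<gamma> \<in> Gal emb \<Longrightarrow> f \<gamma> = (\<Sum>(d, c)\<leftarrow>xs. d * \<gamma> c)"
    and "\<And>\<gamma>. \<gamma> \<in> Gal emb \<Longrightarrow> g \<gamma> = (\<Sum>(d, c)\<leftarrow>ys. d * \<gamma> c)"
  shows "\<exists>zs. \<forall>\<gamma>\<in>Gal emb. f \<gamma> * g \<gamma> = (\<Sum>(d, c)\<leftarrow>zs. d * \<gamma> c)"
  using assms(1)
proof (induction xs arbitrary: f)
  case Nil
  then show ?case by (intro exI[of _ "[]"]) auto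
next
  case (Cons x xs)
  obtain d c where x: "x = (d, c)" by force
  obtain zs where zs: "\<forall>\<gamma>\<in>Gal emb. (\<Sum>(d, c)\<leftarrow>xs. d * \<gamma> c) * g \<gamma> = (\<Sum>(d, c)\<leftarrow>zs. d * \<gamma> c)"
    using Cons.IH[of "\<lambda>\<gamma>. \<Sum>(d, c)\<leftarrow>xs. d * \<gamma> c"] by blast
  have "d * \<gamma> c * (\<Sum>(d, c)\<leftarrow>ys. d * \<gamma> c) = (\<Sum>(d', c')\<leftarrow>map (\<lambda>(d', c'). (d * d', c * c')) ys. d' * \<gamma> c')"
    if "\<gamma> \<in> Gal emb" for \<gamma>
    by (induction ys) (auto simp: algebra_simps GalD(2)[OF that])
  with zs assms(2) Cons.prems show ?case
    by (intro exI[of _ "map (\<lambda>(d', c'). (d * d', c * c')) ys @ zs"]) (auto simp: x distrib_right)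
qed

lemma galois_coordinates_exist:
  "\<exists>(m :: nat) c d. \<forall>\<gamma>\<in>Gal emb. (\<Sum>i<m. d i * \<gamma> (c i)) = (if \<gamma> = id then 1 else 0)"
proof -
  have "\<exists>xs. (\<Sum>(d, c)\<leftarrow>xs. d * id c) = 1 \<and> (\<forall>\<gamma>\<in>S. (\<Sum>(d, c)\<leftarrow>xs. d * \<gamma> c) = 0)"
    if "S \<subseteq> Gal emb - {id}" "finite S" for S
    using that(2,1)
  proof (induction S)
    case empty
    then show ?case by (intro exI[of _ "[(1, 1)]"]) auto
  next
    case (insert \<delta> S)
    then obtain xs where xs: "(\<Sum>(d, c)\<leftarrow>xs. d * id c) = 1" "\<forall>\<gamma>\<in>S. (\<Sum>(d, c)\<leftarrow>xs. d * \<gamma> c) = 0"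
      by auto
    obtain x where x: "\<delta> x \<noteq> x" using separating_function[of \<delta>] insert.prems by auto
    \<comment> \<open>The quotient that separates \<open>\<delta>\<close> from the identity, split
      into a term with \<open>\<gamma> x\<close> and a term with \<open>\<gamma> 1 = 1\<close>.
      Multiplied by it, the sum over \<open>xs\<close> also vanishes at \<open>\<delta>\<close> and
      keeps the value 1 at the identity.\<close>
    let ?ys = "[(inverse (x - \<delta> x), x), (- \<delta> x * inverse (x - \<delta> x), 1)]"
    obtain zs where zs: "\<forall>\<gamma>\<in>Gal emb. (\<Sum>(d, c)\<leftarrow>xs. d * \<gamma> c) * (\<Sum>(d, c)\<leftarrow>?ys. d * \<gamma> c) = (\<Sum>(d, c)\<leftarrow>zs. d * \<gamma> c)"
      using evaluation_product[of "\<lambda>\<gamma>. (\<Sum>(d, c)\<leftarrow>xs. d * \<gamma> c)" xs "\<lambda>\<gamma>. (\<Sum>(d, c)\<leftarrow>?ys. d * \<gamma> c)" ?ys] by blast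
    have ys\<delta>: "(\<Sum>(d, c)\<leftarrow>?ys. d * \<delta> c) = 0"
      using insert.prems by (auto simp: Gal_1)
    have ys1: "(\<Sum>(d, c)\<leftarrow>?ys. d * id c) = 1"
    proof -
      have "(\<Sum>(d, c)\<leftarrow>?ys. d * id c) = inverse (x - \<delta> x) * (x - \<delta> x)"
        by (simp add: algebra_simps)
      with x show ?thesis by simp
    qed
    have "(\<Sum>(d, c)\<leftarrow>zs. d * id c) = 1"
      unfolding zs[rule_format, OF id_Gal, symmetric] xs(1) ys1 by simp
    moreover have "(\<Sum>(d, c)\<leftarrow>zs. d * \<delta> c) = 0"
      using zs[rule_format, of \<delta>] insert.prems unfolding ys\<delta> by auto
    moreover have "(\<Sum>(d, c)\<leftarrow>zs. d * \<gamma> c) = 0" if "\<gamma> \<in> S" for \<gamma>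
      using zs[rule_format, of \<gamma>] xs(2) that insert.prems by auto
    ultimately have "(\<Sum>(d, c)\<leftarrow>zs. d * id c) = 1 \<and> (\<forall>\<gamma>\<in>insert \<delta> S. (\<Sum>(d, c)\<leftarrow>zs. d * \<gamma> c) = 0)"
      by blast
    then show ?case by blast
  qed
  from this[of "Gal emb - {id}"] obtain xs
    where xs: "(\<Sum>(d, c)\<leftarrow>xs. d * id c) = 1" "\<forall>\<gamma>\<in>Gal emb - {id}. (\<Sum>(d, c)\<leftarrow>xs. d * \<gamma> c) = 0"
    using finite_Gal by auto
  show ?thesis
  proof (rule exI[of _ "length xs"], rule exI[of _ "\<lambda>i. snd (xs ! i)"],
      rule exI[of _ "\<lambda>i. fst (xs ! i)"], rule ballI)
    fix \<gamma> assume "\<gamma> \<in> Gal emb"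
    with xs show "(\<Sum>i<length xs. fst (xs ! i) * \<gamma> (snd (xs ! i))) = (if \<gamma> = id then 1 else 0)"
      by (auto simp: sum_list_sum_nth case_prod_beta atLeast0LessThan)
  qed
qed

section \<open>The trace and elements of trace one\<close>

definition tr :: "'l \<Rightarrow> 'l" where
  "tr x = (\<Sum>\<gamma>\<in>Gal emb. \<gamma> x)"

lemma Gal_tr:
  assumes "\<gamma> \<in> Gal emb"
  shows "\<gamma> (tr x) = tr x"
  using sum.reindex_bij_betw[OF bij_betw_comp_Gal[OF assms], of "\<lambda>\<delta>. \<delta> x"]
  by (simp add: tr_def Gal_sum[OF assms])

text \<open>The trace as an element of \<open>K\<close>: it is Galois invariant, hence in the range
  of \<open>emb\<close>, and the choice is unique because \<open>emb\<close> is injective.\<close>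

definition trK :: "'l \<Rightarrow> 'k" where
  "trK x = (SOME k. emb k = tr x)"

lemma emb_trK [simp]: "emb (trK x) = tr x"
proof -
  have "tr x \<in> range emb" by (rule in_range_emb) (rule Gal_tr)
  then obtain k where "emb k = tr x" by (metis rangeE)
  then show ?thesis unfolding trK_def by (rule someI)
qed

lemma tr_add: "tr (x + y) = tr x + tr y"
  by (simp add: tr_def GalD sum.distrib)

lemma tr_scale: "tr (emb k * x) = emb k * tr x"
  by (simp add: tr_def GalD sum_distrib_left)

lemma linear_trK: "linear_map_on (ext_scale emb) UNIV (*) trK"
  by (auto simp: linear_map_on_def ext_scale_def tr_add tr_scale emb_simps simp flip: emb_eq_iff)

text \<open>Summing the coordinate identity over all automorphisms gives total 1 for the products
  \<open>d i * tr (c i)\<close>, so some trace is nonzero and can be normalised by a scalar of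
  \<open>K\<close>. The argument works in every characteristic.\<close>

lemma trace_one_exists: obtains c0 where "tr c0 = 1"
proof -
  obtain m and c d :: "nat \<Rightarrow> 'l" where cd:
    "\<forall>\<gamma>\<in>Gal emb. (\<Sum>i<m. d i * \<gamma> (c i)) = (if \<gamma> = id then 1 else 0)"
    using galois_coordinates_exist by blast
  have "(\<Sum>i<m. d i * tr (c i)) = (\<Sum>\<gamma>\<in>Gal emb. \<Sum>i<m. d i * \<gamma> (c i))"
    unfolding tr_def sum_distrib_left by (rule sum.swap)
  also have "\<dots> = 1" using finite_Gal by (simp add: cd id_Gal)
  finally obtain i where "tr (c i) \<noteq> 0" by (metis (no_types, lifting) mult_zero_right sum.neutral zero_neq_one)
  then have "trK (c i) \<noteq> 0" using emb_0 emb_trK by metis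
  then have "emb (inverse (trK (c i)) * trK (c i)) = 1"
    by (simp add: emb_simps del: emb_trK)
  then have "tr (emb (inverse (trK (c i))) * c i) = 1"
    by (simp add: tr_scale emb_simps)
  then show ?thesis by (rule that)
qed

end

text \<open>Coordinates and an element of trace 1 are fixed once, so that all frames and projections
  onto invariants below are explicit formulas in \<open>c\<close>, \<open>d\<close> and
  \<open>c0\<close>.\<close>

locale galois_coordinates = finite_galois emb for emb :: "'k::field \<Rightarrow> 'l::field" +
  fixes m :: nat and c d :: "nat \<Rightarrow> 'l" and c0 :: 'l
  assumes coordinates: "\<gamma> \<in> Gal emb \<Longrightarrow> (\<Sum>i<m. d i * \<gamma> (c i)) = (if \<gamma> = id then 1 else 0)"
    and trace_one: "tr c0 = 1"
begin

text \<open>Opening the trace and summing over \<open>i\<close> first leaves only the identity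
  automorphism. In particular the \<open>d i\<close> span \<open>L\<close> over
  \<open>K\<close>.\<close>

lemma trace_expansion: "(\<Sum>i<m. d i * tr (c i * x)) = x"
proof -
  have "(\<Sum>i<m. d i * tr (c i * x)) = (\<Sum>i<m. \<Sum>\<gamma>\<in>Gal emb. d i * \<gamma> (c i) * \<gamma> x)"
    by (simp add: tr_def sum_distrib_left GalD mult.assoc)
  also have "\<dots> = (\<Sum>\<gamma>\<in>Gal emb. (\<Sum>i<m. d i * \<gamma> (c i)) * \<gamma> x)"
    unfolding sum_distrib_right by (rule sum.swap)
  also have "\<dots> = (\<Sum>\<gamma>\<in>Gal emb. if \<gamma> = id then x else 0)"
    by (rule sum.cong) (auto simp: coordinates)
  also have "\<dots> = x" using finite_Gal by (simp add: id_Gal)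
  finally show ?thesis .
qed

text \<open>This is \<open>\<delta>\<close> applied to the coordinate identity for the automorphism
  \<open>inv_into UNIV \<delta> \<circ> \<gamma>\<close>.\<close>

lemma coordinates_apply:
  assumes "\<gamma> \<in> Gal emb" "\<delta> \<in> Gal emb"
  shows "(\<Sum>i<m. \<delta> (d i) * \<gamma> (c i)) = (if \<gamma> = \<delta> then 1 else 0)"
proof -
  have "(\<Sum>i<m. \<delta> (d i) * \<gamma> (c i)) = \<delta> (\<Sum>i<m. d i * (inv_into UNIV \<delta> \<circ> \<gamma>) (c i))"
    using inv_Gal[OF assms(2)] by (simp add: Gal_sum[OF assms(2)] GalD(2)[OF assms(2)]) (metis comp_apply id_apply)
  also have "\<dots> = \<delta> (if inv_into UNIV \<delta> \<circ> \<gamma> = id then 1 else 0)"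
    using assms by (simp only: coordinates comp_Gal inv_Gal)
  also have "inv_into UNIV \<delta> \<circ> \<gamma> = id \<longleftrightarrow> \<gamma> = \<delta>"
    using inv_Gal[OF assms(2)] by (metis comp_id fun.map_comp id_comp)
  finally show ?thesis using assms(2) by (auto simp: Gal_0 Gal_1)
qed

text \<open>Testing the relation on the \<open>c i\<close> with weights
  \<open>\<delta> (d i)\<close> isolates the coefficient of \<open>\<delta>\<close>; this replaces
  the usual argument with a shortest relation.\<close>

lemma Dedekind_independence:
  assumes "\<And>x. (\<Sum>\<gamma>\<in>Gal emb. s \<gamma> * \<gamma> x) = 0" "\<delta> \<in> Gal emb"
  shows "s \<delta> = 0"
proof -
  have "0 = (\<Sum>i<m. \<delta> (d i) * (\<Sum>\<gamma>\<in>Gal emb. s \<gamma> * \<gamma> (c i)))"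
    using assms(1) by simp
  also have "\<dots> = (\<Sum>\<gamma>\<in>Gal emb. s \<gamma> * (\<Sum>i<m. \<delta> (d i) * \<gamma> (c i)))"
    unfolding sum_distrib_left by (subst sum.swap) (simp add: mult_ac)
  also have "\<dots> = (\<Sum>\<gamma>\<in>Gal emb. if \<gamma> = \<delta> then s \<delta> else 0)"
    by (rule sum.cong) (auto simp: coordinates_apply assms)
  also have "\<dots> = s \<delta>" using finite_Gal assms by simp
  finally show ?thesis by simp
qed

lemma dual_frame_ext: "dual_frame (ext_scale emb) UNIV {..<m} d (\<lambda>i x. trK (c i * x))"
  using linear_trK trace_expansion
  by (simp add: dual_frame_def linear_map_on_def ext_scale_def distrib_left mult.left_commute[of "c _" "emb _"])
    (simp add: mult.commute)

end

section \<open>The Hopf algebra of a regular subgroup\<close>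

context finite_galois
begin

abbreviation lam where "lam \<equiv> left_regular emb"
abbreviation ac where "ac \<equiv> conj_left emb"

lemma lam_comp: "\<gamma> \<in> Gal emb \<Longrightarrow> \<delta> \<in> Gal emb \<Longrightarrow> lam \<gamma> \<circ> lam \<delta> = lam (\<gamma> \<circ> \<delta>)"
  by (auto simp: left_regular_def comp_Gal fun_eq_iff)

lemma lam_id: "lam id = id"
  by (auto simp: left_regular_def)

lemma inv_lam:
  assumes "\<gamma> \<in> Gal emb"
  shows "inv_into UNIV (lam \<gamma>) = lam (inv_into UNIV \<gamma>)"
proof (rule inv_unique_comp)
  show "lam \<gamma> \<circ> lam (inv_into UNIV \<gamma>) = id" "lam (inv_into UNIV \<gamma>) \<circ> lam \<gamma> = id"
    using assms by (simp_all add: lam_comp inv_Gal lam_id)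
qed

lemma ac_eq: "\<gamma> \<in> Gal emb \<Longrightarrow> ac \<gamma> \<eta> = lam \<gamma> \<circ> \<eta> \<circ> lam (inv_into UNIV \<gamma>)"
  by (simp add: conj_left_def inv_lam)

lemma ac_ac: "\<gamma> \<in> Gal emb \<Longrightarrow> \<delta> \<in> Gal emb \<Longrightarrow> ac \<gamma> (ac \<delta> \<eta>) = ac (\<gamma> \<circ> \<delta>) \<eta>"
proof -
  assume *: "\<gamma> \<in> Gal emb" "\<delta> \<in> Gal emb"
  have "inv_into UNIV (\<gamma> \<circ> \<delta>) = inv_into UNIV \<delta> \<circ> inv_into UNIV \<gamma>"
    using * by (simp add: o_inv_distrib GalD(4))
  with * show ?thesis
    by (simp add: ac_eq comp_Gal o_assoc lam_comp inv_Gal) (simp add: o_assoc[symmetric] lam_comp inv_Gal *)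
qed

lemma ac_id [simp]: "ac id \<eta> = \<eta>"
  by (simp add: ac_eq id_Gal lam_id inv_id)

lemma ac_inverse:
  "\<gamma> \<in> Gal emb \<Longrightarrow> ac (inv_into UNIV \<gamma>) (ac \<gamma> \<eta>) = \<eta>"
  "\<gamma> \<in> Gal emb \<Longrightarrow> ac \<gamma> (ac (inv_into UNIV \<gamma>) \<eta>) = \<eta>"
  by (simp_all add: ac_ac inv_Gal)

lemma ac_eq_iff: "\<gamma> \<in> Gal emb \<Longrightarrow> ac \<gamma> \<eta> = ac \<gamma> \<theta> \<longleftrightarrow> \<eta> = \<theta>"
  using ac_inverse(1) by metis

lemma lam_inv_lam: "\<gamma> \<in> Gal emb \<Longrightarrow> lam (inv_into UNIV \<gamma>) \<circ> lam \<gamma> = id"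
  by (simp add: lam_comp inv_Gal lam_id)

lemma lam_lam_inv: "\<gamma> \<in> Gal emb \<Longrightarrow> lam \<gamma> \<circ> lam (inv_into UNIV \<gamma>) = id"
  by (simp add: lam_comp inv_Gal lam_id)

lemma ac_comp:
  assumes "\<gamma> \<in> Gal emb"
  shows "ac \<gamma> (\<eta> \<circ> \<theta>) = ac \<gamma> \<eta> \<circ> ac \<gamma> \<theta>"
  using lam_inv_lam[OF assms] unfolding ac_eq[OF assms]
  by (metis (no_types, opaque_lifting) comp_assoc comp_id)

lemma ac_id_perm: "\<gamma> \<in> Gal emb \<Longrightarrow> ac \<gamma> id = id"
  by (simp add: ac_eq lam_lam_inv)

end

section \<open>Regular subgroups normalised by left translations\<close>

locale greither_pareigis = galois_coordinates emb m c d c0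
  for emb :: "'k::field \<Rightarrow> 'l::field" and m c d c0 +
  fixes N :: "'l perm set"
  assumes regular: "regular_subgroup (Gal emb) N"
    and normalized: "normalized_by_left emb N"
begin

lemma N_permutes: "\<eta> \<in> N \<Longrightarrow> \<eta> permutes Gal emb"
  using regular subgroup.subset[of N "perm_group (Gal emb)"]
  by (auto simp: regular_subgroup_def perm_group_def)

lemma N_bij: "\<eta> \<in> N \<Longrightarrow> bij \<eta>"
  using N_permutes permutes_bij by blast

lemma N_Gal: "\<eta> \<in> N \<Longrightarrow> \<gamma> \<in> Gal emb \<Longrightarrow> \<eta> \<gamma> \<in> Gal emb"
  using N_permutes permutes_in_image by metis

lemma id_N: "id \<in> N"
  using regular subgroup.one_closed[of N "perm_group (Gal emb)"]
  by (auto simp: regular_subgroup_def perm_group_def)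

lemma comp_N: "\<eta> \<in> N \<Longrightarrow> \<theta> \<in> N \<Longrightarrow> \<eta> \<circ> \<theta> \<in> N"
  using regular subgroup.m_closed[of N "perm_group (Gal emb)" \<eta> \<theta>]
  by (auto simp: regular_subgroup_def perm_group_def)

lemma N_eqI:
  assumes "\<eta> \<in> N" "\<theta> \<in> N" "\<gamma> \<in> Gal emb" "\<eta> \<gamma> = \<theta> \<gamma>"
  shows "\<eta> = \<theta>"
  using regular assms N_Gal[OF assms(2,3)] unfolding regular_subgroup_def by metis

lemma N_transitive:
  assumes "\<gamma> \<in> Gal emb" "\<delta> \<in> Gal emb"
  obtains \<eta> where "\<eta> \<in> N" "\<eta> \<gamma> = \<delta>"
  using regular assms unfolding regular_subgroup_def by metis

lemma inv_N:
  assumes "\<eta> \<in> N"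
  shows "inv_into UNIV \<eta> \<in> N" "\<eta> \<circ> inv_into UNIV \<eta> = id" "inv_into UNIV \<eta> \<circ> \<eta> = id"
proof -
  note b = N_bij[OF assms]
  show "\<eta> \<circ> inv_into UNIV \<eta> = id" using bij_is_surj[OF b] by (simp add: surj_iff)
  show *: "inv_into UNIV \<eta> \<circ> \<eta> = id" using bij_is_inj[OF b] by (simp add: inj_iff)
  \<comment> \<open>Transitivity supplies an element of \<open>N\<close> that undoes
    \<open>\<eta>\<close> at one point. Then \<open>\<theta> \<circ> \<eta>\<close> agrees with
    \<open>id\<close> there, hence everywhere, so the inverse function of \<open>\<eta>\<close> is
    \<open>\<theta>\<close> and lies in \<open>N\<close>.\<close>
  obtain \<theta> where \<theta>: "\<theta> \<in> N" "\<theta> (\<eta> id) = id"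
    using N_transitive[OF N_Gal[OF assms id_Gal] id_Gal] .
  have "\<theta> \<circ> \<eta> = id"
    by (rule N_eqI[OF comp_N[OF \<theta>(1) assms] id_N id_Gal]) (simp add: \<theta>(2))
  then have "\<theta> = inv_into UNIV \<eta>"
    using \<open>\<eta> \<circ> inv_into UNIV \<eta> = id\<close> by (metis comp_id fun.map_comp id_comp o_assoc)
  with \<theta>(1) show "inv_into UNIV \<eta> \<in> N" by simp
qed

lemma finite_N: "finite N"
proof (rule inj_on_finite)
  show "inj_on (\<lambda>\<eta>. \<eta> id) N" using N_eqI[OF _ _ id_Gal] by (auto intro: inj_onI)
  show "(\<lambda>\<eta>. \<eta> id) ` N \<subseteq> Gal emb" using N_Gal id_Gal by blast
qed (rule finite_Gal)

lemma ac_N [intro, simp]: "\<gamma> \<in> Gal emb \<Longrightarrow> \<eta> \<in> N \<Longrightarrow> ac \<gamma> \<eta> \<in> N"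
  using normalized unfolding normalized_by_left_def by blast

lemma bij_ac: "\<gamma> \<in> Gal emb \<Longrightarrow> bij_betw (ac \<gamma>) N N"
  by (rule bij_betw_byWitness[where f' = "ac (inv_into UNIV \<gamma>)"]) (auto simp: ac_inverse inv_Gal)

lemma ac_inv:
  assumes "\<gamma> \<in> Gal emb" "\<eta> \<in> N"
  shows "ac \<gamma> (inv_into UNIV \<eta>) = inv_into UNIV (ac \<gamma> \<eta>)"
proof (rule inv_unique_comp[symmetric])
  show "ac \<gamma> \<eta> \<circ> ac \<gamma> (inv_into UNIV \<eta>) = id" "ac \<gamma> (inv_into UNIV \<eta>) \<circ> ac \<gamma> \<eta> = id"
    using assms by (simp_all add: ac_comp[symmetric] inv_N ac_id_perm)
qed

lemma ac_apply:
  assumes "\<gamma> \<in> Gal emb" "\<eta> \<in> N"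
  shows "ac \<gamma> \<eta> \<gamma> = \<gamma> \<circ> \<eta> id"
  using assms N_Gal[OF assms(2) id_Gal] by (simp add: ac_eq left_regular_def inv_Gal)

text \<open>The automorphism by which \<open>\<eta>\<close> acts on \<open>L\<close>. It gives a
  bijection of \<open>N\<close> onto the Galois group, but in general a homomorphism only up to the
  twist in \<open>\<sigma>_comp\<close>.\<close>

definition \<sigma> :: "'l perm \<Rightarrow> ('l \<Rightarrow> 'l)" where
  "\<sigma> \<eta> = inv_into UNIV \<eta> id"

lemma \<sigma>_Gal: "\<eta> \<in> N \<Longrightarrow> \<sigma> \<eta> \<in> Gal emb"
  by (simp add: \<sigma>_def N_Gal inv_N id_Gal)

lemma \<sigma>_inv: "\<eta> \<in> N \<Longrightarrow> \<sigma> (inv_into UNIV \<eta>) = \<eta> id"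
  by (simp add: \<sigma>_def N_bij inv_inv_eq)

lemma bij_\<sigma>: "bij_betw \<sigma> N (Gal emb)"
proof (rule bij_betwI')
  fix \<eta> \<theta> assume *: "\<eta> \<in> N" "\<theta> \<in> N"
  then show "\<sigma> \<eta> = \<sigma> \<theta> \<longleftrightarrow> \<eta> = \<theta>"
    unfolding \<sigma>_def using N_eqI[OF inv_N(1) inv_N(1) id_Gal, of \<eta> \<theta>] by (metis N_bij inv_inv_eq)
next
  fix \<gamma> assume "\<gamma> \<in> Gal emb"
  then obtain \<eta> where "\<eta> \<in> N" "\<eta> id = \<gamma>" using N_transitive id_Gal by metis
  then show "\<exists>\<eta>\<in>N. \<gamma> = \<sigma> \<eta>" using inv_N(1) \<sigma>_inv by metis
qed (rule \<sigma>_Gal)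

text \<open>With \<gamma> = \<open>\<sigma> \<eta>\<close>, the inverse of
  \<open>ac \<gamma> \<theta>\<close> sends \<gamma> to \<gamma> composed with
  \<open>\<sigma> \<theta>\<close>, by \<open>ac_apply\<close>. The twist is the one that the
  coefficients of an element of \<open>C\<close> undergo when \<open>\<sigma> \<eta>\<close> moves
  past them, and so it makes the action of \<open>H\<close> multiplicative.\<close>

lemma \<sigma>_comp:
  assumes "\<eta> \<in> N" "\<theta> \<in> N"
  shows "\<sigma> (\<eta> \<circ> ac (\<sigma> \<eta>) \<theta>) = \<sigma> \<eta> \<circ> \<sigma> \<theta>"
proof -
  note \<gamma> = \<sigma>_Gal[OF assms(1)]
  have "\<sigma> (\<eta> \<circ> ac (\<sigma> \<eta>) \<theta>) = ac (\<sigma> \<eta>) (inv_into UNIV \<theta>) (\<sigma> \<eta>)"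
    using assms \<gamma> by (simp add: \<sigma>_def[of "_ \<circ> _"] o_inv_distrib N_bij ac_inv) (simp add: \<sigma>_def)
  then show ?thesis
    using ac_apply[OF \<gamma> inv_N(1)[OF assms(2)]] by (simp add: \<sigma>_def)
qed

abbreviation H where "H \<equiv> gp_hopf emb N"
abbreviation C where "C \<equiv> carrier H"
abbreviation LN :: "('l, 'l perm \<Rightarrow>\<^sub>0 'l) hopf" where "LN \<equiv> group_algebra N"

abbreviation lift_scale :: "'k \<Rightarrow> ('x \<Rightarrow>\<^sub>0 'l) \<Rightarrow> ('x \<Rightarrow>\<^sub>0 'l)" where
  "lift_scale \<equiv> \<lambda>k. free_scale (emb k)"

lemma scale_H: "scale H = lift_scale"
  by (simp add: gp_hopf_def Let_def)

lemma vs_lift: "vector_space lift_scale"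
  by (rule vector_space_restrict_scalars[OF emb free.vector_space_axioms])

lemma vs_ext: "vector_space (ext_scale emb)"
  by (rule vector_space_ext_scale[OF emb])

lemma subspace_lift:
  assumes "free.subspace U"
  shows "module.subspace lift_scale U"
proof -
  interpret vector_space "lift_scale :: 'k \<Rightarrow> ('a \<Rightarrow>\<^sub>0 'l) \<Rightarrow> _" by (rule vs_lift)
  show ?thesis
    using free.subspace_0[OF assms] free.subspace_add[OF assms] free.subspace_scale[OF assms]
    by (intro subspaceI) auto
qed

section \<open>Equivariant functions on \<open>N\<close>\<close>

lemma gal_act_eq:
  assumes "keys s \<subseteq> N" "\<gamma> \<in> Gal emb"
  shows "gal_act emb \<gamma> s = (\<Sum>\<eta>\<in>N. single (ac \<gamma> \<eta>) (\<gamma> (lookup s \<eta>)))"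
  unfolding gal_act_def using assms finite_N
  by (intro sum.mono_neutral_left) (auto simp: in_keys_iff Gal_0)

lemma lookup_gal_act:
  assumes "keys s \<subseteq> N" "\<gamma> \<in> Gal emb" "\<eta> \<in> N"
  shows "lookup (gal_act emb \<gamma> s) (ac \<gamma> \<eta>) = \<gamma> (lookup s \<eta>)"
  using assms finite_N by (simp add: gal_act_eq lookup_sum lookup_single when_def ac_eq_iff)

lemma keys_gal_act:
  assumes "keys s \<subseteq> N" "\<gamma> \<in> Gal emb"
  shows "keys (gal_act emb \<gamma> s) \<subseteq> N"
proof -
  have "gal_act emb \<gamma> s \<in> {f. keys f \<subseteq> N}"
    unfolding gal_act_eq[OF assms] using assms by (intro free.subspace_sum[OF subspace_keys]) auto
  then show ?thesis by simp
qed

lemma poly_mapping_N_eqI: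
  assumes "keys s \<subseteq> N" "keys t \<subseteq> N"
    "\<And>\<eta>. \<eta> \<in> N \<Longrightarrow> lookup s \<eta> = lookup t \<eta>"
  shows "s = t"
  using assms by (intro poly_mapping_eqI) (metis in_keys_iff subset_iff)

text \<open>The translate of \<open>s\<close> by \<gamma> has at \<open>ac \<gamma> \<eta>\<close>
  the coefficient \<gamma>(\<open>lookup s \<eta>\<close>), so invariance under \<Gamma> becomes a
  pointwise condition.\<close>

lemma mem_C_iff:
  "s \<in> C \<longleftrightarrow> keys s \<subseteq> N \<and>
    (\<forall>\<gamma>\<in>Gal emb. \<forall>\<eta>\<in>N. lookup s (ac \<gamma> \<eta>) = \<gamma> (lookup s \<eta>))"
proof (cases "keys s \<subseteq> N")
  case True
  have "gal_act emb \<gamma> s = s \<longleftrightarrow> (\<forall>\<eta>\<in>N. lookup s (ac \<gamma> \<eta>) = \<gamma> (lookup s \<eta>))"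
    if \<gamma>: "\<gamma> \<in> Gal emb" for \<gamma>
  proof
    assume *: "\<forall>\<eta>\<in>N. lookup s (ac \<gamma> \<eta>) = \<gamma> (lookup s \<eta>)"
    show "gal_act emb \<gamma> s = s"
    proof (rule poly_mapping_N_eqI[OF keys_gal_act[OF True \<gamma>] True])
      fix \<eta> assume "\<eta> \<in> N"
      then obtain \<theta> where "\<theta> \<in> N" "\<eta> = ac \<gamma> \<theta>"
        using bij_ac[OF \<gamma>] by (metis bij_betw_imp_surj_on imageE)
      then show "lookup (gal_act emb \<gamma> s) \<eta> = lookup s \<eta>"
        using * lookup_gal_act[OF True \<gamma>] by simp
    qed
  qed (use lookup_gal_act[OF True \<gamma>] in force)
  then show ?thesis using True by (simp add: gp_hopf_def group_algebra_def Let_def)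
qed (simp add: gp_hopf_def group_algebra_def Let_def)

lemma CD:
  assumes "h \<in> C"
  shows "keys h \<subseteq> N"
    and "\<gamma> \<in> Gal emb \<Longrightarrow> \<eta> \<in> N \<Longrightarrow>
      lookup h (ac \<gamma> \<eta>) = \<gamma> (lookup h \<eta>)"
  using assms unfolding mem_C_iff by auto

lemma C_eqI:
  assumes "s \<in> C" "t \<in> C" "\<And>\<eta>. \<eta> \<in> N \<Longrightarrow> lookup s \<eta> = lookup t \<eta>"
  shows "s = t"
  using assms CD(1) poly_mapping_N_eqI by blast

lemma subspace_C: "module.subspace lift_scale C"
proof -
  interpret vector_space "lift_scale :: 'k \<Rightarrow> (_ \<Rightarrow>\<^sub>0 'l) \<Rightarrow> _" by (rule vs_lift)
  show ?thesis
  proof (rule subspaceI)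
    fix s t assume "s \<in> C" "t \<in> C"
    then show "s + t \<in> C"
      using keys_add[of s t] unfolding mem_C_iff by (auto simp: lookup_add GalD)
  next
    fix k s assume "s \<in> C"
    then show "free_scale (emb k) s \<in> C"
      using keys_free_scale[of "emb k" s] unfolding mem_C_iff by (auto simp: GalD)
  qed (auto simp: mem_C_iff Gal_0)
qed

text \<open>The trace of \<open>x \<eta>\<close> for the action of \<Gamma> on \<open>L[N]\<close>,
  the source of elements of \<open>H\<close>. When \<open>\<eta>\<close> has a nontrivial
  stabiliser, several terms fall on the same permutation, whence the sum in
  \<open>lookup_T\<close>.\<close>

definition T :: "'l \<Rightarrow> 'l perm \<Rightarrow> ('l perm \<Rightarrow>\<^sub>0 'l)" where
  "T x \<eta> = (\<Sum>\<gamma>\<in>Gal emb. single (ac \<gamma> \<eta>) (\<gamma> x))"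

lemma lookup_T:
  "lookup (T x \<eta>) \<theta> = (\<Sum>\<gamma>\<in>Gal emb. if ac \<gamma> \<eta> = \<theta> then \<gamma> x else 0)"
  by (simp add: T_def lookup_sum lookup_single when_def)

lemma keys_T:
  assumes "\<And>\<gamma>. \<gamma> \<in> Gal emb \<Longrightarrow> ac \<gamma> \<eta> \<in> M"
  shows "keys (T x \<eta>) \<subseteq> M"
proof -
  have "T x \<eta> \<in> {f. keys f \<subseteq> M}"
    unfolding T_def using assms by (intro free.subspace_sum[OF subspace_keys]) auto
  then show ?thesis by simp
qed

lemma T_C: "\<eta> \<in> N \<Longrightarrow> T x \<eta> \<in> C"
  unfolding mem_C_iff
proof (intro conjI ballI keys_T)
  fix \<gamma> \<theta> assume *: "\<eta> \<in> N" "\<gamma> \<in> Gal emb" "\<theta> \<in> N"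
  have "lookup (T x \<eta>) (ac \<gamma> \<theta>) =
    (\<Sum>\<delta>\<in>Gal emb. if ac (\<gamma> \<circ> \<delta>) \<eta> = ac \<gamma> \<theta> then (\<gamma> \<circ> \<delta>) x else 0)"
    unfolding lookup_T by (rule sum.reindex_bij_betw[OF bij_betw_comp_Gal[OF *(2)], symmetric])
  also have "\<dots> = (\<Sum>\<delta>\<in>Gal emb. \<gamma> (if ac \<delta> \<eta> = \<theta> then \<delta> x else 0))"
    by (rule sum.cong) (auto simp: ac_ac[symmetric] ac_eq_iff * Gal_0[OF *(2)])
  finally show "lookup (T x \<eta>) (ac \<gamma> \<theta>) = \<gamma> (lookup (T x \<eta>) \<theta>)"
    by (simp add: lookup_T Gal_sum[OF *(2)])
qed auto

text \<open>The coordinate identity removes all conjugates except \<open>\<eta>\<close> itself. Read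
  in \<open>L[N]\<close>, each element of \<open>N\<close> is an \<open>L\<close>-combination of
  elements of \<open>H\<close>, so \<open>H\<close> spans \<open>L[N]\<close> over
  \<open>L\<close>.\<close>

lemma sum_T:
  "(\<Sum>i<m. d i * lookup (T (c i) \<eta>) \<theta>) = (if \<eta> = \<theta> then 1 else 0)"
proof -
  have "(\<Sum>i<m. d i * lookup (T (c i) \<eta>) \<theta>) =
    (\<Sum>\<gamma>\<in>Gal emb. \<Sum>i<m. if ac \<gamma> \<eta> = \<theta> then d i * \<gamma> (c i) else 0)"
    unfolding lookup_T sum_distrib_left by (subst sum.swap) (auto intro!: sum.cong)
  also have "\<dots> = (\<Sum>\<gamma>\<in>Gal emb. if ac \<gamma> \<eta> = \<theta> then \<Sum>i<m. d i * \<gamma> (c i) else 0)"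
    by (rule sum.cong) auto
  also have "\<dots> = (\<Sum>\<gamma>\<in>Gal emb. if \<gamma> = id then (if \<eta> = \<theta> then 1 else 0) else 0)"
    using coordinates coordinates[OF id_Gal] by (intro sum.cong) auto
  finally show ?thesis using finite_Gal by (simp add: id_Gal)
qed

lemma linear_lookup: "linear_map_on lift_scale U (ext_scale emb) (\<lambda>h. lookup h \<eta>)"
  by (simp add: linear_map_on_def lookup_add ext_scale_def)

text \<open>
  With \<open>\<gamma>\<close> moved past the equivariant \<open>h\<close>, the coefficient at \<open>\<theta>\<close> of the expansion below
  becomes \<open>tr(c\<^sub>0) h(\<theta>)\<close>.
\<close>

lemma dual_frame_C:
  "dual_frame lift_scale C (N \<times> {..<m}) (\<lambda>(\<eta>, i). T (d i) \<eta>)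
    (\<lambda>(\<eta>, i) h. trK (c i * (c0 * lookup h \<eta>)))"
  unfolding dual_frame_def
proof (intro conjI ballI)
  show "finite (N \<times> {..<m})" using finite_N by simp
next
  fix x assume "x \<in> N \<times> {..<m}"
  then show "(case x of (\<eta>, i) \<Rightarrow> T (d i) \<eta>) \<in> C" by (auto simp: T_C)
  show "linear_map_on lift_scale C (*) (case x of (\<eta>, i) \<Rightarrow> \<lambda>h. trK (c i * (c0 * lookup h \<eta>)))"
    using linear_trK by (cases x) (auto simp: linear_map_on_def lookup_add ext_scale_def distrib_left
        mult.left_commute[of _ "emb _"])
next
  fix h assume h: "h \<in> C"
  let ?h = "lookup h"
  interpret vector_space "lift_scale :: 'k \<Rightarrow> (_ \<Rightarrow>\<^sub>0 'l) \<Rightarrow> _" by (rule vs_lift)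
  show "(\<Sum>x\<in>N \<times> {..<m}. free_scale (emb ((case x of (\<eta>, i) \<Rightarrow> \<lambda>h. trK (c i * (c0 * lookup h \<eta>))) h))
      (case x of (\<eta>, i) \<Rightarrow> T (d i) \<eta>)) = h" (is "?s = h")
  proof (rule C_eqI[OF _ h])
    show "?s \<in> C" by (intro subspace_sum[OF subspace_C] subspace_scale[OF subspace_C]) (auto simp: T_C)
    fix \<theta> assume \<theta>: "\<theta> \<in> N"
    have "lookup ?s \<theta> = (\<Sum>\<eta>\<in>N. \<Sum>i<m. tr (c i * (c0 * ?h \<eta>)) * (\<Sum>\<gamma>\<in>Gal emb. if ac \<gamma> \<eta> = \<theta> then \<gamma> (d i) else 0))"
      by (simp add: lookup_sum sum.cartesian_product case_prod_beta lookup_T)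
    also have "\<dots> = (\<Sum>\<eta>\<in>N. \<Sum>\<gamma>\<in>Gal emb. if ac \<gamma> \<eta> = \<theta> then \<gamma> (\<Sum>i<m. d i * tr (c i * (c0 * ?h \<eta>))) else 0)"
    proof (rule sum.cong[OF refl])
      fix \<eta> assume "\<eta> \<in> N"
      have "(\<Sum>i<m. tr (c i * (c0 * ?h \<eta>)) * (\<Sum>\<gamma>\<in>Gal emb. if ac \<gamma> \<eta> = \<theta> then \<gamma> (d i) else 0)) =
        (\<Sum>\<gamma>\<in>Gal emb. \<Sum>i<m. if ac \<gamma> \<eta> = \<theta> then \<gamma> (d i * tr (c i * (c0 * ?h \<eta>))) else 0)"
        unfolding sum_distrib_left
        by (subst sum.swap) (auto intro!: sum.cong simp: GalD Gal_tr mult.commute)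
      also have "\<dots> = (\<Sum>\<gamma>\<in>Gal emb. if ac \<gamma> \<eta> = \<theta> then \<gamma> (\<Sum>i<m. d i * tr (c i * (c0 * ?h \<eta>))) else 0)"
        by (rule sum.cong) (auto simp: Gal_sum)
      finally show "(\<Sum>i<m. tr (c i * (c0 * ?h \<eta>)) * (\<Sum>\<gamma>\<in>Gal emb. if ac \<gamma> \<eta> = \<theta> then \<gamma> (d i) else 0)) =
        (\<Sum>\<gamma>\<in>Gal emb. if ac \<gamma> \<eta> = \<theta> then \<gamma> (\<Sum>i<m. d i * tr (c i * (c0 * ?h \<eta>))) else 0)" .
    qed
    also have "\<dots> = (\<Sum>\<gamma>\<in>Gal emb. \<Sum>\<eta>\<in>N. if ac \<gamma> \<eta> = \<theta> then \<gamma> (c0 * ?h \<eta>) else 0)"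
      unfolding trace_expansion by (rule sum.swap)
    also have "\<dots> = (\<Sum>\<gamma>\<in>Gal emb. \<gamma> c0 * ?h \<theta>)"
    proof (rule sum.cong[OF refl])
      fix \<gamma> assume \<gamma>: "\<gamma> \<in> Gal emb"
      have "(\<Sum>\<eta>\<in>N. if ac \<gamma> \<eta> = \<theta> then \<gamma> (c0 * ?h \<eta>) else 0) =
        (\<Sum>\<eta>\<in>N. (\<lambda>\<kappa>. if \<kappa> = \<theta> then \<gamma> c0 * ?h \<kappa> else 0) (ac \<gamma> \<eta>))"
        by (rule sum.cong) (auto simp: GalD[OF \<gamma>] CD(2)[OF h \<gamma>])
      also have "\<dots> = (\<Sum>\<kappa>\<in>N. if \<kappa> = \<theta> then \<gamma> c0 * ?h \<kappa> else 0)"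
        by (rule sum.reindex_bij_betw[OF bij_ac[OF \<gamma>]])
      finally show "(\<Sum>\<eta>\<in>N. if ac \<gamma> \<eta> = \<theta> then \<gamma> (c0 * ?h \<eta>) else 0) = \<gamma> c0 * ?h \<theta>"
        using finite_N \<theta> by simp
    qed
    also have "\<dots> = ?h \<theta>"
      using trace_one by (simp add: tr_def flip: sum_distrib_right)
    finally show "lookup ?s \<theta> = ?h \<theta>" .
  qed
qed

end

lemma lin_ext_sum_right2:
  assumes "vector_space s"
  shows "lin_ext s (\<lambda>(u, v). \<Sum>i\<in>I. b i u v) f = (\<Sum>i\<in>I. lin_ext s (\<lambda>(u, v). b i u v) f)"
  unfolding case_prod_unfold by (rule lin_ext_sum_right[OF assms])

lemma lin_ext_cong2:
  assumes "keys f \<subseteq> U \<times> V" "\<And>u v. u \<in> U \<Longrightarrow> v \<in> V \<Longrightarrow> b u v = b' u v"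
  shows "lin_ext s (\<lambda>(u, v). b u v) f = lin_ext s (\<lambda>(u, v). b' u v) f"
  using assms by (intro lin_ext_cong) auto

context greither_pareigis
begin

section \<open>Tensors over \<open>K\<close> as functions on powers of \<open>N\<close>\<close>

lemma vs_H: "vector_space (scale H)"
  unfolding scale_H by (rule vs_lift)

lemma subspace_H: "module.subspace (scale H) C"
  unfolding scale_H by (rule subspace_C)

lemma linear_emb: "linear_map_on (*) UNIV (ext_scale emb) emb"
  by (simp add: linear_map_on_def ext_scale_def emb_simps)

lemma linear_Gal: "\<gamma> \<in> Gal emb \<Longrightarrow> linear_map_on (ext_scale emb) UNIV (ext_scale emb) \<gamma>"
  by (simp add: linear_map_on_def ext_scale_def GalD)

lemma lin_ext_mult: "lin_ext (ext_scale emb) (\<lambda>x. w * b x) f = w * lin_ext (ext_scale emb) b f"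
  by (rule lin_ext_hom_UNIV[OF vs_ext vs_ext, symmetric, where F = "\<lambda>x. w * x"])
    (simp add: linear_map_on_def ext_scale_def algebra_simps)

lemma lin_ext_mult2:
  "lin_ext (ext_scale emb) (\<lambda>(u, v). w * b u v) f = w * lin_ext (ext_scale emb) (\<lambda>(u, v). b u v) f"
  unfolding case_prod_unfold by (rule lin_ext_mult)

lemma lookup_lin_ext_lift:
  "lookup (lin_ext lift_scale b f) y = lin_ext (ext_scale emb) (\<lambda>x. lookup (b x) y) f"
  by (rule lin_ext_hom_UNIV[OF vs_lift vs_ext linear_lookup])

text \<open>The coefficient at \<open>\<eta> \<otimes> \<theta>\<close> of the image of
  \<open>f\<close> in the tensor square of \<open>L[N]\<close> over \<open>L\<close>.\<close>

definition ev2 ::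
  "(('l perm \<Rightarrow>\<^sub>0 'l) \<times> ('l perm \<Rightarrow>\<^sub>0 'l) \<Rightarrow>\<^sub>0 'k) \<Rightarrow>
    'l perm \<Rightarrow> 'l perm \<Rightarrow> 'l" where
  "ev2 f \<eta> \<theta> = lin_ext (ext_scale emb) (\<lambda>(a, b). lookup a \<eta> * lookup b \<theta>) f"

definition ev3 where
  "ev3 f \<eta> \<theta> \<kappa> = lin_ext (ext_scale emb)
    (\<lambda>(a, b, e). lookup a \<eta> * (lookup b \<theta> * lookup e \<kappa>)) f"

lemma ev2_pure2: "ev2 (pure2 a b) \<eta> \<theta> = lookup a \<eta> * lookup b \<theta>"
  by (simp add: ev2_def lin_ext_single[OF vs_ext] ext_scale_def emb_simps)

lemma ev3_pure3: "ev3 (pure3 a b e) \<eta> \<theta> \<kappa> =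
    lookup a \<eta> * (lookup b \<theta> * lookup e \<kappa>)"
  by (simp add: ev3_def lin_ext_single[OF vs_ext] ext_scale_def emb_simps)

lemma linear_ev2: "linear_map_on free_scale U (ext_scale emb) (\<lambda>f. ev2 f \<eta> \<theta>)"
  unfolding ev2_def by (rule linear_map_on_lin_ext[OF vs_ext])

lemma linear_ev3: "linear_map_on free_scale U (ext_scale emb) (\<lambda>f. ev3 f \<eta> \<theta> \<kappa>)"
  unfolding ev3_def by (rule linear_map_on_lin_ext[OF vs_ext])

lemma ev2_lin_ext: "ev2 (lin_ext free_scale b f) \<eta> \<theta> = lin_ext (ext_scale emb) (\<lambda>x. ev2 (b x) \<eta> \<theta>) f"
  by (rule lin_ext_hom_UNIV[OF free.vector_space_axioms vs_ext linear_ev2])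

lemma ev3_lin_ext:
  "ev3 (lin_ext free_scale b f) \<eta> \<theta> \<kappa> = lin_ext (ext_scale emb) (\<lambda>x. ev3 (b x) \<eta> \<theta> \<kappa>) f"
  by (rule lin_ext_hom_UNIV[OF free.vector_space_axioms vs_ext linear_ev3])

lemma ev2_diff: "ev2 (f - g) \<eta> \<theta> = ev2 f \<eta> \<theta> - ev2 g \<eta> \<theta>"
  by (simp add: ev2_def lin_ext_diff[OF vs_ext])

lemma ev3_diff: "ev3 (f - g) \<eta> \<theta> \<kappa> = ev3 f \<eta> \<theta> \<kappa> - ev3 g \<eta> \<theta> \<kappa>"
  by (simp add: ev3_def lin_ext_diff[OF vs_ext])

text \<open>Equivariance turns conjugates of a value of \<open>h\<close> into values of
  \<open>h\<close> at translates of \<open>\<eta>\<close>. The \<open>K\<close>-valued frame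
  functionals of \<open>C\<close> thus become \<open>L\<close>-combinations of evaluations.\<close>

lemma trK_functional:
  assumes "h \<in> C" "\<eta> \<in> N"
  shows "emb (trK (x * (c0 * lookup h \<eta>))) =
    (\<Sum>\<gamma>\<in>Gal emb. \<gamma> (x * c0) * lookup h (ac \<gamma> \<eta>))"
  using assms by (auto simp: tr_def GalD CD(2) mult.assoc intro!: sum.cong)

lemma functional_ev2:
  assumes "keys f \<subseteq> C \<times> C" "\<eta> \<in> N" "\<theta> \<in> N"
  shows "emb (lin_ext (*) (\<lambda>(u, v). trK (x * (c0 * lookup u \<eta>)) *
      trK (y * (c0 * lookup v \<theta>))) f) =
    (\<Sum>\<gamma>\<in>Gal emb. \<Sum>\<delta>\<in>Gal emb. \<gamma> (x * c0) * \<delta> (y * c0) * ev2 f (ac \<gamma> \<eta>) (ac \<delta> \<theta>))"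
proof -
  have "emb (lin_ext (*) (\<lambda>(u, v). trK (x * (c0 * lookup u \<eta>)) *
      trK (y * (c0 * lookup v \<theta>))) f) =
    lin_ext (ext_scale emb) (\<lambda>(u, v). emb (trK (x * (c0 * lookup u \<eta>))) *
      emb (trK (y * (c0 * lookup v \<theta>)))) f"
    by (simp only: lin_ext_hom_UNIV[OF vector_space_times vs_ext linear_emb] case_prod_unfold emb_simps)
  also have "\<dots> = lin_ext (ext_scale emb) (\<lambda>(u, v). \<Sum>\<gamma>\<in>Gal emb. \<Sum>\<delta>\<in>Gal emb.
      \<gamma> (x * c0) * \<delta> (y * c0) * (lookup u (ac \<gamma> \<eta>) * lookup v (ac \<delta> \<theta>))) f"
    by (rule lin_ext_cong2[OF assms(1)])
      (simp only: trK_functional assms(2,3) sum_product, simp only: mult_ac)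
  finally show ?thesis
    by (simp only: lin_ext_sum_right2[OF vs_ext] lin_ext_mult2 ev2_def)
qed

abbreviation "R \<equiv> tensor_rel lift_scale C lift_scale C"

text \<open>Evaluation is bilinear, so relations evaluate to zero. Conversely, by
  \<open>functional_ev2\<close> the frame functionals are combinations of values, so they vanish
  with the values and \<open>tensor_rel_iff\<close> applies.\<close>

lemma tensor_rel_C_iff:
  "f \<in> R \<longleftrightarrow> keys f \<subseteq> C \<times> C \<and> (\<forall>\<eta>\<in>N. \<forall>\<theta>\<in>N. ev2 f \<eta> \<theta> = 0)"
proof
  assume f: "f \<in> R"
  have "ev2 f \<eta> \<theta> = 0" for \<eta> \<theta>
    unfolding ev2_def
    by (rule lin_ext_tensor_rel[OF vs_ext _ f])
      (simp add: bilinear_map_on_def linear_map_on_def lookup_add ext_scale_def algebra_simps)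
  with keys_tensor_rel[OF vs_lift subspace_C vs_lift subspace_C f]
  show "keys f \<subseteq> C \<times> C \<and> (\<forall>\<eta>\<in>N. \<forall>\<theta>\<in>N. ev2 f \<eta> \<theta> = 0)" by blast
next
  assume *: "keys f \<subseteq> C \<times> C \<and> (\<forall>\<eta>\<in>N. \<forall>\<theta>\<in>N. ev2 f \<eta> \<theta> = 0)"
  show "f \<in> R"
    unfolding tensor_rel_iff[OF vs_lift subspace_C vs_lift subspace_C dual_frame_C dual_frame_C]
  proof (intro conjI ballI)
    fix i j assume "i \<in> N \<times> {..<m}" "j \<in> N \<times> {..<m}"
    moreover obtain \<eta> i' \<theta> j' where ij: "i = (\<eta>, i')" "j = (\<theta>, j')" by force
    ultimately have "\<eta> \<in> N" "\<theta> \<in> N" by auto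
    then have "emb (lin_ext (*) (\<lambda>(u, v). trK (c i' * (c0 * lookup u \<eta>)) *
      trK (c j' * (c0 * lookup v \<theta>))) f) = emb 0"
      using * by (simp add: functional_ev2 emb_0)
    then show "lin_ext (*) (\<lambda>(u, v). (case i of (\<eta>, i) \<Rightarrow> \<lambda>h. trK (c i * (c0 * lookup h \<eta>))) u *
      (case j of (\<eta>, i) \<Rightarrow> \<lambda>h. trK (c i * (c0 * lookup h \<eta>))) v) f = 0"
      by (simp add: ij)
  qed (use * in blast)
qed

lemma tensor_rel3_C_if:
  assumes f: "keys f \<subseteq> C \<times> C \<times> C"
    and 0: "\<And>\<eta> \<theta> \<kappa>. \<eta> \<in> N \<Longrightarrow> \<theta> \<in> N \<Longrightarrow> \<kappa> \<in> N \<Longrightarrow> ev3 f \<eta> \<theta> \<kappa> = 0"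
  shows "f \<in> tensor_rel3 lift_scale C"
proof (rule tensor_rel3_if[OF vs_lift subspace_C dual_frame_C f])
  fix i j k assume "i \<in> N \<times> {..<m}" "j \<in> N \<times> {..<m}" "k \<in> N \<times> {..<m}"
  moreover obtain \<eta> i' \<theta> j' \<kappa> k' where ijk: "i = (\<eta>, i')" "j = (\<theta>, j')" "k = (\<kappa>, k')" by (metis prod.exhaust)
  ultimately have N: "\<eta> \<in> N" "\<theta> \<in> N" "\<kappa> \<in> N" by auto
  let ?t = "\<lambda>x u \<eta>. trK (x * (c0 * lookup u \<eta>))"
  have "emb (lin_ext (*) (\<lambda>(u, v, w). ?t (c i') u \<eta> * (?t (c j') v \<theta> * ?t (c k') w \<kappa>)) f) =
    lin_ext (ext_scale emb) (\<lambda>x. emb (?t (c i') (fst x) \<eta>) * (emb (?t (c j') (fst (snd x)) \<theta>) * emb (?t (c k') (snd (snd x)) \<kappa>))) f"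
    by (simp only: lin_ext_hom_UNIV[OF vector_space_times vs_ext linear_emb] case_prod_unfold emb_simps)
  also have "\<dots> = lin_ext (ext_scale emb) (\<lambda>x. \<Sum>\<gamma>\<in>Gal emb. \<Sum>\<delta>\<in>Gal emb. \<Sum>\<epsilon>\<in>Gal emb.
      (\<gamma> (c i' * c0) * (\<delta> (c j' * c0) * \<epsilon> (c k' * c0))) * (lookup (fst x) (ac \<gamma> \<eta>) *
      (lookup (fst (snd x)) (ac \<delta> \<theta>) * lookup (snd (snd x)) (ac \<epsilon> \<kappa>)))) f"
  proof (rule lin_ext_cong)
    fix x assume "x \<in> keys f"
    with f have "fst x \<in> C" "fst (snd x) \<in> C" "snd (snd x) \<in> C" by auto
    with N show "emb (?t (c i') (fst x) \<eta>) * (emb (?t (c j') (fst (snd x)) \<theta>) * emb (?t (c k') (snd (snd x)) \<kappa>)) =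
      (\<Sum>\<gamma>\<in>Gal emb. \<Sum>\<delta>\<in>Gal emb. \<Sum>\<epsilon>\<in>Gal emb.
      (\<gamma> (c i' * c0) * (\<delta> (c j' * c0) * \<epsilon> (c k' * c0))) * (lookup (fst x) (ac \<gamma> \<eta>) *
      (lookup (fst (snd x)) (ac \<delta> \<theta>) * lookup (snd (snd x)) (ac \<epsilon> \<kappa>))))"
      by (simp only: trK_functional sum_product) (simp only: sum_distrib_left mult_ac)
  qed
  also have "\<dots> = (\<Sum>\<gamma>\<in>Gal emb. \<Sum>\<delta>\<in>Gal emb. \<Sum>\<epsilon>\<in>Gal emb.
      (\<gamma> (c i' * c0) * (\<delta> (c j' * c0) * \<epsilon> (c k' * c0))) * ev3 f (ac \<gamma> \<eta>) (ac \<delta> \<theta>) (ac \<epsilon> \<kappa>))"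
    by (simp only: lin_ext_sum_right[OF vs_ext] lin_ext_mult ev3_def case_prod_unfold)
  also have "\<dots> = emb 0" using 0 N by (simp add: emb_0)
  finally show "lin_ext (*) (\<lambda>(u, v, w). (case i of (\<eta>, i) \<Rightarrow> \<lambda>h. trK (c i * (c0 * lookup h \<eta>))) u *
      ((case j of (\<eta>, i) \<Rightarrow> \<lambda>h. trK (c i * (c0 * lookup h \<eta>))) v *
      (case k of (\<eta>, i) \<Rightarrow> \<lambda>h. trK (c i * (c0 * lookup h \<eta>))) w)) f = 0"
    by (simp add: ijk)
qed

subsection \<open>Comultiplication\<close>

abbreviation "A \<equiv> {s :: 'l perm \<Rightarrow>\<^sub>0 'l. keys s \<subseteq> N}"

lemma dual_frame_A:
  "dual_frame free_scale A N (\<lambda>\<eta>. single \<eta> 1) (\<lambda>\<eta> s. lookup s \<eta>)"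
  unfolding dual_frame_def
proof (intro conjI ballI)
  fix s assume "s \<in> A"
  then show "(\<Sum>\<eta>\<in>N. free_scale (lookup s \<eta>) (single \<eta> 1)) = s"
    using sum_single_lookup[OF finite_N, of s] by simp
qed (auto simp: finite_N linear_map_on_def lookup_add)

lemma tclass_LN: "tclass LN = coset (tensor_rel free_scale A free_scale A)"
  by (simp add: tclass_def group_algebra_def Let_def)

lemma comult_LN: "comult LN h = coset (tensor_rel free_scale A free_scale A)
    (lin_ext free_scale (\<lambda>\<eta>. pure2 (single \<eta> 1) (single \<eta> 1)) h)"
  by (simp add: group_algebra_def Let_def)

text \<open>Over \<open>L\<close> the group elements form an actual basis, in which the coproduct of
  \<open>h\<close> is \<open>h\<close> placed on the diagonal of \<open>N \<times> N\<close>. This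
  turns the condition inside the definite description of \<open>comult H\<close> into one on
  values.\<close>

lemma comult_spec_iff:
  assumes h: "h \<in> C" and f: "keys f \<subseteq> C \<times> C"
  shows "tclass LN (lin_ext lift_scale (\<lambda>(a, b). pure2 a b) f) = comult LN h \<longleftrightarrow>
    (\<forall>\<eta>\<in>N. \<forall>\<theta>\<in>N. ev2 f \<eta> \<theta> = (if \<eta> = \<theta> then lookup h \<eta> else 0))"
proof -
  let ?g = "lin_ext lift_scale (\<lambda>(a, b). pure2 a b) f"
  let ?g' = "lin_ext free_scale (\<lambda>\<eta>. pure2 (single \<eta> 1) (single \<eta> 1)) h"
  let ?F = "\<lambda>\<eta> \<theta>. lin_ext (*) (\<lambda>(u, v). lookup u \<eta> * lookup v \<theta>)"
  have "?g \<in> {g. keys g \<subseteq> A \<times> A}"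
    by (rule lin_ext_in_subspace[OF vs_lift subspace_lift[OF subspace_keys]])
      (use f CD(1) in \<open>auto dest!: subsetD\<close>)
  moreover have "?g' \<in> {g. keys g \<subseteq> A \<times> A}"
    by (rule lin_ext_in_subspace[OF free.vector_space_axioms subspace_keys])
      (use CD(1)[OF h] in auto)
  ultimately have keys: "keys (?g - ?g') \<subseteq> A \<times> A"
    using free.subspace_diff[OF subspace_keys] by blast
  have g: "?F \<eta> \<theta> ?g = ev2 f \<eta> \<theta>" for \<eta> \<theta>
  proof -
    have lin: "linear_map_on lift_scale UNIV (ext_scale emb) (?F \<eta> \<theta>)"
      by (simp add: linear_map_on_def lin_ext_add[OF vector_space_times] lin_ext_scale[OF vector_space_times] ext_scale_def)
    show ?thesis
      unfolding ev2_def lin_ext_hom_UNIV[OF vs_lift vs_ext lin]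
      by (simp add: case_prod_unfold lin_ext_single[OF vector_space_times])
  qed
  have g': "?F \<eta> \<theta> ?g' = (if \<eta> = \<theta> then lookup h \<eta> else 0)" if N: "\<eta> \<in> N" "\<theta> \<in> N" for \<eta> \<theta>
  proof -
    have "?F \<eta> \<theta> ?g' = (\<Sum>\<kappa>\<in>N. lookup h \<kappa> * ((1 when \<kappa> = \<eta>) * (1 when \<kappa> = \<theta>)))"
      unfolding lin_ext_hom_UNIV[OF free.vector_space_axioms vector_space_times linear_map_on_lin_ext[OF vector_space_times]]
      by (simp add: lin_ext_single[OF vector_space_times] lookup_single lin_ext_superset[OF vector_space_times finite_N CD(1)[OF h]])
    also have "\<dots> = (\<Sum>\<kappa>\<in>N. if \<kappa> = \<eta> then (if \<eta> = \<theta> then lookup h \<eta> else 0) else 0)"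
      by (rule sum.cong) auto
    finally show ?thesis using N finite_N by simp
  qed
  have "tclass LN ?g = comult LN h \<longleftrightarrow> ?g - ?g' \<in> tensor_rel free_scale A free_scale A"
    unfolding tclass_LN comult_LN by (rule coset_eq_iff[OF subspace_tensor_rel])
  also have "\<dots> \<longleftrightarrow> (\<forall>\<eta>\<in>N. \<forall>\<theta>\<in>N. ?F \<eta> \<theta> (?g - ?g') = 0)"
    using tensor_rel_iff[OF free.vector_space_axioms subspace_keys free.vector_space_axioms subspace_keys dual_frame_A dual_frame_A]
      keys by blast
  finally show ?thesis
    by (simp only: lin_ext_diff[OF vector_space_times] g g' right_minus_eq ball_simps cong: ball_cong)
qed

text \<open>
  By the coordinate identity, \<open>\<Sum>\<^sub>i T(c\<^sub>i, \<eta>) \<otimes> T(d\<^sub>i x, \<eta>)\<close> is the sum of \<open>\<gamma>(x) \<gamma>\<eta> \<otimes> \<gamma>\<eta>\<close> over all \<open>\<gamma>\<close>;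
  with \<open>x = h(\<eta>) c\<^sub>0\<close>, summing over \<open>\<eta>\<close> gives \<open>tr(c\<^sub>0)\<close> times the coproduct of \<open>h\<close>.
\<close>

lemma diagonal_tensor:
  assumes h: "h \<in> C"
  obtains f where "keys f \<subseteq> (\<lambda>(x, \<eta>). T x \<eta>) ` (UNIV \<times> keys h) \<times> (\<lambda>(x, \<eta>). T x \<eta>) ` (UNIV \<times> keys h)"
    "\<And>\<eta> \<theta>. \<eta> \<in> N \<Longrightarrow> \<theta> \<in> N \<Longrightarrow> ev2 f \<eta> \<theta> = (if \<eta> = \<theta> then lookup h \<eta> else 0)"
proof (rule that)
  let ?h = "lookup h"
  \<comment> \<open>Only conjugates of elements of \<open>keys h\<close> occur in the factors. With
    \<open>h\<close> supported in a stable subgroup, this keeps the coproduct inside the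
    corresponding sub-Hopf algebra.\<close>
  let ?J = "(\<lambda>(x, \<eta>). T x \<eta>) ` (UNIV \<times> keys h)"
  let ?f = "\<Sum>\<eta>\<in>keys h. \<Sum>i<m. pure2 (T (c i) \<eta>) (T (d i * (?h \<eta> * c0)) \<eta>) :: _ \<Rightarrow>\<^sub>0 'k"
  have "?f \<in> {f. keys f \<subseteq> ?J \<times> ?J}"
    by (intro free.subspace_sum[OF subspace_keys]) auto
  then show "keys ?f \<subseteq> ?J \<times> ?J" by simp
  fix \<theta> \<kappa> assume N: "\<theta> \<in> N" "\<kappa> \<in> N"
  have *: "(\<Sum>i<m. lookup (T (c i) \<eta>) \<theta> * lookup (T (d i * x) \<eta>) \<kappa>) =
    (\<Sum>\<gamma>\<in>Gal emb. if ac \<gamma> \<eta> = \<theta> \<and> \<theta> = \<kappa> then \<gamma> x else 0)" for \<eta> x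
  proof -
    have "(\<Sum>i<m. lookup (T (c i) \<eta>) \<theta> * lookup (T (d i * x) \<eta>) \<kappa>) =
      (\<Sum>i<m. \<Sum>\<gamma>\<in>Gal emb. \<Sum>\<delta>\<in>Gal emb. (if ac \<gamma> \<eta> = \<theta> \<and> ac \<delta> \<eta> = \<kappa> then \<delta> x else 0) * (\<delta> (d i) * \<gamma> (c i)))"
      unfolding lookup_T sum_product by (intro sum.cong refl) (auto simp: GalD)
    also have "\<dots> = (\<Sum>\<gamma>\<in>Gal emb. \<Sum>i<m. \<Sum>\<delta>\<in>Gal emb. (if ac \<gamma> \<eta> = \<theta> \<and> ac \<delta> \<eta> = \<kappa> then \<delta> x else 0) * (\<delta> (d i) * \<gamma> (c i)))"
      by (rule sum.swap)
    also have "\<dots> = (\<Sum>\<gamma>\<in>Gal emb. \<Sum>\<delta>\<in>Gal emb. (if ac \<gamma> \<eta> = \<theta> \<and> ac \<delta> \<eta> = \<kappa> then \<delta> x else 0) * (\<Sum>i<m. \<delta> (d i) * \<gamma> (c i)))"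
      unfolding sum_distrib_left by (intro sum.cong refl sum.swap)
    also have "\<dots> = (\<Sum>\<gamma>\<in>Gal emb. \<Sum>\<delta>\<in>Gal emb. if \<gamma> = \<delta> then (if ac \<gamma> \<eta> = \<theta> \<and> \<theta> = \<kappa> then \<gamma> x else 0) else 0)"
      by (intro sum.cong refl) (auto simp: coordinates_apply)
    finally show ?thesis using finite_Gal by simp
  qed
  have "ev2 ?f \<theta> \<kappa> = (\<Sum>\<eta>\<in>keys h. \<Sum>\<gamma>\<in>Gal emb. if ac \<gamma> \<eta> = \<theta> \<and> \<theta> = \<kappa> then \<gamma> (?h \<eta> * c0) else 0)"
    unfolding ev2_def lin_ext_sum[OF vs_ext] unfolding ev2_def[symmetric] ev2_pure2 * ..
  also have "\<dots> = (\<Sum>\<eta>\<in>N. \<Sum>\<gamma>\<in>Gal emb. if ac \<gamma> \<eta> = \<theta> \<and> \<theta> = \<kappa> then \<gamma> (?h \<eta> * c0) else 0)"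
    using CD(1)[OF h] finite_N
    by (intro sum.mono_neutral_left) (auto simp: in_keys_iff Gal_0 intro!: sum.neutral)
  also have "\<dots> = (\<Sum>\<gamma>\<in>Gal emb. \<Sum>\<eta>\<in>N. if ac \<gamma> \<eta> = \<theta> \<and> \<theta> = \<kappa> then \<gamma> (?h \<eta> * c0) else 0)"
    by (rule sum.swap)
  also have "\<dots> = (\<Sum>\<gamma>\<in>Gal emb. \<gamma> c0 * (if \<theta> = \<kappa> then ?h \<theta> else 0))"
  proof (rule sum.cong[OF refl])
    fix \<gamma> assume \<gamma>: "\<gamma> \<in> Gal emb"
    have "(\<Sum>\<eta>\<in>N. if ac \<gamma> \<eta> = \<theta> \<and> \<theta> = \<kappa> then \<gamma> (?h \<eta> * c0) else 0) =
      (\<Sum>\<eta>\<in>N. (\<lambda>\<eta>. if \<eta> = \<theta> then \<gamma> c0 * (if \<theta> = \<kappa> then ?h \<theta> else 0) else 0) (ac \<gamma> \<eta>))"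
      by (rule sum.cong) (auto simp: GalD[OF \<gamma>] CD(2)[OF h \<gamma>])
    also have "\<dots> = (\<Sum>\<eta>\<in>N. if \<eta> = \<theta> then \<gamma> c0 * (if \<theta> = \<kappa> then ?h \<theta> else 0) else 0)"
      by (rule sum.reindex_bij_betw[OF bij_ac[OF \<gamma>]])
    finally show "(\<Sum>\<eta>\<in>N. if ac \<gamma> \<eta> = \<theta> \<and> \<theta> = \<kappa> then \<gamma> (?h \<eta> * c0) else 0) =
      \<gamma> c0 * (if \<theta> = \<kappa> then ?h \<theta> else 0)" using finite_N N by simp
  qed
  also have "\<dots> = (if \<theta> = \<kappa> then ?h \<theta> else 0)"
    using trace_one by (simp add: tr_def flip: sum_distrib_right)
  finally show "ev2 ?f \<theta> \<kappa> = (if \<theta> = \<kappa> then ?h \<theta> else 0)" .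
qed

lemma tclass_H: "tclass H = coset R"
  by (simp add: tclass_def scale_H)

lemma coset_R_eqI:
  assumes "keys f \<subseteq> C \<times> C" "keys g \<subseteq> C \<times> C"
    and "\<And>\<eta> \<theta>. \<eta> \<in> N \<Longrightarrow> \<theta> \<in> N \<Longrightarrow> ev2 f \<eta> \<theta> = ev2 g \<eta> \<theta>"
  shows "coset R f = coset R g"
  unfolding coset_eq_iff[OF subspace_tensor_rel] tensor_rel_C_iff
  using assms free.subspace_diff[OF subspace_keys[of "C \<times> C"], of f g] by (auto simp: ev2_diff)

lemma ev2_rep_coset: "\<eta> \<in> N \<Longrightarrow> \<theta> \<in> N \<Longrightarrow> ev2 (rep (coset R f)) \<eta> \<theta> = ev2 f \<eta> \<theta>"
  using rep_coset[OF subspace_tensor_rel, of lift_scale C lift_scale C f] unfolding tensor_rel_C_iff ev2_diff by simp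

lemma tensor_C_rep:
  assumes "t \<in> tensor lift_scale C lift_scale C"
  shows "keys (rep t) \<subseteq> C \<times> C" "t = coset R (rep t)"
  using tensor_rep[OF vs_lift subspace_C vs_lift subspace_C assms] by blast+

text \<open>Existence and uniqueness in the definite description are both decided by values on
  \<open>N \<times> N\<close>. From here on a coproduct is identified by exhibiting any formal sum
  over \<open>C \<times> C\<close> with the diagonal values.\<close>

lemma comult_H:
  assumes h: "h \<in> C" and f: "keys f \<subseteq> C \<times> C"
    and ev: "\<And>\<eta> \<theta>. \<eta> \<in> N \<Longrightarrow> \<theta> \<in> N \<Longrightarrow> ev2 f \<eta> \<theta> = (if \<eta> = \<theta> then lookup h \<eta> else 0)"
  shows "comult H h = tclass H f"
proof -
  have "comult H h = (THE t. t \<in> tensor lift_scale C lift_scale C \<and>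
        tclass LN (lin_ext lift_scale (\<lambda>(a, b). pure2 a b) (rep t)) = comult LN h)"
    by (simp add: gp_hopf_def Let_def tensor_eval_def)
  also have "\<dots> = coset R f"
  proof (rule the_equality)
    have t: "coset R f \<in> tensor lift_scale C lift_scale C"
      using f unfolding tensor_def by blast
    then show "coset R f \<in> tensor lift_scale C lift_scale C \<and>
        tclass LN (lin_ext lift_scale (\<lambda>(a, b). pure2 a b) (rep (coset R f))) = comult LN h"
      using comult_spec_iff[OF h tensor_C_rep(1)[OF t]] ev by (simp add: ev2_rep_coset)
    fix t assume *: "t \<in> tensor lift_scale C lift_scale C \<and>
        tclass LN (lin_ext lift_scale (\<lambda>(a, b). pure2 a b) (rep t)) = comult LN h"
    then have rep: "keys (rep t) \<subseteq> C \<times> C" "t = coset R (rep t)"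
      using tensor_C_rep by blast+
    have "coset R (rep t) = coset R f"
      using * comult_spec_iff[OF h rep(1)] ev by (intro coset_R_eqI rep f) simp
    with rep show "t = coset R f" by simp
  qed
  finally show ?thesis by (simp add: tclass_H)
qed

text \<open>The formal sum through which \<open>tensor_eval\<close> reads the coproduct; only its
  values on \<open>N \<times> N\<close> and the location of its entries are ever used.\<close>

definition D where "D h = rep (comult H h)"

lemma comult_H_tensor:
  assumes "h \<in> C"
  shows "comult H h \<in> tensor lift_scale C lift_scale C"
    and "\<eta> \<in> N \<Longrightarrow> \<theta> \<in> N \<Longrightarrow> ev2 (D h) \<eta> \<theta> = (if \<eta> = \<theta> then lookup h \<eta> else 0)"
    and "keys (D h) \<subseteq> C \<times> C"
    and "comult H h = tclass H (D h)"
proof -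
  obtain f where f: "keys f \<subseteq> (\<lambda>(x, \<eta>). T x \<eta>) ` (UNIV \<times> keys h) \<times> (\<lambda>(x, \<eta>). T x \<eta>) ` (UNIV \<times> keys h)"
    "\<And>\<eta> \<theta>. \<eta> \<in> N \<Longrightarrow> \<theta> \<in> N \<Longrightarrow> ev2 f \<eta> \<theta> = (if \<eta> = \<theta> then lookup h \<eta> else 0)"
    using diagonal_tensor[OF assms] by blast
  have "(\<lambda>(x, \<eta>). T x \<eta>) ` (UNIV \<times> keys h) \<subseteq> C"
    using CD(1)[OF assms] T_C by auto
  with f(1) have keys: "keys f \<subseteq> C \<times> C" by blast
  have eq: "comult H h = coset R f" using comult_H[OF assms keys f(2)] by (simp add: tclass_H)
  show t: "comult H h \<in> tensor lift_scale C lift_scale C"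
    unfolding eq tensor_def using keys by blast
  show "ev2 (D h) \<eta> \<theta> = (if \<eta> = \<theta> then lookup h \<eta> else 0)" if "\<eta> \<in> N" "\<theta> \<in> N"
    using that f(2) by (simp add: D_def eq ev2_rep_coset)
  show "keys (D h) \<subseteq> C \<times> C" "comult H h = tclass H (D h)"
    using tensor_C_rep[OF t] by (simp_all add: D_def tclass_H)
qed

end

lemma keys_lin_ext2:
  assumes "keys f \<subseteq> U \<times> V"
    and "\<And>u v. u \<in> U \<Longrightarrow> v \<in> V \<Longrightarrow> keys (b u v) \<subseteq> S"
  shows "keys (lin_ext free_scale (\<lambda>(u, v). b u v) f) \<subseteq> S"
proof -
  have "lin_ext free_scale (\<lambda>(u, v). b u v) f \<in> {f. keys f \<subseteq> S}"
    using assms by (intro lin_ext_in_subspace[OF free.vector_space_axioms subspace_keys]) auto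
  then show ?thesis by simp
qed

context greither_pareigis
begin

subsection \<open>Structure maps\<close>

text \<open>The coproduct is concentrated on the diagonal, so in a Sweedler sum of products of
  evaluations only the terms with \<open>p i = q i\<close> survive. Counit, antipode,
  multiplicativity of the coproduct and the module algebra law are computed with it.\<close>

lemma lin_ext_D:
  assumes "h \<in> C" "\<And>i. i \<in> I \<Longrightarrow> p i \<in> N" "\<And>i. i \<in> I \<Longrightarrow> q i \<in> N"
    and "\<And>a b. a \<in> C \<Longrightarrow> b \<in> C \<Longrightarrow>
      F a b = (\<Sum>i\<in>I. w i * (lookup a (p i) * lookup b (q i)))"
  shows "lin_ext (ext_scale emb) (\<lambda>(a, b). F a b) (D h) =
    (\<Sum>i\<in>I. w i * (if p i = q i then lookup h (p i) else 0))"
proof -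
  have "lin_ext (ext_scale emb) (\<lambda>(a, b). F a b) (D h) =
    lin_ext (ext_scale emb) (\<lambda>(a, b). \<Sum>i\<in>I. w i * (lookup a (p i) * lookup b (q i))) (D h)"
    by (rule lin_ext_cong2[OF comult_H_tensor(3)[OF assms(1)] assms(4)])
  also have "\<dots> = (\<Sum>i\<in>I. w i * ev2 (D h) (p i) (q i))"
    by (simp only: lin_ext_sum_right2[OF vs_ext] lin_ext_mult2 ev2_def)
  finally show ?thesis using comult_H_tensor(2)[OF assms(1)] assms(2,3) by simp
qed

lemma one_H: "\<one>\<^bsub>H\<^esub> = single id 1"
  by (simp add: gp_hopf_def group_algebra_def Let_def)

lemma mult_H:
  assumes "s \<in> C" "t \<in> C"
  shows "s \<otimes>\<^bsub>H\<^esub> t = (\<Sum>\<eta>\<in>N. \<Sum>\<theta>\<in>N.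
    single (\<eta> \<circ> \<theta>) (lookup s \<eta> * lookup t \<theta>))"
proof -
  have "s \<otimes>\<^bsub>H\<^esub> t = (\<Sum>\<eta>\<in>keys s. \<Sum>\<theta>\<in>keys t.
    single (\<eta> \<circ> \<theta>) (lookup s \<eta> * lookup t \<theta>))"
    by (simp add: gp_hopf_def group_algebra_def Let_def)
  also have "\<dots> = (\<Sum>\<eta>\<in>keys s. \<Sum>\<theta>\<in>N.
    single (\<eta> \<circ> \<theta>) (lookup s \<eta> * lookup t \<theta>))"
    using CD(1)[OF assms(2)] finite_N
    by (intro sum.cong refl sum.mono_neutral_left) (auto simp: in_keys_iff)
  also have "\<dots> = (\<Sum>\<eta>\<in>N. \<Sum>\<theta>\<in>N.
    single (\<eta> \<circ> \<theta>) (lookup s \<eta> * lookup t \<theta>))"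
    using CD(1)[OF assms(1)] finite_N
    by (intro sum.mono_neutral_left) (auto simp: in_keys_iff)
  finally show ?thesis .
qed

lemma comp_eq_iff:
  assumes "\<theta> \<in> N"
  shows "\<eta> \<circ> \<theta> = \<kappa> \<longleftrightarrow> \<eta> = \<kappa> \<circ> inv_into UNIV \<theta>"
  using inv_N[OF assms] by (metis comp_assoc comp_id)

lemma inv_inv_N: "\<eta> \<in> N \<Longrightarrow> inv_into UNIV (inv_into UNIV \<eta>) = \<eta>"
  by (simp add: N_bij inv_inv_eq)

lemma inv_comp_N: "\<eta> \<in> N \<Longrightarrow> \<theta> \<in> N \<Longrightarrow> inv_into UNIV (\<eta> \<circ> \<theta>) = inv_into UNIV \<theta> \<circ> inv_into UNIV \<eta>"
  by (simp add: N_bij o_inv_distrib)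

lemma bij_inv_N: "bij_betw (inv_into UNIV) N N"
  by (rule bij_betw_byWitness[where f' = "inv_into UNIV"]) (auto simp: inv_N inv_inv_N)

lemma bij_comp_right: "\<theta> \<in> N \<Longrightarrow> bij_betw (\<lambda>\<eta>. \<eta> \<circ> \<theta>) N N"
  by (rule bij_betw_byWitness[where f' = "\<lambda>\<eta>. \<eta> \<circ> inv_into UNIV \<theta>"])
    (auto simp: inv_N comp_N comp_assoc)

lemma lookup_mult_H:
  assumes "s \<in> C" "t \<in> C" "\<kappa> \<in> N"
  shows "lookup (s \<otimes>\<^bsub>H\<^esub> t) \<kappa> =
    (\<Sum>\<theta>\<in>N. lookup s (\<kappa> \<circ> inv_into UNIV \<theta>) * lookup t \<theta>)"
proof -
  have "lookup (s \<otimes>\<^bsub>H\<^esub> t) \<kappa> = (\<Sum>\<theta>\<in>N. \<Sum>\<eta>\<in>N.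
    if \<eta> \<circ> \<theta> = \<kappa> then lookup s \<eta> * lookup t \<theta> else 0)"
    unfolding mult_H[OF assms(1,2)]
    by (subst sum.swap) (simp add: lookup_sum lookup_single when_def)
  also have "\<dots> = (\<Sum>\<theta>\<in>N. lookup s (\<kappa> \<circ> inv_into UNIV \<theta>) * lookup t \<theta>)"
    using finite_N assms by (intro sum.cong refl) (simp add: comp_eq_iff comp_N inv_N)
  finally show ?thesis .
qed

lemma mult_H_closed:
  assumes "s \<in> C" "t \<in> C"
  shows "s \<otimes>\<^bsub>H\<^esub> t \<in> C"
  unfolding mem_C_iff
proof (intro conjI ballI)
  have "s \<otimes>\<^bsub>H\<^esub> t \<in> {f. keys f \<subseteq> N}"
    unfolding mult_H[OF assms] by (intro free.subspace_sum[OF subspace_keys]) (auto simp: comp_N)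
  then show "keys (s \<otimes>\<^bsub>H\<^esub> t) \<subseteq> N" by simp
  fix \<gamma> \<kappa> assume *: "\<gamma> \<in> Gal emb" "\<kappa> \<in> N"
  have "lookup (s \<otimes>\<^bsub>H\<^esub> t) (ac \<gamma> \<kappa>) =
    (\<Sum>\<theta>\<in>N. lookup s (ac \<gamma> \<kappa> \<circ> inv_into UNIV (ac \<gamma> \<theta>)) * lookup t (ac \<gamma> \<theta>))"
    unfolding lookup_mult_H[OF assms ac_N[OF *]]
    by (rule sum.reindex_bij_betw[OF bij_ac[OF *(1)], symmetric])
  also have "\<dots> = \<gamma> (lookup (s \<otimes>\<^bsub>H\<^esub> t) \<kappa>)"
    unfolding lookup_mult_H[OF assms *(2)] Gal_sum[OF *(1)]
    using * assms by (intro sum.cong refl)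
      (simp add: ac_inv[symmetric] ac_comp[symmetric] CD(2) comp_N inv_N GalD)
  finally show "lookup (s \<otimes>\<^bsub>H\<^esub> t) (ac \<gamma> \<kappa>) = \<gamma> (lookup (s \<otimes>\<^bsub>H\<^esub> t) \<kappa>)" .
qed

lemma single_id_C: "single id (emb k) \<in> C"
  unfolding mem_C_iff by (auto simp: id_N lookup_single when_def ac_id_perm GalD Gal_0)
    (metis ac_eq_iff ac_id_perm)+

lemma one_C: "\<one>\<^bsub>H\<^esub> \<in> C"
  using single_id_C[of 1] by (simp add: one_H emb_simps)

lemma add_C: "s \<in> C \<Longrightarrow> t \<in> C \<Longrightarrow> s + t \<in> C"
  and scale_C: "s \<in> C \<Longrightarrow> free_scale (emb k) s \<in> C"
proof -
  interpret vector_space "lift_scale :: 'k \<Rightarrow> ('l perm \<Rightarrow>\<^sub>0 'l) \<Rightarrow> _" by (rule vs_lift)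
  show "s \<in> C \<Longrightarrow> t \<in> C \<Longrightarrow> s + t \<in> C" "s \<in> C \<Longrightarrow> free_scale (emb k) s \<in> C"
    using subspace_add[OF subspace_C] subspace_scale[OF subspace_C] by auto
qed

lemma monoid_H: "monoid H"
proof
  fix s t u assume "s \<in> C" "t \<in> C" "u \<in> C"
  note * = this
  show "s \<otimes>\<^bsub>H\<^esub> t \<otimes>\<^bsub>H\<^esub> u = s \<otimes>\<^bsub>H\<^esub> (t \<otimes>\<^bsub>H\<^esub> u)"
  proof (rule C_eqI)
    fix \<kappa> assume \<kappa>: "\<kappa> \<in> N"
    have "lookup (s \<otimes>\<^bsub>H\<^esub> (t \<otimes>\<^bsub>H\<^esub> u)) \<kappa> =
      (\<Sum>\<phi>\<in>N. \<Sum>\<theta>\<in>N. lookup s (\<kappa> \<circ> inv_into UNIV \<phi>) *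
        (lookup t (\<phi> \<circ> inv_into UNIV \<theta>) * lookup u \<theta>))"
      using * \<kappa> by (simp add: lookup_mult_H mult_H_closed sum_distrib_left)
    also have "\<dots> = (\<Sum>\<theta>\<in>N. \<Sum>\<phi>\<in>N. lookup s (\<kappa> \<circ> inv_into UNIV \<phi>) *
        (lookup t (\<phi> \<circ> inv_into UNIV \<theta>) * lookup u \<theta>))"
      by (rule sum.swap)
    also have "\<dots> = (\<Sum>\<theta>\<in>N. \<Sum>\<phi>\<in>N. lookup s (\<kappa> \<circ> inv_into UNIV (\<phi> \<circ> \<theta>)) *
        (lookup t (\<phi> \<circ> \<theta> \<circ> inv_into UNIV \<theta>) * lookup u \<theta>))"
      by (intro sum.cong refl sum.reindex_bij_betw[OF bij_comp_right, symmetric])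
    also have "\<dots> = lookup (s \<otimes>\<^bsub>H\<^esub> t \<otimes>\<^bsub>H\<^esub> u) \<kappa>"
      using * \<kappa> by (simp add: lookup_mult_H mult_H_closed comp_N inv_N sum_distrib_right inv_comp_N comp_assoc mult.assoc)
    finally show "lookup (s \<otimes>\<^bsub>H\<^esub> t \<otimes>\<^bsub>H\<^esub> u) \<kappa> = lookup (s \<otimes>\<^bsub>H\<^esub> (t \<otimes>\<^bsub>H\<^esub> u)) \<kappa>" by simp
  qed (use * mult_H_closed in auto)
next
  fix s assume s: "s \<in> C"
  show "\<one>\<^bsub>H\<^esub> \<otimes>\<^bsub>H\<^esub> s = s"
  proof (rule C_eqI)
    fix \<kappa> assume \<kappa>: "\<kappa> \<in> N"
    have "lookup (\<one>\<^bsub>H\<^esub> \<otimes>\<^bsub>H\<^esub> s) \<kappa> = (\<Sum>\<theta>\<in>N. if \<theta> = \<kappa> then lookup s \<kappa> else 0)"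
      unfolding lookup_mult_H[OF one_C s \<kappa>] unfolding one_H
    proof (intro sum.cong refl)
      fix \<theta> assume "\<theta> \<in> N"
      then have "id = \<kappa> \<circ> inv_into UNIV \<theta> \<longleftrightarrow> \<theta> = \<kappa>" by (simp flip: comp_eq_iff)
      then show "lookup (single id 1) (\<kappa> \<circ> inv_into UNIV \<theta>) * lookup s \<theta> =
        (if \<theta> = \<kappa> then lookup s \<kappa> else 0)" by (simp add: lookup_single)
    qed
    then show "lookup (\<one>\<^bsub>H\<^esub> \<otimes>\<^bsub>H\<^esub> s) \<kappa> = lookup s \<kappa>"
      using finite_N \<kappa> by simp
  qed (use s mult_H_closed one_C in auto)
  show "s \<otimes>\<^bsub>H\<^esub> \<one>\<^bsub>H\<^esub> = s"
  proof (rule C_eqI)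
    fix \<kappa> assume \<kappa>: "\<kappa> \<in> N"
    have "lookup (s \<otimes>\<^bsub>H\<^esub> \<one>\<^bsub>H\<^esub>) \<kappa> = (\<Sum>\<theta>\<in>N. if \<theta> = id then lookup s \<kappa> else 0)"
      unfolding lookup_mult_H[OF s one_C \<kappa>] unfolding one_H
      by (intro sum.cong refl) (auto simp: lookup_single when_def inv_id)
    then show "lookup (s \<otimes>\<^bsub>H\<^esub> \<one>\<^bsub>H\<^esub>) \<kappa> = lookup s \<kappa>"
      using finite_N id_N by simp
  qed (use s mult_H_closed one_C in auto)
qed (use one_C mult_H_closed in auto)

lemma assoc_unital_algebra_H: "assoc_unital_algebra H"
proof (rule assoc_unital_algebra.intro[OF vs_H subspace_H monoid_H])
  fix x y z and k :: 'k assume xy: "x \<in> C" "y \<in> C"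
  show "scale H k x \<otimes>\<^bsub>H\<^esub> y = scale H k (x \<otimes>\<^bsub>H\<^esub> y)" "x \<otimes>\<^bsub>H\<^esub> scale H k y = scale H k (x \<otimes>\<^bsub>H\<^esub> y)"
    unfolding scale_H using xy
    by (auto intro!: C_eqI mult_H_closed scale_C simp: lookup_mult_H mult_H_closed scale_C sum_distrib_left mult_ac)
  assume z: "z \<in> C"
  show "x \<otimes>\<^bsub>H\<^esub> (y + z) = x \<otimes>\<^bsub>H\<^esub> y + x \<otimes>\<^bsub>H\<^esub> z" "(x + y) \<otimes>\<^bsub>H\<^esub> z = x \<otimes>\<^bsub>H\<^esub> z + y \<otimes>\<^bsub>H\<^esub> z"
    using xy z
    by (auto intro!: C_eqI mult_H_closed add_C
      simp: lookup_mult_H mult_H_closed add_C lookup_add distrib_left distrib_right sum.distrib)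
qed

text \<open>\<Gamma> permutes \<open>N\<close> by conjugation, so the sum of all coefficients of an
  equivariant function is Galois invariant and comes from \<open>K\<close>; this resolves the
  definite description of the counit.\<close>

lemma emb_counit_H:
  assumes "h \<in> C"
  shows "emb (counit H h) = (\<Sum>\<eta>\<in>N. lookup h \<eta>)"
proof -
  have eq: "counit LN h = (\<Sum>\<eta>\<in>N. lookup h \<eta>)"
    using CD(1)[OF assms] finite_N
    by (auto simp: group_algebra_def Let_def in_keys_iff intro: sum.mono_neutral_left)
  have "\<gamma> (\<Sum>\<eta>\<in>N. lookup h \<eta>) = (\<Sum>\<eta>\<in>N. lookup h \<eta>)" if "\<gamma> \<in> Gal emb" for \<gamma>
    using sum.reindex_bij_betw[OF bij_ac[OF that], of "lookup h"] assms that
    by (simp add: Gal_sum CD(2))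
  then have "(\<Sum>\<eta>\<in>N. lookup h \<eta>) \<in> range emb" by (rule in_range_emb)
  then obtain k where "emb k = (\<Sum>\<eta>\<in>N. lookup h \<eta>)" by (metis rangeE)
  moreover have "counit H h = (THE k. emb k = (\<Sum>\<eta>\<in>N. lookup h \<eta>))"
    unfolding eq[symmetric] by (simp add: gp_hopf_def Let_def)
  ultimately show ?thesis
    by (simp add: the_equality flip: emb_eq_iff)
qed

lemma lookup_antipode_H:
  assumes "h \<in> C" "\<kappa> \<in> N"
  shows "lookup (antipode H h) \<kappa> = lookup h (inv_into UNIV \<kappa>)"
proof -
  have "lookup (antipode H h) \<kappa> =
      (\<Sum>\<eta>\<in>N. lookup h \<eta> * lookup (single (inv_into UNIV \<eta>) 1) \<kappa>)"
    by (simp add: gp_hopf_def group_algebra_def Let_def lookup_lin_ext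
        lin_ext_superset[OF vector_space_times finite_N CD(1)[OF assms(1)]])
  also have "\<dots> = (\<Sum>\<eta>\<in>N. if \<eta> = inv_into UNIV \<kappa> then lookup h (inv_into UNIV \<kappa>) else 0)"
    using assms(2) by (intro sum.cong refl) (auto simp: lookup_single when_def inv_inv_N)
  finally show ?thesis using finite_N assms inv_N by simp
qed

lemma antipode_H_closed:
  assumes "h \<in> C"
  shows "antipode H h \<in> C"
  unfolding mem_C_iff
proof (intro conjI ballI)
  have "antipode H h = lin_ext free_scale (\<lambda>\<eta>. single (inv_into UNIV \<eta>) 1) h"
    by (simp add: gp_hopf_def group_algebra_def Let_def)
  also have "\<dots> \<in> {f. keys f \<subseteq> N}"
    by (rule lin_ext_in_subspace[OF free.vector_space_axioms subspace_keys])
      (use CD(1)[OF assms] inv_N in auto)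
  finally show "keys (antipode H h) \<subseteq> N" by simp
qed (use assms in \<open>simp add: lookup_antipode_H ac_inv[symmetric] CD(2) inv_N\<close>)

section \<open>Coalgebra and Hopf axioms by evaluation on \<open>N\<close>\<close>

lemma tensor_eval_comult: "tensor_eval s b (comult H h) = lin_ext s (\<lambda>(u, v). b u v) (D h)"
  by (simp add: tensor_eval_def D_def)

lemma lin_ext_lift_C:
  "(\<And>x. x \<in> keys f \<Longrightarrow> b x \<in> C) \<Longrightarrow> lin_ext lift_scale b f \<in> C"
  by (rule lin_ext_in_subspace[OF vs_lift subspace_C])

lemma keys_D: "h \<in> C \<Longrightarrow> (a, b) \<in> keys (D h) \<Longrightarrow> a \<in> C"
  "h \<in> C \<Longrightarrow> (a, b) \<in> keys (D h) \<Longrightarrow> b \<in> C"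
  using comult_H_tensor(3) by blast+

lemma tclass3_eqI:
  assumes "keys f \<subseteq> C \<times> C \<times> C" "keys g \<subseteq> C \<times> C \<times> C"
    and "\<And>\<eta> \<theta> \<kappa>. \<eta> \<in> N \<Longrightarrow> \<theta> \<in> N \<Longrightarrow> \<kappa> \<in> N \<Longrightarrow> ev3 f \<eta> \<theta> \<kappa> = ev3 g \<eta> \<theta> \<kappa>"
  shows "tclass3 H f = tclass3 H g"
  unfolding tclass3_def scale_H coset_eq_iff[OF subspace_tensor_rel3]
  using assms free.subspace_diff[OF subspace_keys[of "C \<times> C \<times> C"], of f g]
  by (intro tensor_rel3_C_if) (auto simp: ev3_diff)

lemma comult_H_sum:
  assumes "g \<in> C" "h \<in> C"
  shows "comult H (g + h) = tclass H (D g + D h)"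
proof (rule comult_H)
  show "keys (D g + D h) \<subseteq> C \<times> C"
    using free.subspace_add[OF subspace_keys[of "C \<times> C"], of "D g" "D h"] comult_H_tensor(3) assms by auto
  have "ev2 (D g + D h) \<eta> \<theta> = ev2 (D g) \<eta> \<theta> + ev2 (D h) \<eta> \<theta>" for \<eta> \<theta>
    by (simp add: ev2_def lin_ext_add[OF vs_ext])
  then show "ev2 (D g + D h) \<eta> \<theta> = (if \<eta> = \<theta> then lookup (g + h) \<eta> else 0)"
    if "\<eta> \<in> N" "\<theta> \<in> N" for \<eta> \<theta>
    using that assms by (simp add: comult_H_tensor lookup_add)
qed (use assms add_C in auto)

lemma comult_H_scale:
  assumes "h \<in> C"
  shows "comult H (free_scale (emb k) h) = tclass H (free_scale k (D h))"
proof (rule comult_H)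
  show "keys (free_scale k (D h)) \<subseteq> C \<times> C"
    by (rule order_trans[OF keys_free_scale comult_H_tensor(3)[OF assms]])
  have "ev2 (free_scale k (D h)) \<eta> \<theta> = emb k * ev2 (D h) \<eta> \<theta>" for \<eta> \<theta>
    by (simp add: ev2_def lin_ext_scale[OF vs_ext] ext_scale_def)
  then show "ev2 (free_scale k (D h)) \<eta> \<theta> = (if \<eta> = \<theta> then lookup (free_scale (emb k) h) \<eta> else 0)"
    if "\<eta> \<in> N" "\<theta> \<in> N" for \<eta> \<theta>
    using that assms by (simp add: comult_H_tensor)
qed (use assms scale_C in auto)

lemma ev2_reassoc_left:
  assumes "a \<in> C" "\<eta> \<in> N" "\<theta> \<in> N"
  shows "ev3 (lin_ext free_scale (\<lambda>(u, v). pure3 u v b) (D a)) \<eta> \<theta> \<kappa> =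
    (if \<eta> = \<theta> then lookup a \<eta> else 0) * lookup b \<kappa>"
proof -
  have "ev3 (lin_ext free_scale (\<lambda>(u, v). pure3 u v b) (D a)) \<eta> \<theta> \<kappa> =
    lin_ext (ext_scale emb) (\<lambda>(u, v). lookup b \<kappa> * (lookup u \<eta> * lookup v \<theta>)) (D a)"
    unfolding ev3_lin_ext by (rule lin_ext_cong) (auto simp: ev3_pure3)
  then show ?thesis
    using comult_H_tensor(2)[OF assms] unfolding lin_ext_mult2 ev2_def[symmetric] by simp
qed

lemma ev2_reassoc_right:
  assumes "b \<in> C" "\<theta> \<in> N" "\<kappa> \<in> N"
  shows "ev3 (lin_ext free_scale (\<lambda>(u, v). pure3 a u v) (D b)) \<eta> \<theta> \<kappa> =
    lookup a \<eta> * (if \<theta> = \<kappa> then lookup b \<theta> else 0)"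
proof -
  have "ev3 (lin_ext free_scale (\<lambda>(u, v). pure3 a u v) (D b)) \<eta> \<theta> \<kappa> =
    lin_ext (ext_scale emb) (\<lambda>(u, v). lookup a \<eta> * (lookup u \<theta> * lookup v \<kappa>)) (D b)"
    unfolding ev3_lin_ext by (rule lin_ext_cong) (auto simp: ev3_pure3)
  then show ?thesis
    using comult_H_tensor(2)[OF assms] unfolding lin_ext_mult2 ev2_def[symmetric] by simp
qed

text \<open>Both iterated coproducts take the values of \<open>x\<close> on the triple diagonal and
  vanish off it.\<close>

lemma coassoc_H:
  assumes x: "x \<in> C"
  shows "tclass3 H (tensor_eval free_scale
      (\<lambda>a b. tensor_eval free_scale (\<lambda>a1 a2. pure3 a1 a2 b) (comult H a)) (comult H x)) =
    tclass3 H (tensor_eval free_scale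
      (\<lambda>a b. tensor_eval free_scale (\<lambda>b1 b2. pure3 a b1 b2) (comult H b)) (comult H x))"
  unfolding tensor_eval_comult
proof (rule tclass3_eqI)
  show "keys (lin_ext free_scale (\<lambda>(u, v). lin_ext free_scale (\<lambda>(a, b). pure3 a b v) (D u)) (D x)) \<subseteq> C \<times> C \<times> C"
    by (intro keys_lin_ext2[OF comult_H_tensor(3)] x) auto
  show "keys (lin_ext free_scale (\<lambda>(u, v). lin_ext free_scale (\<lambda>(a, b). pure3 u a b) (D v)) (D x)) \<subseteq> C \<times> C \<times> C"
    by (intro keys_lin_ext2[OF comult_H_tensor(3)] x) auto
  fix \<eta> \<theta> \<kappa> assume N: "\<eta> \<in> N" "\<theta> \<in> N" "\<kappa> \<in> N"
  have 1: "ev3 (lin_ext free_scale (\<lambda>(u, v). lin_ext free_scale (\<lambda>(a, b). pure3 a b v) (D u)) (D x)) \<eta> \<theta> \<kappa> =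
    lin_ext (ext_scale emb) (\<lambda>(u, v). (if \<eta> = \<theta> then 1 else 0) * (lookup u \<eta> * lookup v \<kappa>)) (D x)"
    unfolding ev3_lin_ext using N x by (intro lin_ext_cong) (auto simp: ev2_reassoc_left dest: keys_D)
  have 2: "ev3 (lin_ext free_scale (\<lambda>(u, v). lin_ext free_scale (\<lambda>(a, b). pure3 u a b) (D v)) (D x)) \<eta> \<theta> \<kappa> =
    lin_ext (ext_scale emb) (\<lambda>(u, v). (if \<theta> = \<kappa> then 1 else 0) * (lookup u \<eta> * lookup v \<theta>)) (D x)"
    unfolding ev3_lin_ext using N x by (intro lin_ext_cong) (auto simp: ev2_reassoc_right dest: keys_D)
  show "ev3 (lin_ext free_scale (\<lambda>(u, v). lin_ext free_scale (\<lambda>(a, b). pure3 a b v) (D u)) (D x)) \<eta> \<theta> \<kappa> =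
    ev3 (lin_ext free_scale (\<lambda>(u, v). lin_ext free_scale (\<lambda>(a, b). pure3 u a b) (D v)) (D x)) \<eta> \<theta> \<kappa>"
    unfolding 1 2 lin_ext_mult2 ev2_def[symmetric] using N x by (simp add: comult_H_tensor)
qed

lemma coalgebra_H: "coalgebra H"
proof (rule coalgebra.intro)
  fix x assume x: "x \<in> C"
  show "comult H x \<in> hopf_tensor H"
    unfolding hopf_tensor_def scale_H by (rule comult_H_tensor(1)[OF x])
  fix k show "comult H (scale H k x) = tclass H (free_scale k (rep (comult H x)))"
    using comult_H_scale[OF x] by (simp add: scale_H D_def)
  show "counit H (scale H k x) = k * counit H x"
    using x scale_C[OF x, of k] by (simp add: scale_H emb_counit_H emb_simps sum_distrib_left flip: emb_eq_iff)
  show "tensor_eval (scale H) (\<lambda>a b. scale H (counit H a) b) (comult H x) = x"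
    unfolding scale_H tensor_eval_comult
  proof (rule C_eqI)
    fix \<kappa> assume \<kappa>: "\<kappa> \<in> N"
    have "lookup (lin_ext lift_scale (\<lambda>(a, b). free_scale (emb (counit H a)) b) (D x)) \<kappa> =
      lin_ext (ext_scale emb) (\<lambda>(a, b). emb (counit H a) * lookup b \<kappa>) (D x)"
      unfolding lookup_lin_ext_lift by (rule lin_ext_cong) auto
    \<comment> \<open>\<open>emb (counit H a)\<close> is the sum of all values of \<open>a\<close>,
      so the first index runs through \<open>N\<close> while the second stays at
      \<open>\<kappa>\<close>.\<close>
    also have "\<dots> = (\<Sum>\<eta>\<in>N. 1 * (if \<eta> = \<kappa> then lookup x \<eta> else 0))"
      by (rule lin_ext_D[OF x]) (auto simp: \<kappa> emb_counit_H sum_distrib_right)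
    finally show "lookup (lin_ext lift_scale (\<lambda>(a, b). free_scale (emb (counit H a)) b) (D x)) \<kappa> = lookup x \<kappa>"
      using finite_N \<kappa> by simp
  qed (use x in \<open>auto intro!: lin_ext_lift_C scale_C dest: keys_D\<close>)
  show "tensor_eval (scale H) (\<lambda>a b. scale H (counit H b) a) (comult H x) = x"
    unfolding scale_H tensor_eval_comult
  proof (rule C_eqI)
    fix \<kappa> assume \<kappa>: "\<kappa> \<in> N"
    have "lookup (lin_ext lift_scale (\<lambda>(a, b). free_scale (emb (counit H b)) a) (D x)) \<kappa> =
      lin_ext (ext_scale emb) (\<lambda>(a, b). emb (counit H b) * lookup a \<kappa>) (D x)"
      unfolding lookup_lin_ext_lift by (rule lin_ext_cong) auto
    also have "\<dots> = (\<Sum>\<eta>\<in>N. 1 * (if \<kappa> = \<eta> then lookup x \<kappa> else 0))"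
      by (rule lin_ext_D[OF x]) (auto simp: \<kappa> emb_counit_H sum_distrib_left mult.commute)
    finally show "lookup (lin_ext lift_scale (\<lambda>(a, b). free_scale (emb (counit H b)) a) (D x)) \<kappa> = lookup x \<kappa>"
      using finite_N \<kappa> by simp
  qed (use x in \<open>auto intro!: lin_ext_lift_C scale_C dest: keys_D\<close>)
  fix y assume y: "y \<in> C"
  show "comult H (x + y) = tclass H (rep (comult H x) + rep (comult H y))"
    using comult_H_sum[OF x y] by (simp add: D_def)
  show "counit H (x + y) = counit H x + counit H y"
    using x y add_C[OF x y] by (simp add: emb_counit_H emb_simps lookup_add sum.distrib flip: emb_eq_iff)
qed (rule coassoc_H)

text \<open>Evaluated from the inside, the coproduct of \<open>y\<close> forces the same
  \<open>\<theta>\<close> in both convolutions; that of \<open>x\<close> then forces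
  \<open>\<kappa> = \<mu>\<close>, since right translation by \<open>inv_into UNIV \<theta>\<close>
  is injective.\<close>

lemma comult_H_mult:
  assumes x: "x \<in> C" and y: "y \<in> C"
  shows "comult H (x \<otimes>\<^bsub>H\<^esub> y) = tclass H (tensor_eval free_scale
      (\<lambda>a b. tensor_eval free_scale (\<lambda>c d. pure2 (a \<otimes>\<^bsub>H\<^esub> c) (b \<otimes>\<^bsub>H\<^esub> d)) (comult H y)) (comult H x))"
  unfolding tensor_eval_comult
proof (rule comult_H[OF mult_H_closed[OF x y]])
  show "keys (lin_ext free_scale (\<lambda>(u, v). lin_ext free_scale
      (\<lambda>(a, b). pure2 (u \<otimes>\<^bsub>H\<^esub> a) (v \<otimes>\<^bsub>H\<^esub> b)) (D y)) (D x)) \<subseteq> C \<times> C"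
    by (intro keys_lin_ext2[OF comult_H_tensor(3)] x y) (auto intro: mult_H_closed)
  fix \<kappa> \<mu> assume N: "\<kappa> \<in> N" "\<mu> \<in> N"
  have inner: "ev2 (lin_ext free_scale (\<lambda>(a, b). pure2 (u \<otimes>\<^bsub>H\<^esub> a) (v \<otimes>\<^bsub>H\<^esub> b)) (D y)) \<kappa> \<mu> =
    (\<Sum>\<theta>\<in>N. lookup y \<theta> * (lookup u (\<kappa> \<circ> inv_into UNIV \<theta>) * lookup v (\<mu> \<circ> inv_into UNIV \<theta>)))"
    if uv: "u \<in> C" "v \<in> C" for u v
  proof -
    have "ev2 (lin_ext free_scale (\<lambda>(a, b). pure2 (u \<otimes>\<^bsub>H\<^esub> a) (v \<otimes>\<^bsub>H\<^esub> b)) (D y)) \<kappa> \<mu> =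
      lin_ext (ext_scale emb) (\<lambda>(a, b). lookup (u \<otimes>\<^bsub>H\<^esub> a) \<kappa> * lookup (v \<otimes>\<^bsub>H\<^esub> b) \<mu>) (D y)"
      unfolding ev2_lin_ext by (rule lin_ext_cong) (auto simp: ev2_pure2)
    also have "\<dots> = (\<Sum>i\<in>N \<times> N. lookup u (\<kappa> \<circ> inv_into UNIV (fst i)) * lookup v (\<mu> \<circ> inv_into UNIV (snd i)) *
        (if fst i = snd i then lookup y (fst i) else 0))"
      by (rule lin_ext_D[OF y])
        (auto simp: lookup_mult_H uv N sum_product sum.cartesian_product case_prod_unfold mult_ac)
    also have "\<dots> = (\<Sum>\<theta>\<in>N. \<Sum>\<phi>\<in>N. if \<theta> = \<phi> then lookup y \<theta> * (lookup u (\<kappa> \<circ> inv_into UNIV \<theta>) * lookup v (\<mu> \<circ> inv_into UNIV \<theta>)) else 0)"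
      unfolding sum.cartesian_product by (rule sum.cong) auto
    finally show ?thesis using finite_N by simp
  qed
  have "ev2 (lin_ext free_scale (\<lambda>(u, v). lin_ext free_scale
      (\<lambda>(a, b). pure2 (u \<otimes>\<^bsub>H\<^esub> a) (v \<otimes>\<^bsub>H\<^esub> b)) (D y)) (D x)) \<kappa> \<mu> =
    lin_ext (ext_scale emb) (\<lambda>(u, v). ev2 (lin_ext free_scale
      (\<lambda>(a, b). pure2 (u \<otimes>\<^bsub>H\<^esub> a) (v \<otimes>\<^bsub>H\<^esub> b)) (D y)) \<kappa> \<mu>) (D x)"
    unfolding ev2_lin_ext[of _ "D x"] by (rule lin_ext_cong) auto
  also have "\<dots> = (\<Sum>\<theta>\<in>N. lookup y \<theta> * (if \<kappa> \<circ> inv_into UNIV \<theta> = \<mu> \<circ> inv_into UNIV \<theta>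
      then lookup x (\<kappa> \<circ> inv_into UNIV \<theta>) else 0))"
    by (rule lin_ext_D[OF x]) (auto simp: N comp_N inv_N inner)
  also have "\<dots> = (\<Sum>\<theta>\<in>N. if \<kappa> = \<mu> then lookup x (\<kappa> \<circ> inv_into UNIV \<theta>) * lookup y \<theta> else 0)"
  proof (intro sum.cong refl)
    fix \<theta> assume "\<theta> \<in> N"
    then have "\<kappa> \<circ> inv_into UNIV \<theta> = \<mu> \<circ> inv_into UNIV \<theta> \<longleftrightarrow> \<kappa> = \<mu>"
      using comp_eq_iff inv_N by (metis comp_assoc comp_id)
    then show "lookup y \<theta> * (if \<kappa> \<circ> inv_into UNIV \<theta> = \<mu> \<circ> inv_into UNIV \<theta>
        then lookup x (\<kappa> \<circ> inv_into UNIV \<theta>) else 0) =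
      (if \<kappa> = \<mu> then lookup x (\<kappa> \<circ> inv_into UNIV \<theta>) * lookup y \<theta> else 0)" by simp
  qed
  finally show "ev2 (lin_ext free_scale (\<lambda>(u, v). lin_ext free_scale
      (\<lambda>(a, b). pure2 (u \<otimes>\<^bsub>H\<^esub> a) (v \<otimes>\<^bsub>H\<^esub> b)) (D y)) (D x)) \<kappa> \<mu> =
    (if \<kappa> = \<mu> then lookup (x \<otimes>\<^bsub>H\<^esub> y) \<kappa> else 0)"
    using N by (simp add: lookup_mult_H x y)
qed

lemma counit_H_mult:
  assumes x: "x \<in> C" and y: "y \<in> C"
  shows "counit H (x \<otimes>\<^bsub>H\<^esub> y) = counit H x * counit H y"
proof -
  have "(\<Sum>\<kappa>\<in>N. lookup (x \<otimes>\<^bsub>H\<^esub> y) \<kappa>) =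
    (\<Sum>\<kappa>\<in>N. \<Sum>\<theta>\<in>N. lookup x (\<kappa> \<circ> inv_into UNIV \<theta>) * lookup y \<theta>)"
    by (simp add: lookup_mult_H x y)
  also have "\<dots> = (\<Sum>\<theta>\<in>N. \<Sum>\<kappa>\<in>N. lookup x (\<kappa> \<circ> inv_into UNIV \<theta>) * lookup y \<theta>)"
    by (rule sum.swap)
  also have "\<dots> = (\<Sum>\<theta>\<in>N. \<Sum>\<kappa>\<in>N. lookup x \<kappa> * lookup y \<theta>)"
    by (intro sum.cong refl sum.reindex_bij_betw[OF bij_comp_right[OF inv_N(1)]])
  also have "\<dots> = (\<Sum>\<kappa>\<in>N. lookup x \<kappa>) * (\<Sum>\<theta>\<in>N. lookup y \<theta>)"
    unfolding sum_product by (rule sum.swap)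
  finally show ?thesis
    using emb_counit_H[OF mult_H_closed[OF x y]] emb_counit_H[OF x] emb_counit_H[OF y]
    by (simp add: emb_simps flip: emb_eq_iff)
qed

lemma lookup_scale_one_H:
  "x \<in> C \<Longrightarrow> lookup (free_scale (emb (counit H x)) \<one>\<^bsub>H\<^esub>) \<kappa> =
    (if \<kappa> = id then (\<Sum>\<eta>\<in>N. lookup x \<eta>) else 0)"
  by (simp add: one_H emb_counit_H lookup_single when_def)

text \<open>At \<open>\<kappa>\<close>, the product pairs the values of the two factors at
  \<open>\<theta> \<circ> inv_into UNIV \<kappa>\<close> and at \<open>\<theta>\<close>. On a
  diagonal coproduct these meet only for \<open>\<kappa> = id\<close>, where the sum over
  \<open>\<theta>\<close> is the counit.\<close>

lemma antipode_H_left: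
  assumes x: "x \<in> C"
  shows "tensor_eval (scale H) (\<lambda>a b. antipode H a \<otimes>\<^bsub>H\<^esub> b) (comult H x) = scale H (counit H x) \<one>\<^bsub>H\<^esub>"
  unfolding scale_H tensor_eval_comult
proof (rule C_eqI)
  fix \<kappa> assume \<kappa>: "\<kappa> \<in> N"
  have "lookup (lin_ext lift_scale (\<lambda>(a, b). antipode H a \<otimes>\<^bsub>H\<^esub> b) (D x)) \<kappa> =
    lin_ext (ext_scale emb) (\<lambda>(a, b). lookup (antipode H a \<otimes>\<^bsub>H\<^esub> b) \<kappa>) (D x)"
    unfolding lookup_lin_ext_lift by (rule lin_ext_cong) auto
  also have "\<dots> = (\<Sum>\<theta>\<in>N. 1 * (if \<theta> \<circ> inv_into UNIV \<kappa> = \<theta> then lookup x (\<theta> \<circ> inv_into UNIV \<kappa>) else 0))"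
    by (rule lin_ext_D[OF x])
      (auto simp: \<kappa> comp_N inv_N lookup_mult_H antipode_H_closed lookup_antipode_H inv_comp_N inv_inv_N)
  also have "\<dots> = (\<Sum>\<theta>\<in>N. if \<kappa> = id then lookup x \<theta> else 0)"
  proof (intro sum.cong refl)
    fix \<theta> assume \<theta>: "\<theta> \<in> N"
    have "\<theta> \<circ> inv_into UNIV \<kappa> = \<theta> \<longleftrightarrow> \<kappa> = id"
      using inv_N[OF \<theta>] inv_N[OF \<kappa>] by (metis comp_assoc comp_id id_comp)
    then show "1 * (if \<theta> \<circ> inv_into UNIV \<kappa> = \<theta> then lookup x (\<theta> \<circ> inv_into UNIV \<kappa>) else 0) =
      (if \<kappa> = id then lookup x \<theta> else 0)" by simp
  qed
  finally show "lookup (lin_ext lift_scale (\<lambda>(a, b). antipode H a \<otimes>\<^bsub>H\<^esub> b) (D x)) \<kappa> =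
    lookup (free_scale (emb (counit H x)) \<one>\<^bsub>H\<^esub>) \<kappa>"
    by (simp add: lookup_scale_one_H x del: lookup_free_scale)
qed (use x in \<open>auto intro!: lin_ext_lift_C mult_H_closed antipode_H_closed scale_C one_C dest: keys_D\<close>)

lemma antipode_H_right:
  assumes x: "x \<in> C"
  shows "tensor_eval (scale H) (\<lambda>a b. a \<otimes>\<^bsub>H\<^esub> antipode H b) (comult H x) = scale H (counit H x) \<one>\<^bsub>H\<^esub>"
  unfolding scale_H tensor_eval_comult
proof (rule C_eqI)
  fix \<kappa> assume \<kappa>: "\<kappa> \<in> N"
  have "lookup (lin_ext lift_scale (\<lambda>(a, b). a \<otimes>\<^bsub>H\<^esub> antipode H b) (D x)) \<kappa> =
    lin_ext (ext_scale emb) (\<lambda>(a, b). lookup (a \<otimes>\<^bsub>H\<^esub> antipode H b) \<kappa>) (D x)"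
    unfolding lookup_lin_ext_lift by (rule lin_ext_cong) auto
  also have "\<dots> = (\<Sum>\<theta>\<in>N. 1 * (if \<kappa> \<circ> inv_into UNIV \<theta> = inv_into UNIV \<theta> then lookup x (\<kappa> \<circ> inv_into UNIV \<theta>) else 0))"
    by (rule lin_ext_D[OF x])
      (auto simp: \<kappa> comp_N inv_N lookup_mult_H antipode_H_closed lookup_antipode_H)
  also have "\<dots> = (\<Sum>\<theta>\<in>N. if \<kappa> = id then lookup x (inv_into UNIV \<theta>) else 0)"
  proof (intro sum.cong refl)
    fix \<theta> assume \<theta>: "\<theta> \<in> N"
    have "\<kappa> \<circ> inv_into UNIV \<theta> = inv_into UNIV \<theta> \<longleftrightarrow> \<kappa> = id"
      using inv_N[OF \<theta>] by (metis comp_assoc comp_id id_comp)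
    then show "1 * (if \<kappa> \<circ> inv_into UNIV \<theta> = inv_into UNIV \<theta> then lookup x (\<kappa> \<circ> inv_into UNIV \<theta>) else 0) =
      (if \<kappa> = id then lookup x (inv_into UNIV \<theta>) else 0)" by simp
  qed
  finally show "lookup (lin_ext lift_scale (\<lambda>(a, b). a \<otimes>\<^bsub>H\<^esub> antipode H b) (D x)) \<kappa> =
    lookup (free_scale (emb (counit H x)) \<one>\<^bsub>H\<^esub>) \<kappa>"
    using sum.reindex_bij_betw[OF bij_inv_N, of "lookup x"]
    by (simp add: lookup_scale_one_H x del: lookup_free_scale)
qed (use x in \<open>auto intro!: lin_ext_lift_C mult_H_closed antipode_H_closed scale_C one_C dest: keys_D\<close>)

lemma hopf_algebra_H: "hopf_algebra H"
proof (intro hopf_algebra.intro assoc_unital_algebra_H coalgebra_H hopf_algebra_axioms.intro)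
  show "comult H \<one>\<^bsub>H\<^esub> = tclass H (pure2 \<one>\<^bsub>H\<^esub> \<one>\<^bsub>H\<^esub>)"
    by (rule comult_H) (auto simp: one_C ev2_pure2, auto simp: one_H lookup_single when_def)
  show "counit H \<one>\<^bsub>H\<^esub> = 1"
    using emb_counit_H[OF one_C] finite_N id_N
    by (simp add: one_H lookup_single when_def emb_simps flip: emb_eq_iff)
  fix x assume x: "x \<in> C"
  show "antipode H (scale H k x) = scale H k (antipode H x)" for k
    unfolding scale_H using x
    by (intro C_eqI) (simp_all add: antipode_H_closed scale_C lookup_antipode_H)
  show "antipode H (x + y) = antipode H x + antipode H y" if "y \<in> C" for y
    using x that
    by (intro C_eqI) (simp_all add: antipode_H_closed add_C lookup_antipode_H lookup_add)
qed (simp_all only: antipode_H_closed antipode_H_left antipode_H_right comult_H_mult counit_H_mult)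

text \<open>A function concentrated on the diagonal is symmetric.\<close>

lemma cocommutative_H: "cocommutative H"
  unfolding cocommutative_def tensor_eval_comult
proof (intro ballI comult_H)
  fix x assume x: "x \<in> C"
  show "keys (lin_ext free_scale (\<lambda>(a, b). pure2 b a) (D x)) \<subseteq> C \<times> C"
    by (intro keys_lin_ext2[OF comult_H_tensor(3)] x) auto
  fix \<eta> \<theta> assume N: "\<eta> \<in> N" "\<theta> \<in> N"
  have "ev2 (lin_ext free_scale (\<lambda>(a, b). pure2 b a) (D x)) \<eta> \<theta> = ev2 (D x) \<theta> \<eta>"
    unfolding ev2_lin_ext unfolding ev2_def[of "D x"] by (rule lin_ext_cong) (auto simp: ev2_pure2)
  then show "ev2 (lin_ext free_scale (\<lambda>(a, b). pure2 b a) (D x)) \<eta> \<theta> = (if \<eta> = \<theta> then lookup x \<eta> else 0)"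
    using comult_H_tensor(2)[OF x N(2,1)] by simp
qed

lemma finite_dim_H: "finite_dim (scale H) C"
proof -
  interpret vector_space "lift_scale :: 'k \<Rightarrow> ('l perm \<Rightarrow>\<^sub>0 'l) \<Rightarrow> _" by (rule vs_lift)
  let ?B = "(\<lambda>(\<eta>, i). T (d i) \<eta>) ` (N \<times> {..<m})"
  have "h \<in> span ?B" if "h \<in> C" for h
  proof -
    have "h = (\<Sum>x\<in>N \<times> {..<m}. lift_scale ((case x of (\<eta>, i) \<Rightarrow> \<lambda>h. trK (c i * (c0 * lookup h \<eta>))) h)
      ((\<lambda>(\<eta>, i). T (d i) \<eta>) x))"
      using dual_frame_C that unfolding dual_frame_def by simp
    also have "\<dots> \<in> span ?B" by (intro span_sum span_scale span_base) auto
    finally show ?thesis .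
  qed
  moreover have "span ?B \<subseteq> C"
    by (rule span_minimal[OF _ subspace_C]) (auto simp: T_C)
  ultimately have "span ?B = C" by blast
  moreover have "finite ?B" using finite_N by simp
  ultimately show ?thesis unfolding finite_dim_def scale_H by blast
qed


subsection \<open>The action on \<open>L\<close>\<close>

lemma gp_act_eq:
  assumes "keys s \<subseteq> N"
  shows "gp_act s x = (\<Sum>\<eta>\<in>N. lookup s \<eta> * \<sigma> \<eta> x)"
  unfolding gp_act_def \<sigma>_def using assms finite_N
  by (intro sum.mono_neutral_left) (auto simp: in_keys_iff)

lemma gp_act_C: "s \<in> C \<Longrightarrow> gp_act s x = (\<Sum>\<eta>\<in>N. lookup s \<eta> * \<sigma> \<eta> x)"
  by (rule gp_act_eq[OF CD(1)])

lemma Dedekind_N: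
  assumes "\<And>x. (\<Sum>\<eta>\<in>N. s \<eta> * \<sigma> \<eta> x) = 0" "\<theta> \<in> N"
  shows "s \<theta> = 0"
proof -
  define r where "r = inv_into N \<sigma>"
  have r: "r (\<sigma> \<eta>) = \<eta>" if "\<eta> \<in> N" for \<eta>
    using bij_\<sigma> that unfolding r_def bij_betw_def by simp
  have "(\<Sum>\<gamma>\<in>Gal emb. s (r \<gamma>) * \<gamma> x) = 0" for x
    using assms(1)[of x] sum.reindex_bij_betw[OF bij_\<sigma>, of "\<lambda>\<gamma>. s (r \<gamma>) * \<gamma> x"] r by simp
  from Dedekind_independence[OF this \<sigma>_Gal[OF assms(2)]] show ?thesis
    using r assms(2) by simp
qed

text \<open>When \<open>\<sigma> \<eta>\<close> moves past the coefficients of \<open>t\<close>,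
  equivariance replaces \<open>\<theta>\<close> by \<open>ac (\<sigma> \<eta>) \<theta>\<close>; by
  \<open>\<sigma>_comp\<close> the automorphism carries the same twist. Renaming the conjugate
  leaves the plain convolution.\<close>

lemma gp_act_mult:
  assumes "s \<in> C" "t \<in> C"
  shows "gp_act (s \<otimes>\<^bsub>H\<^esub> t) x = gp_act s (gp_act t x)"
proof -
  let ?s = "lookup s" and ?t = "lookup t"
  have "gp_act s (gp_act t x) = (\<Sum>\<eta>\<in>N. ?s \<eta> * (\<Sum>\<theta>\<in>N. ?t (ac (\<sigma> \<eta>) \<theta>) * \<sigma> (\<eta> \<circ> ac (\<sigma> \<eta>) \<theta>) x))"
    using assms by (simp add: gp_act_C)
      (intro sum.cong refl, simp add: Gal_sum[OF \<sigma>_Gal] GalD(2)[OF \<sigma>_Gal] \<sigma>_Gal CD(2) \<sigma>_comp)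
  also have "\<dots> = (\<Sum>\<eta>\<in>N. ?s \<eta> * (\<Sum>\<theta>\<in>N. ?t \<theta> * \<sigma> (\<eta> \<circ> \<theta>) x))"
  proof (rule sum.cong[OF refl])
    fix \<eta> assume "\<eta> \<in> N"
    then show "?s \<eta> * (\<Sum>\<theta>\<in>N. ?t (ac (\<sigma> \<eta>) \<theta>) * \<sigma> (\<eta> \<circ> ac (\<sigma> \<eta>) \<theta>) x) =
      ?s \<eta> * (\<Sum>\<theta>\<in>N. ?t \<theta> * \<sigma> (\<eta> \<circ> \<theta>) x)"
      using sum.reindex_bij_betw[OF bij_ac[OF \<sigma>_Gal], of \<eta> "\<lambda>\<theta>. ?t \<theta> * \<sigma> (\<eta> \<circ> \<theta>) x"] by simp
  qed
  also have "\<dots> = (\<Sum>\<theta>\<in>N. \<Sum>\<eta>\<in>N. ?s \<eta> * ?t \<theta> * \<sigma> (\<eta> \<circ> \<theta>) x)"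
    unfolding sum_distrib_left by (subst sum.swap) (simp add: mult.assoc)
  also have "\<dots> = (\<Sum>\<theta>\<in>N. \<Sum>\<kappa>\<in>N. ?s (\<kappa> \<circ> inv_into UNIV \<theta>) * ?t \<theta> * \<sigma> \<kappa> x)"
  proof (rule sum.cong[OF refl])
    fix \<theta> assume \<theta>: "\<theta> \<in> N"
    have "(\<Sum>\<eta>\<in>N. (\<lambda>\<kappa>. ?s (\<kappa> \<circ> inv_into UNIV \<theta>) * ?t \<theta> * \<sigma> \<kappa> x) (\<eta> \<circ> \<theta>)) =
      (\<Sum>\<kappa>\<in>N. ?s (\<kappa> \<circ> inv_into UNIV \<theta>) * ?t \<theta> * \<sigma> \<kappa> x)"
      by (rule sum.reindex_bij_betw[OF bij_comp_right[OF \<theta>]])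
    then show "(\<Sum>\<eta>\<in>N. ?s \<eta> * ?t \<theta> * \<sigma> (\<eta> \<circ> \<theta>) x) = (\<Sum>\<kappa>\<in>N. ?s (\<kappa> \<circ> inv_into UNIV \<theta>) * ?t \<theta> * \<sigma> \<kappa> x)"
      by (simp add: comp_assoc inv_N[OF \<theta>])
  qed
  also have "\<dots> = gp_act (s \<otimes>\<^bsub>H\<^esub> t) x"
    using assms by (subst sum.swap) (simp add: gp_act_C mult_H_closed lookup_mult_H sum_distrib_right)
  finally show ?thesis by simp
qed

lemma gp_act_prod:
  assumes h: "h \<in> C"
  shows "gp_act h (x * y) = tensor_eval (ext_scale emb) (\<lambda>a b. gp_act a x * gp_act b y) (comult H h)"
proof -
  have "lin_ext (ext_scale emb) (\<lambda>(a, b). gp_act a x * gp_act b y) (D h) =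
    (\<Sum>i\<in>N \<times> N. (\<sigma> (fst i) x * \<sigma> (snd i) y) * (if fst i = snd i then lookup h (fst i) else 0))"
    by (rule lin_ext_D[OF h])
      (auto simp: gp_act_C sum_product sum.cartesian_product case_prod_unfold mult_ac)
  also have "\<dots> = (\<Sum>\<eta>\<in>N. \<Sum>\<theta>\<in>N. if \<eta> = \<theta> then lookup h \<eta> * (\<sigma> \<eta> x * \<sigma> \<eta> y) else 0)"
    unfolding sum.cartesian_product by (rule sum.cong) auto
  also have "\<dots> = gp_act h (x * y)"
    using finite_N by (simp add: gp_act_C[OF h] GalD(2)[OF \<sigma>_Gal])
  finally show ?thesis by (simp add: tensor_eval_comult)
qed

lemma module_algebra_H: "module_algebra emb H gp_act"
  unfolding module_algebra_def
proof (intro conjI ballI allI)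
  fix h x y assume h: "h \<in> C"
  show "gp_act h (x + y) = gp_act h x + gp_act h y"
    by (simp add: gp_act_C[OF h] GalD(1)[OF \<sigma>_Gal] distrib_left sum.distrib)
  show "gp_act (h + k) x = gp_act h x + gp_act k x" if "k \<in> C" for k
    using h that add_C by (simp add: gp_act_C lookup_add distrib_right sum.distrib)
  show "gp_act (scale H k h) x = emb k * gp_act h x" for k
    using h scale_C[OF h] by (simp add: scale_H gp_act_C sum_distrib_left mult.assoc)
  show "gp_act h (emb k * x) = emb k * gp_act h x" for k
    by (simp add: gp_act_C[OF h] GalD(2,3)[OF \<sigma>_Gal] sum_distrib_left mult.left_commute)
  show "gp_act h 1 = emb (counit H h)"
    by (simp add: gp_act_C[OF h] emb_counit_H[OF h] Gal_1[OF \<sigma>_Gal])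
next
  fix x show "gp_act \<one>\<^bsub>H\<^esub> x = x"
    by (simp add: gp_act_def one_H inv_id)
qed (rule gp_act_mult gp_act_prod; assumption)+

subsection \<open>Bijectivity of \<open>L \<otimes> H \<rightarrow> End(L)\<close>\<close>

abbreviation "R' \<equiv> tensor_rel (ext_scale emb) UNIV lift_scale C"

text \<open>The coefficient at \<open>\<eta>\<close> of the image of \<open>f\<close> under the
  canonical map from \<open>L \<otimes> H\<close> to \<open>L[N]\<close>.\<close>

definition evm where
  "evm f \<eta> = lin_ext (ext_scale emb) (\<lambda>(x, h). x * lookup h \<eta>) f"

lemma evm_diff: "evm (f - g) \<eta> = evm f \<eta> - evm g \<eta>"
  by (simp add: evm_def lin_ext_diff[OF vs_ext])

lemma subspace_UNIV_ext: "module.subspace (ext_scale emb) UNIV"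
proof -
  interpret vector_space "ext_scale emb" by (rule vs_ext)
  show ?thesis by (rule subspace_UNIV)
qed

text \<open>The two traces in a product functional open over independent automorphisms \<gamma> and
  \<delta>. Equivariance collects \<open>x\<close> and the value of \<open>h\<close> under the
  single \<gamma>, so the functional depends only on the values \<open>evm f\<close>; hence
  \<open>L \<otimes> H\<close> embeds into \<open>L[N]\<close>.\<close>

lemma tensor_rel_LC_iff:
  "f \<in> R' \<longleftrightarrow> keys f \<subseteq> UNIV \<times> C \<and> (\<forall>\<eta>\<in>N. evm f \<eta> = 0)"
proof
  assume f: "f \<in> R'"
  have "evm f \<eta> = 0" for \<eta>
    unfolding evm_def
    by (rule lin_ext_tensor_rel[OF vs_ext _ f])
      (simp add: bilinear_map_on_def linear_map_on_def lookup_add ext_scale_def algebra_simps)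
  with keys_tensor_rel[OF vs_ext subspace_UNIV_ext vs_lift subspace_C f]
  show "keys f \<subseteq> UNIV \<times> C \<and> (\<forall>\<eta>\<in>N. evm f \<eta> = 0)" by blast
next
  assume *: "keys f \<subseteq> UNIV \<times> C \<and> (\<forall>\<eta>\<in>N. evm f \<eta> = 0)"
  show "f \<in> R'"
    unfolding tensor_rel_iff[OF vs_ext subspace_UNIV_ext vs_lift subspace_C dual_frame_ext dual_frame_C]
  proof (intro conjI ballI)
    fix i j assume "i \<in> {..<m}" "j \<in> N \<times> {..<m}"
    moreover obtain \<theta> j' where j: "j = (\<theta>, j')" by force
    ultimately have N: "\<theta> \<in> N" by auto
    have "emb (lin_ext (*) (\<lambda>(x, h). trK (c i * x) * trK (c j' * (c0 * lookup h \<theta>))) f) =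
      lin_ext (ext_scale emb) (\<lambda>(x, h). emb (trK (c i * x)) * emb (trK (c j' * (c0 * lookup h \<theta>)))) f"
      by (simp only: lin_ext_hom_UNIV[OF vector_space_times vs_ext linear_emb] case_prod_unfold emb_simps)
    also have "\<dots> = lin_ext (ext_scale emb) (\<lambda>(x, h). \<Sum>\<gamma>\<in>Gal emb. \<Sum>\<delta>\<in>Gal emb.
        \<gamma> (c i) * \<delta> (c j' * c0) * \<gamma> (x * lookup h (ac (inv_into UNIV \<gamma> \<circ> \<delta>) \<theta>))) f"
    proof (rule lin_ext_cong2)
      show "keys f \<subseteq> UNIV \<times> C" using * by blast
      fix x h assume h: "h \<in> C"
      have "emb (trK (c i * x)) * emb (trK (c j' * (c0 * lookup h \<theta>))) =
        (\<Sum>\<gamma>\<in>Gal emb. \<Sum>\<delta>\<in>Gal emb. \<gamma> (c i * x) * (\<delta> (c j' * c0) * lookup h (ac \<delta> \<theta>)))"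
        by (simp only: trK_functional[OF h N]) (simp only: emb_trK tr_def sum_product)
      also have "\<dots> = (\<Sum>\<gamma>\<in>Gal emb. \<Sum>\<delta>\<in>Gal emb.
        \<gamma> (c i) * \<delta> (c j' * c0) * \<gamma> (x * lookup h (ac (inv_into UNIV \<gamma> \<circ> \<delta>) \<theta>)))"
      proof (intro sum.cong refl)
        fix \<gamma> \<delta> assume g: "\<gamma> \<in> Gal emb" "\<delta> \<in> Gal emb"
        have "lookup h (ac \<delta> \<theta>) = \<gamma> (lookup h (ac (inv_into UNIV \<gamma> \<circ> \<delta>) \<theta>))"
          using CD(2)[OF h g(1), of "ac (inv_into UNIV \<gamma> \<circ> \<delta>) \<theta>"] g N
          by (simp add: ac_ac comp_Gal inv_Gal o_assoc)
        then show "\<gamma> (c i * x) * (\<delta> (c j' * c0) * lookup h (ac \<delta> \<theta>)) =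
          \<gamma> (c i) * \<delta> (c j' * c0) * \<gamma> (x * lookup h (ac (inv_into UNIV \<gamma> \<circ> \<delta>) \<theta>))"
          by (simp add: GalD(2)[OF g(1)])
      qed
      finally show "emb (trK (c i * x)) * emb (trK (c j' * (c0 * lookup h \<theta>))) =
        (\<Sum>\<gamma>\<in>Gal emb. \<Sum>\<delta>\<in>Gal emb.
        \<gamma> (c i) * \<delta> (c j' * c0) * \<gamma> (x * lookup h (ac (inv_into UNIV \<gamma> \<circ> \<delta>) \<theta>)))" .
    qed
    also have "\<dots> = (\<Sum>\<gamma>\<in>Gal emb. \<Sum>\<delta>\<in>Gal emb.
        \<gamma> (c i) * \<delta> (c j' * c0) * \<gamma> (evm f (ac (inv_into UNIV \<gamma> \<circ> \<delta>) \<theta>)))"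
      unfolding lin_ext_sum_right2[OF vs_ext] lin_ext_mult2 evm_def
      by (intro sum.cong refl) (simp add: lin_ext_hom_UNIV[OF vs_ext vs_ext linear_Gal] case_prod_unfold)
    also have "\<dots> = emb 0"
      using * N by (simp add: comp_Gal inv_Gal Gal_0 emb_0)
    finally show "lin_ext (*) (\<lambda>(u, v). trK (c i * u) *
      (case j of (\<eta>, i) \<Rightarrow> \<lambda>h. trK (c i * (c0 * lookup h \<eta>))) v) f = 0"
      by (simp add: j)
  qed (use * in blast)
qed

lemma hopf_galois_map:
  assumes "keys f \<subseteq> UNIV \<times> C"
  shows "tensor_eval (ext_scale emb) (\<lambda>x h. x * gp_act h y) (coset R' f) = (\<Sum>\<eta>\<in>N. evm f \<eta> * \<sigma> \<eta> y)"
proof -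
  have "bilinear_map_on (ext_scale emb) UNIV lift_scale C (ext_scale emb) (\<lambda>x h. x * gp_act h y)"
    using module_algebra_H unfolding module_algebra_def scale_H
    by (simp add: bilinear_map_on_def linear_map_on_def ext_scale_def algebra_simps)
  then have "tensor_eval (ext_scale emb) (\<lambda>x h. x * gp_act h y) (coset R' f) =
    lin_ext (ext_scale emb) (\<lambda>(x, h). x * gp_act h y) f"
    by (rule tensor_eval_coset[OF vs_ext])
  also have "\<dots> = lin_ext (ext_scale emb) (\<lambda>(x, h). \<Sum>\<eta>\<in>N. \<sigma> \<eta> y * (x * lookup h \<eta>)) f"
    by (rule lin_ext_cong2[OF assms]) (simp add: gp_act_C sum_distrib_left mult_ac)
  finally show ?thesis
    by (simp only: lin_ext_sum_right2[OF vs_ext] lin_ext_mult2 evm_def mult.commute)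
qed

text \<open>Apply \<open>\<phi>\<close> to the trace expansion of \<open>y\<close>: the traces lie
  in \<open>K\<close> and come out of \<open>\<phi>\<close>, and opening them exhibits
  \<open>\<phi>\<close> as an \<open>L\<close>-combination of automorphisms.\<close>

lemma Galois_map_surj:
  assumes "Vector_Spaces.linear (ext_scale emb) (ext_scale emb) \<phi>"
  shows "\<phi> y = (\<Sum>\<gamma>\<in>Gal emb. (\<Sum>i<m. \<phi> (d i) * \<gamma> (c i)) * \<gamma> y)"
proof -
  interpret Vector_Spaces.linear "ext_scale emb" "ext_scale emb" \<phi> by fact
  have "\<phi> y = \<phi> (\<Sum>i<m. ext_scale emb (trK (c i * y)) (d i))"
    using trace_expansion[of y] by (simp add: ext_scale_def mult.commute)
  also have "\<dots> = (\<Sum>i<m. \<phi> (d i) * tr (c i * y))"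
    by (simp only: sum scale) (simp add: ext_scale_def mult.commute)
  also have "\<dots> = (\<Sum>i<m. \<Sum>\<gamma>\<in>Gal emb. \<phi> (d i) * \<gamma> (c i) * \<gamma> y)"
    by (simp add: tr_def sum_distrib_left GalD mult.assoc)
  also have "\<dots> = (\<Sum>\<gamma>\<in>Gal emb. \<Sum>i<m. \<phi> (d i) * \<gamma> (c i) * \<gamma> y)"
    by (rule sum.swap)
  finally show ?thesis by (simp add: sum_distrib_right)
qed

text \<open>The map factors through \<open>L[N]\<close>. Injectivity combines
  \<open>tensor_rel_LC_iff\<close> with Dedekind independence; surjectivity combines
  \<open>Galois_map_surj\<close> with \<open>sum_T\<close>.\<close>

lemma hopf_galois_H: "hopf_galois emb H gp_act"
  unfolding hopf_galois_def
proof (intro conjI emb hopf_algebra_H cocommutative_H finite_dim_H module_algebra_H)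
  show "finite_dim (ext_scale emb) UNIV"
    using galois by (simp add: galois_extension_def)
  show "bij_betw (\<lambda>t y. tensor_eval (ext_scale emb) (\<lambda>x h. x * gp_act h y) t)
      (tensor (ext_scale emb) UNIV (scale H) C) {\<phi>. Vector_Spaces.linear (ext_scale emb) (ext_scale emb) \<phi>}"
    unfolding scale_H
  proof (rule bij_betwI')
    fix t t' assume "t \<in> tensor (ext_scale emb) UNIV lift_scale C" "t' \<in> tensor (ext_scale emb) UNIV lift_scale C"
    then obtain f f' where t: "t = coset R' f" "keys f \<subseteq> UNIV \<times> C"
      and t': "t' = coset R' f'" "keys f' \<subseteq> UNIV \<times> C"
      unfolding tensor_def by blast
    show "((\<lambda>y. tensor_eval (ext_scale emb) (\<lambda>x h. x * gp_act h y) t) =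
      (\<lambda>y. tensor_eval (ext_scale emb) (\<lambda>x h. x * gp_act h y) t')) = (t = t')"
    proof
      assume "(\<lambda>y. tensor_eval (ext_scale emb) (\<lambda>x h. x * gp_act h y) t) =
        (\<lambda>y. tensor_eval (ext_scale emb) (\<lambda>x h. x * gp_act h y) t')"
      then have "(\<Sum>\<eta>\<in>N. evm f \<eta> * \<sigma> \<eta> y) = (\<Sum>\<eta>\<in>N. evm f' \<eta> * \<sigma> \<eta> y)" for y
        unfolding t(1) t'(1) hopf_galois_map[OF t(2)] hopf_galois_map[OF t'(2)] by meson
      then have "(\<Sum>\<eta>\<in>N. evm (f - f') \<eta> * \<sigma> \<eta> y) = 0" for y
        by (simp add: evm_diff left_diff_distrib sum_subtractf)
      then have "evm (f - f') \<eta> = 0" if "\<eta> \<in> N" for \<eta>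
        using Dedekind_N that by blast
      moreover have "keys (f - f') \<subseteq> UNIV \<times> C"
        using free.subspace_diff[OF subspace_keys[of "UNIV \<times> C"], of f f'] t(2) t'(2) by simp
      ultimately show "t = t'"
        unfolding t(1) t'(1) coset_eq_iff[OF subspace_tensor_rel] tensor_rel_LC_iff by blast
    qed simp
  next
    fix t assume "t \<in> tensor (ext_scale emb) UNIV lift_scale C"
    then obtain f where t: "t = coset R' f" "keys f \<subseteq> UNIV \<times> C"
      unfolding tensor_def by blast
    have "module_hom (ext_scale emb) (ext_scale emb) (\<lambda>y. \<Sum>\<eta>\<in>N. evm f \<eta> * \<sigma> \<eta> y)"
      using vs_ext unfolding module_hom_iff module_iff_vector_space
      by (auto simp: GalD[OF \<sigma>_Gal] ext_scale_def distrib_left sum.distrib sum_distrib_left mult_ac)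
    then show "(\<lambda>y. tensor_eval (ext_scale emb) (\<lambda>x h. x * gp_act h y) t) \<in>
      {\<phi>. Vector_Spaces.linear (ext_scale emb) (ext_scale emb) \<phi>}"
      unfolding t(1) hopf_galois_map[OF t(2)] module_hom_iff_linear by simp
  next
    fix \<phi> assume "\<phi> \<in> {\<phi>. Vector_Spaces.linear (ext_scale emb) (ext_scale emb) \<phi>}"
    then have \<phi>: "\<phi> y = (\<Sum>\<gamma>\<in>Gal emb. (\<Sum>i<m. \<phi> (d i) * \<gamma> (c i)) * \<gamma> y)" for y
      using Galois_map_surj by blast
    define s where "s \<eta> = (\<Sum>i<m. \<phi> (d i) * \<sigma> \<eta> (c i))" for \<eta>
    \<comment> \<open>By \<open>sum_T\<close>, \<open>\<eta>\<close> is the image of the sum of the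
      tensors \<open>d i \<otimes> T (c i) \<eta>\<close>. So \<open>f\<close> lifts the element of
      \<open>L[N]\<close> with coefficients \<open>s\<close>.\<close>
    define f :: "'l \<times> _ \<Rightarrow>\<^sub>0 'k" where "f = (\<Sum>\<eta>\<in>N. \<Sum>i<m. single (s \<eta> * d i, T (c i) \<eta>) 1)"
    have "f \<in> {f. keys f \<subseteq> UNIV \<times> C}"
      unfolding f_def by (intro free.subspace_sum[OF subspace_keys]) (auto simp: T_C)
    then have f: "keys f \<subseteq> UNIV \<times> C" by simp
    have "evm f \<theta> = s \<theta>" if "\<theta> \<in> N" for \<theta>
    proof -
      have "evm f \<theta> = (\<Sum>\<eta>\<in>N. s \<eta> * (\<Sum>i<m. d i * lookup (T (c i) \<eta>) \<theta>))"
        unfolding evm_def f_def lin_ext_sum[OF vs_ext] lin_ext_single[OF vs_ext]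
        by (simp add: ext_scale_def emb_simps sum_distrib_left mult.assoc)
      then show ?thesis using finite_N that by (simp add: sum_T if_distrib cong: if_cong)
    qed
    then have "(\<Sum>\<eta>\<in>N. evm f \<eta> * \<sigma> \<eta> y) = \<phi> y" for y
      using \<phi>[of y] sum.reindex_bij_betw[OF bij_\<sigma>, of "\<lambda>\<gamma>. (\<Sum>i<m. \<phi> (d i) * \<gamma> (c i)) * \<gamma> y"]
      by (simp add: s_def)
    then have "\<phi> = (\<lambda>y. tensor_eval (ext_scale emb) (\<lambda>x h. x * gp_act h y) (coset R' f))"
      unfolding hopf_galois_map[OF f] by presburger
    moreover have "coset R' f \<in> tensor (ext_scale emb) UNIV lift_scale C"
      unfolding tensor_def using f by blast
    ultimately show "\<exists>t\<in>tensor (ext_scale emb) UNIV lift_scale C.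
      \<phi> = (\<lambda>y. tensor_eval (ext_scale emb) (\<lambda>x h. x * gp_act h y) t)" by blast
  qed
qed


section \<open>Sub-Hopf algebras and their fixed fields\<close>

definition stable_subgroup :: "'l perm set \<Rightarrow> bool" where
  "stable_subgroup M \<longleftrightarrow> M \<subseteq> N \<and> id \<in> M \<and> (\<forall>\<eta>\<in>M. \<forall>\<theta>\<in>M. \<eta> \<circ> \<theta> \<in> M) \<and>
    (\<forall>\<eta>\<in>M. inv_into UNIV \<eta> \<in> M) \<and> (\<forall>\<gamma>\<in>Gal emb. \<forall>\<eta>\<in>M. ac \<gamma> \<eta> \<in> M)"

definition sub_of :: "'l perm set \<Rightarrow> ('l perm \<Rightarrow>\<^sub>0 'l) set" where
  "sub_of M = {h \<in> C. keys h \<subseteq> M}"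

lemma T_sub_of:
  assumes "stable_subgroup M" "\<eta> \<in> M"
  shows "T x \<eta> \<in> sub_of M"
  using assms keys_T[of \<eta> M x] T_C[of \<eta> x] by (auto simp: stable_subgroup_def sub_of_def)

lemma subspace_sub_of: "module.subspace lift_scale (sub_of M)"
proof -
  interpret vector_space "lift_scale :: 'k \<Rightarrow> ('l perm \<Rightarrow>\<^sub>0 'l) \<Rightarrow> _" by (rule vs_lift)
  have "sub_of M = C \<inter> {f. keys f \<subseteq> M}" by (auto simp: sub_of_def)
  then show ?thesis
    by (simp only: subspace_inter[OF subspace_C subspace_lift[OF subspace_keys]])
qed

lemma keys_subsetI: "(\<And>\<eta>. \<eta> \<notin> M \<Longrightarrow> lookup h \<eta> = 0) \<Longrightarrow> keys h \<subseteq> M"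
  by (metis in_keys_iff subsetI)

lemma sub_hopf_algebra_sub_of:
  assumes M: "stable_subgroup M"
  shows "sub_hopf_algebra H (sub_of M)"
  unfolding sub_hopf_algebra_def
proof (intro conjI ballI)
  show "sub_of M \<subseteq> C" by (auto simp: sub_of_def)
  show "module.subspace (scale H) (sub_of M)" unfolding scale_H by (rule subspace_sub_of)
  show "\<one>\<^bsub>H\<^esub> \<in> sub_of M"
    using one_C M by (auto simp: sub_of_def one_H stable_subgroup_def)
next
  fix x y assume xy: "x \<in> sub_of M" "y \<in> sub_of M"
  then have C: "x \<in> C" "y \<in> C" by (auto simp: sub_of_def)
  have "x \<otimes>\<^bsub>H\<^esub> y \<in> {f. keys f \<subseteq> M}"
    unfolding mult_H[OF C]
  proof (intro free.subspace_sum[OF subspace_keys])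
    fix \<eta> \<theta>
    show "single (\<eta> \<circ> \<theta>) (lookup x \<eta> * lookup y \<theta>) \<in> {f. keys f \<subseteq> M}"
    proof (cases "lookup x \<eta> = 0 \<or> lookup y \<theta> = 0")
      case False
      then have "\<eta> \<in> M" "\<theta> \<in> M" using xy by (auto simp: sub_of_def in_keys_iff subset_iff)
      then show ?thesis using M by (auto simp: stable_subgroup_def)
    qed auto
  qed
  then show "x \<otimes>\<^bsub>H\<^esub> y \<in> sub_of M" using C mult_H_closed by (simp add: sub_of_def)
next
  fix x assume x: "x \<in> sub_of M"
  then have C: "x \<in> C" and keys: "keys x \<subseteq> M" by (auto simp: sub_of_def)
  \<comment> \<open>The representative \<open>D x\<close> is only known to have entries in
    \<open>C\<close>, so the explicit formal sum is taken instead.\<close>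
  obtain f where f: "keys f \<subseteq> (\<lambda>(x, \<eta>). T x \<eta>) ` (UNIV \<times> keys x) \<times> (\<lambda>(x, \<eta>). T x \<eta>) ` (UNIV \<times> keys x)"
    "\<And>\<eta> \<theta>. \<eta> \<in> N \<Longrightarrow> \<theta> \<in> N \<Longrightarrow> ev2 f \<eta> \<theta> = (if \<eta> = \<theta> then lookup x \<eta> else 0)"
    using diagonal_tensor[OF C] by blast
  have "(\<lambda>(x, \<eta>). T x \<eta>) ` (UNIV \<times> keys x) \<subseteq> sub_of M"
    using T_sub_of[OF M] keys by auto
  with f(1) have keys_f: "keys f \<subseteq> sub_of M \<times> sub_of M" by blast
  then have "keys f \<subseteq> C \<times> C" by (auto simp: sub_of_def)
  from comult_H[OF C this f(2)] keys_f
  show "\<exists>f. keys f \<subseteq> sub_of M \<times> sub_of M \<and> comult H x = tclass H f" by blast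
  have "keys (antipode H x) \<subseteq> M"
  proof (rule keys_subsetI)
    fix \<eta> assume \<eta>: "\<eta> \<notin> M"
    show "lookup (antipode H x) \<eta> = 0"
    proof (cases "\<eta> \<in> N")
      case True
      have "inv_into UNIV \<eta> \<notin> M"
        using \<eta> M inv_inv_N[OF True] by (metis stable_subgroup_def)
      then show ?thesis
        using lookup_antipode_H[OF C True] keys by (metis in_keys_iff subset_iff)
    next
      case False
      then show ?thesis using CD(1)[OF antipode_H_closed[OF C]] by (metis in_keys_iff subset_iff)
    qed
  qed
  then show "antipode H x \<in> sub_of M" using antipode_H_closed[OF C] by (simp add: sub_of_def)
qed

text \<open>By \<open>sum_T\<close>, the coefficients of the \<open>T (c i) \<eta>\<close> at
  \<open>\<eta>\<close> combine to 1, so they do not all vanish. Hence \<open>M\<close> can be read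
  off \<open>sub_of M\<close> as the union of supports.\<close>

lemma support_sub_of:
  assumes M: "stable_subgroup M" and \<eta>: "\<eta> \<in> M"
  obtains h where "h \<in> sub_of M" "lookup h \<eta> \<noteq> 0"
proof -
  have "(\<Sum>i<m. d i * lookup (T (c i) \<eta>) \<eta>) \<noteq> 0"
    using sum_T[of \<eta> \<eta>] by simp
  then obtain i where "lookup (T (c i) \<eta>) \<eta> \<noteq> 0"
    by (metis (no_types, lifting) mult_zero_right sum.neutral)
  with T_sub_of[OF M \<eta>] show ?thesis by (rule that)
qed

lemma sub_of_subset_iff:
  assumes "stable_subgroup M"
  shows "sub_of M \<subseteq> sub_of M' \<longleftrightarrow> M \<subseteq> M'"
proof
  assume *: "sub_of M \<subseteq> sub_of M'"
  show "M \<subseteq> M'"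
  proof
    fix \<eta> assume "\<eta> \<in> M"
    then obtain h where "h \<in> sub_of M" "lookup h \<eta> \<noteq> 0"
      using support_sub_of[OF assms] by blast
    with * show "\<eta> \<in> M'" by (auto simp: sub_of_def in_keys_iff subset_iff)
  qed
qed (auto simp: sub_of_def)

lemma sub_of_N: "sub_of N = C"
  using CD(1) by (auto simp: sub_of_def)

text \<open>Conjugation fixes the identity permutation, so the coefficient there is Galois invariant
  and lies in \<open>K\<close>.\<close>

lemma sub_of_id: "sub_of {id} = {scale H k \<one>\<^bsub>H\<^esub> | k. True}"
proof (intro equalityI subsetI)
  fix h assume "h \<in> sub_of {id}"
  then have h: "h \<in> C" "keys h \<subseteq> {id}" by (auto simp: sub_of_def)
  have "lookup h id \<in> range emb"
    using CD(2)[OF h(1) _ id_N] by (intro in_range_emb) (metis ac_id_perm)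
  then obtain k where "lookup h id = emb k" by (metis rangeE)
  then have "h = scale H k \<one>\<^bsub>H\<^esub>"
    using sum_single_lookup[OF _ h(2)] by (simp add: scale_H one_H)
  then show "h \<in> {scale H k \<one>\<^bsub>H\<^esub> | k. True}" by blast
qed (use single_id_C in \<open>auto simp: sub_of_def scale_H one_H split: if_splits\<close>)

text \<open>
  Descent along the trace: an invariant \<open>L\<close>-combination \<open>\<Sum> r\<^sub>a a\<close> of elements \<open>a\<close> of a \<open>K\<close>-subspace of \<open>H\<close>
  equals \<open>\<Sum> tr(c\<^sub>0 r\<^sub>a) a\<close>.
\<close>

lemma span_descent:
  assumes J: "module.subspace lift_scale J" "J \<subseteq> C" and h: "h \<in> C" "h \<in> free.span J"
  shows "h \<in> J"
proof -
  interpret vector_space "lift_scale :: 'k \<Rightarrow> ('l perm \<Rightarrow>\<^sub>0 'l) \<Rightarrow> _" by (rule vs_lift)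
  obtain t r where t: "finite t" "t \<subseteq> J" and h_eq: "h = (\<Sum>a\<in>t. free_scale (r a) a)"
    using h(2) unfolding free.span_explicit by blast
  have mem: "(\<Sum>a\<in>t. free_scale (emb (trK (c0 * r a))) a) \<in> J"
    using t(2) by (intro subspace_sum[OF J(1)] subspace_scale[OF J(1)]) auto
  moreover have "(\<Sum>a\<in>t. free_scale (emb (trK (c0 * r a))) a) = h"
  proof (rule C_eqI)
    fix \<eta> assume \<eta>: "\<eta> \<in> N"
    have "lookup (\<Sum>a\<in>t. free_scale (emb (trK (c0 * r a))) a) \<eta> =
      (\<Sum>a\<in>t. \<Sum>\<gamma>\<in>Gal emb. \<gamma> (c0 * r a) * lookup a \<eta>)"
      by (simp add: lookup_sum tr_def sum_distrib_right)
    also have "\<dots> = (\<Sum>\<gamma>\<in>Gal emb. \<Sum>a\<in>t. \<gamma> (c0 * r a) * lookup a \<eta>)"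
      by (rule sum.swap)
    also have "\<dots> = (\<Sum>\<gamma>\<in>Gal emb. \<gamma> c0 * lookup h \<eta>)"
    proof (rule sum.cong[OF refl])
      fix \<gamma> assume \<gamma>: "\<gamma> \<in> Gal emb"
      let ?\<theta> = "ac (inv_into UNIV \<gamma>) \<eta>"
      have \<theta>: "?\<theta> \<in> N" "ac \<gamma> ?\<theta> = \<eta>" using \<gamma> \<eta> by (auto simp: inv_Gal ac_inverse)
      have "\<gamma> (c0 * r a) * lookup a \<eta> = \<gamma> c0 * \<gamma> (r a * lookup a ?\<theta>)" if "a \<in> t" for a
        using CD(2)[of a \<gamma> ?\<theta>] that t(2) J(2) \<gamma> \<theta> by (auto simp: GalD(2)[OF \<gamma>])
      then have "(\<Sum>a\<in>t. \<gamma> (c0 * r a) * lookup a \<eta>) = \<gamma> c0 * \<gamma> (lookup h ?\<theta>)"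
        unfolding h_eq by (simp add: lookup_sum Gal_sum[OF \<gamma>] sum_distrib_left)
      then show "(\<Sum>a\<in>t. \<gamma> (c0 * r a) * lookup a \<eta>) = \<gamma> c0 * lookup h \<eta>"
        using CD(2)[OF h(1) \<gamma> \<theta>(1)] \<theta>(2) by simp
    qed
    also have "\<dots> = lookup h \<eta>"
      using trace_one by (simp add: tr_def flip: sum_distrib_right)
    finally show "lookup (\<Sum>a\<in>t. free_scale (emb (trK (c0 * r a))) a) \<eta> = lookup h \<eta>" .
  qed (use mem J(2) h(1) in auto)
  ultimately show ?thesis by simp
qed

text \<open>The product of \<open>L[N]\<close>, bilinear over \<open>L\<close>. It is needed because
  the \<open>L\<close>-span of a sub-Hopf algebra leaves \<open>C\<close>, to which
  \<open>mult_H\<close> is confined.\<close>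

definition conv :: "('l perm \<Rightarrow>\<^sub>0 'l) \<Rightarrow> ('l perm \<Rightarrow>\<^sub>0 'l) \<Rightarrow>
    ('l perm \<Rightarrow>\<^sub>0 'l)" where
  "conv s t = (\<Sum>\<eta>\<in>N. \<Sum>\<theta>\<in>N. single (\<eta> \<circ> \<theta>) (lookup s \<eta> * lookup t \<theta>))"

lemma conv_simps:
  "conv (s + s') t = conv s t + conv s' t" "conv s (t + t') = conv s t + conv s t'"
  "conv (free_scale x s) t = free_scale x (conv s t)" "conv s (free_scale x t) = free_scale x (conv s t)"
  "conv 0 t = 0" "conv s 0 = 0"
  by (simp_all add: conv_def lookup_add distrib_left distrib_right single_add sum.distrib free.scale_sum_right mult_ac)

lemma conv_single:
  assumes "\<eta> \<in> N" "\<theta> \<in> N"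
  shows "conv (single \<eta> 1) (single \<theta> 1) = single (\<eta> \<circ> \<theta>) 1"
proof -
  have "conv (single \<eta> 1) (single \<theta> 1) =
    (\<Sum>\<eta>'\<in>N. \<Sum>\<theta>'\<in>N. if \<theta>' = \<theta> then (if \<eta>' = \<eta> then single (\<eta> \<circ> \<theta>) 1 else 0) else 0)"
    unfolding conv_def by (intro sum.cong refl) (auto simp: lookup_single when_def)
  then show ?thesis using assms finite_N by simp
qed

text \<open>
  If \<open>\<Sum> a \<otimes> b\<close> is the coproduct of \<open>h\<close>, then \<open>\<Sum> b(\<eta>) a\<close> is the single term \<open>h(\<eta>) \<eta>\<close>; hence the
  \<open>L\<close>-span of a sub-Hopf algebra is spanned by the elements of \<open>N\<close> that it contains.
\<close>

lemma sub_hopf_algebra_cases: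
  assumes J: "sub_hopf_algebra H J"
  obtains M where "stable_subgroup M" "J = sub_of M"
proof -
  have JC: "J \<subseteq> C" and sub: "module.subspace lift_scale J" and one: "\<one>\<^bsub>H\<^esub> \<in> J"
    and mult: "\<And>x y. x \<in> J \<Longrightarrow> y \<in> J \<Longrightarrow> x \<otimes>\<^bsub>H\<^esub> y \<in> J"
    and comult: "\<And>x. x \<in> J \<Longrightarrow> \<exists>f. keys f \<subseteq> J \<times> J \<and> comult H x = tclass H f"
    and antipode: "\<And>x. x \<in> J \<Longrightarrow> antipode H x \<in> J"
    using J unfolding sub_hopf_algebra_def scale_H by auto
  let ?W = "free.span J"
  \<comment> \<open>Defined by supports, which makes stability under antipode and \<Gamma> visible.
    By \<open>M_W\<close> and \<open>W_M\<close> these are also the elements of \<open>N\<close> in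
    the span, which gives closure under composition.\<close>
  define M where "M = {\<eta> \<in> N. \<exists>h\<in>J. lookup h \<eta> \<noteq> 0}"
  have single: "single \<eta> (lookup h \<eta>) \<in> ?W" if h: "h \<in> J" and \<eta>: "\<eta> \<in> N" for h \<eta>
  proof -
    obtain f where f: "keys f \<subseteq> J \<times> J" "comult H h = coset R f"
      using comult[OF h] by (auto simp: tclass_H)
    have ev: "ev2 f \<theta> \<eta> = (if \<theta> = \<eta> then lookup h \<theta> else 0)" if "\<theta> \<in> N" for \<theta>
      using ev2_rep_coset[OF that \<eta>, of f] comult_H_tensor(2)[of h, OF _ that \<eta>] h JC
      by (auto simp: D_def f(2))
    let ?s = "lin_ext lift_scale (\<lambda>(a, b). free_scale (lookup b \<eta>) a) f"
    have W: "?s \<in> ?W"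
      using f(1) by (intro lin_ext_in_subspace[OF vs_lift subspace_lift[OF free.subspace_span]])
        (auto intro!: free.span_scale intro: free.span_base)
    have keys_W: "?W \<subseteq> {f. keys f \<subseteq> N}"
      using JC CD(1) by (intro free.span_minimal subspace_keys) auto
    have "single \<eta> (lookup h \<eta>) = ?s"
    proof (rule poly_mapping_N_eqI)
      fix \<theta> assume \<theta>: "\<theta> \<in> N"
      have "lookup ?s \<theta> = ev2 f \<theta> \<eta>"
        unfolding lookup_lin_ext_lift ev2_def by (rule lin_ext_cong) auto
      with ev[OF \<theta>] show "lookup (single \<eta> (lookup h \<eta>)) \<theta> = lookup ?s \<theta>"
        by (simp add: lookup_single when_def)
    qed (use W keys_W \<eta> in auto)
    with W show ?thesis by simp
  qed
  have M_W: "single \<eta> 1 \<in> ?W" if \<eta>: "\<eta> \<in> M" for \<eta>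
  proof -
    obtain h where h: "h \<in> J" "lookup h \<eta> \<noteq> 0" "\<eta> \<in> N" using \<eta> by (auto simp: M_def)
    then show ?thesis
      using free.span_scale[OF single[OF h(1,3)], of "inverse (lookup h \<eta>)"] by simp
  qed
  \<comment> \<open>A zero coefficient at \<open>\<eta>\<close> is an \<open>L\<close>-linear
    condition, so it passes from \<open>J\<close> to its span.\<close>
  have W_M: "\<eta> \<in> M" if \<eta>: "\<eta> \<in> N" "single \<eta> 1 \<in> ?W" for \<eta>
  proof (rule ccontr)
    assume "\<eta> \<notin> M"
    with \<eta>(1) have "J \<subseteq> {s. lookup s \<eta> = 0}" by (auto simp: M_def)
    moreover have "free.subspace {s :: _ \<Rightarrow>\<^sub>0 'l. lookup s \<eta> = 0}"
      by (rule free.subspaceI) (auto simp: lookup_add)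
    ultimately have "?W \<subseteq> {s. lookup s \<eta> = 0}" by (rule free.span_minimal)
    with \<eta>(2) show False by auto
  qed
  \<comment> \<open>Closure of the span under \<open>conv\<close> is obtained by extending one
    factor at a time: first \<open>s\<close> with \<open>t\<close> in \<open>J\<close>, then
    \<open>t\<close>.\<close>
  have conv1: "conv s t \<in> ?W" if t: "t \<in> J" and s: "s \<in> ?W" for s t
  proof -
    have "conv s t \<in> ?W" if "s \<in> J" for s
    proof -
      have "conv s t = s \<otimes>\<^bsub>H\<^esub> t" using mult_H[of s t] that t JC by (simp add: conv_def subset_iff)
      then show ?thesis using mult[OF that t] by (simp add: free.span_base)
    qed
    then have "J \<subseteq> {s. conv s t \<in> ?W}" by blast
    moreover have "free.subspace {s. conv s t \<in> ?W}"
      by (rule free.subspaceI) (auto simp: conv_simps free.span_zero free.span_add free.span_scale)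
    ultimately show ?thesis using s free.span_minimal by blast
  qed
  have conv2: "conv s t \<in> ?W" if s: "s \<in> ?W" and t: "t \<in> ?W" for s t
  proof -
    have "free.subspace {t. conv s t \<in> ?W}"
      by (rule free.subspaceI) (auto simp: conv_simps free.span_zero free.span_add free.span_scale)
    with conv1[OF _ s] show ?thesis using t free.span_minimal[of J "{t. conv s t \<in> ?W}"] by blast
  qed
  have M_N: "M \<subseteq> N" by (auto simp: M_def)
  have "stable_subgroup M"
    unfolding stable_subgroup_def
  proof (intro conjI ballI M_N)
    show "id \<in> M" unfolding M_def using one id_N by (auto simp: one_H intro!: bexI[of _ "single id 1"])
    fix \<eta> assume \<eta>: "\<eta> \<in> M"
    then obtain h where h: "h \<in> J" "lookup h \<eta> \<noteq> 0" "\<eta> \<in> N" by (auto simp: M_def)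
    then have hC: "h \<in> C" using JC by blast
    show "\<eta> \<circ> \<theta> \<in> M" if "\<theta> \<in> M" for \<theta>
      using conv2[OF M_W[OF \<eta>] M_W[OF that]] \<eta> that M_N by (intro W_M) (auto simp: conv_single subset_iff comp_N)
    show "inv_into UNIV \<eta> \<in> M"
      using lookup_antipode_H[OF hC inv_N(1)[OF h(3)]] antipode[OF h(1)] h inv_N(1)[OF h(3)]
      by (auto simp: M_def inv_inv_N intro!: bexI[of _ "antipode H h"])
    fix \<gamma> assume \<gamma>: "\<gamma> \<in> Gal emb"
    have "lookup h (ac \<gamma> \<eta>) \<noteq> 0"
      using CD(2)[OF hC \<gamma> h(3)] h(2) bij_is_inj[OF GalD(4)[OF \<gamma>]] Gal_0[OF \<gamma>] by (metis injD)
    with h \<gamma> show "ac \<gamma> \<eta> \<in> M" by (auto simp: M_def)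
  qed
  moreover have "J = sub_of M"
  proof (intro equalityI subsetI)
    fix h assume "h \<in> J"
    then show "h \<in> sub_of M" using JC CD(1)[of h] by (auto simp: sub_of_def M_def in_keys_iff subset_iff)
  next
    fix h assume "h \<in> sub_of M"
    then have h: "h \<in> C" "keys h \<subseteq> M" by (auto simp: sub_of_def)
    have "h \<in> ?W"
      by (rule formal_sum_in_subspace[OF free.subspace_span]) (use h M_W in auto)
    then show "h \<in> J" by (rule span_descent[OF sub JC h(1)])
  qed
  ultimately show ?thesis by (rule that)
qed

text \<open>The difference \<open>gp_act h x - emb (counit H h) * x\<close> is the sum of the terms
  \<open>lookup h \<eta> * (\<sigma> \<eta> x - x)\<close>. It vanishes termwise on common fixed
  points; conversely, the elements \<open>T (c i) \<eta>\<close> with weights \<open>d i\<close>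
  isolate the term of one \<open>\<eta>\<close>.\<close>

lemma fixed_field_sub_of:
  assumes M: "stable_subgroup M"
  shows "fixed_field emb H gp_act (sub_of M) = {x. \<forall>\<eta>\<in>M. \<sigma> \<eta> x = x}"
proof -
  have eq: "gp_act h x = emb (counit H h) * x \<longleftrightarrow> (\<Sum>\<eta>\<in>N. lookup h \<eta> * (\<sigma> \<eta> x - x)) = 0"
    if "h \<in> C" for h x
    by (simp add: gp_act_C[OF that] emb_counit_H[OF that] right_diff_distrib sum_subtractf sum_distrib_right)
  show ?thesis
  proof (intro equalityI subsetI CollectI ballI)
    fix x \<eta> assume x: "x \<in> fixed_field emb H gp_act (sub_of M)" and \<eta>: "\<eta> \<in> M"
    have \<eta>N: "\<eta> \<in> N" using M \<eta> by (auto simp: stable_subgroup_def)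
    have "(\<Sum>\<theta>\<in>N. lookup (T (c i) \<eta>) \<theta> * (\<sigma> \<theta> x - x)) = 0" for i
      using x T_sub_of[OF M \<eta>] eq[OF T_C[OF \<eta>N]] unfolding fixed_field_def by blast
    then have "0 = (\<Sum>i<m. d i * (\<Sum>\<theta>\<in>N. lookup (T (c i) \<eta>) \<theta> * (\<sigma> \<theta> x - x)))" by simp
    also have "\<dots> = (\<Sum>\<theta>\<in>N. (\<Sum>i<m. d i * lookup (T (c i) \<eta>) \<theta>) * (\<sigma> \<theta> x - x))"
      unfolding sum_distrib_left sum_distrib_right by (subst sum.swap) (simp add: mult.assoc)
    also have "\<dots> = (\<Sum>\<theta>\<in>N. if \<eta> = \<theta> then \<sigma> \<eta> x - x else 0)"
      unfolding sum_T by (rule sum.cong) auto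
    also have "\<dots> = \<sigma> \<eta> x - x" using finite_N \<eta>N by simp
    finally show "\<sigma> \<eta> x = x" by simp
  next
    fix x assume x: "x \<in> {x. \<forall>\<eta>\<in>M. \<sigma> \<eta> x = x}"
    show "x \<in> fixed_field emb H gp_act (sub_of M)"
      unfolding fixed_field_def
    proof (intro CollectI ballI)
      fix h assume h: "h \<in> sub_of M"
      then have "lookup h \<eta> * (\<sigma> \<eta> x - x) = 0" for \<eta>
        using x by (cases "\<eta> \<in> M") (auto simp: sub_of_def in_keys_iff subset_iff)
      with h eq[of h x] show "gp_act h x = emb (counit H h) * x" by (simp add: sub_of_def)
    qed
  qed
qed

lemma intermediate_fixed_field:
  assumes M: "stable_subgroup M"
  shows "intermediate_field emb (fixed_field emb H gp_act (sub_of M))"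
proof -
  have gal: "\<sigma> \<eta> \<in> Gal emb" if "\<eta> \<in> M" for \<eta> using M that \<sigma>_Gal by (auto simp: stable_subgroup_def)
  then show ?thesis
    unfolding fixed_field_sub_of[OF M] intermediate_field_def
    by (auto simp: GalD(2,3)[OF gal] Gal_minus[OF gal] Gal_inverse[OF gal])
qed

text \<open>The sum of the \<open>\<sigma> \<kappa> x\<close> over \<open>M\<close> is a relative
  trace: by \<open>\<sigma>_comp\<close>, applying \<open>\<sigma> \<theta>\<close> with
  \<open>\<theta>\<close> in \<open>M\<close> permutes its terms. By assumption
  \<open>\<sigma> \<eta>\<close> fixes it too, so the sums over \<open>M\<close> and over its
  twisted translate by \<open>\<eta>\<close> agree for all \<open>x\<close>. Independence makes the
  two sets agree at \<open>\<eta>\<close>, which lies in the translate as the image of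
  \<open>id\<close>.\<close>

lemma fixed_field_subset_imp:
  assumes M: "stable_subgroup M" and \<eta>: "\<eta> \<in> N"
    and fix_imp: "\<And>x. \<forall>\<theta>\<in>M. \<sigma> \<theta> x = x \<Longrightarrow> \<sigma> \<eta> x = x"
  shows "\<eta> \<in> M"
proof -
  have MN: "M \<subseteq> N" and finM: "finite M"
    using M finite_N finite_subset by (auto simp: stable_subgroup_def)
  let ?g = "\<lambda>\<theta> \<kappa>. \<theta> \<circ> ac (\<sigma> \<theta>) \<kappa>"
  have g: "inj_on (?g \<theta>) M" if "\<theta> \<in> N" for \<theta>
  proof (rule inj_onI)
    fix \<kappa> \<kappa>' assume "?g \<theta> \<kappa> = ?g \<theta> \<kappa>'"
    then have "ac (\<sigma> \<theta>) \<kappa> = ac (\<sigma> \<theta>) \<kappa>'" using inv_N(3)[OF that] by (metis comp_assoc id_comp)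
    then show "\<kappa> = \<kappa>'" using ac_eq_iff[OF \<sigma>_Gal[OF that]] by blast
  qed
  have \<sigma>_sum: "\<sigma> \<theta> (\<Sum>\<kappa>\<in>M. \<sigma> \<kappa> x) = (\<Sum>\<kappa>\<in>?g \<theta> ` M. \<sigma> \<kappa> x)" if \<theta>: "\<theta> \<in> N" for \<theta> x
  proof -
    have "\<sigma> \<theta> (\<sigma> \<kappa> x) = \<sigma> (?g \<theta> \<kappa>) x" if "\<kappa> \<in> M" for \<kappa>
      using \<sigma>_comp[OF \<theta>, of \<kappa>] that MN by auto
    then show ?thesis by (simp add: Gal_sum[OF \<sigma>_Gal[OF \<theta>]] sum.reindex[OF g[OF \<theta>]])
  qed
  have "\<sigma> \<eta> (\<Sum>\<kappa>\<in>M. \<sigma> \<kappa> x) = (\<Sum>\<kappa>\<in>M. \<sigma> \<kappa> x)" for x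
  proof (rule fix_imp, rule ballI)
    fix \<theta> assume \<theta>: "\<theta> \<in> M"
    with MN have \<theta>N: "\<theta> \<in> N" by blast
    have "?g \<theta> ` M \<subseteq> M" using M \<theta> \<sigma>_Gal[OF \<theta>N] by (auto simp: stable_subgroup_def)
    then have "?g \<theta> ` M = M" using g[OF \<theta>N] finM by (metis endo_inj_surj)
    then show "\<sigma> \<theta> (\<Sum>\<kappa>\<in>M. \<sigma> \<kappa> x) = (\<Sum>\<kappa>\<in>M. \<sigma> \<kappa> x)" using \<sigma>_sum[OF \<theta>N] by simp
  qed
  then have eq: "(\<Sum>\<kappa>\<in>?g \<eta> ` M. \<sigma> \<kappa> x) = (\<Sum>\<kappa>\<in>M. \<sigma> \<kappa> x)" for x
    using \<sigma>_sum[OF \<eta>] by simp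
  have gN: "?g \<eta> ` M \<subseteq> N" using MN \<eta> \<sigma>_Gal[OF \<eta>] by (auto intro!: comp_N)
  have ind: "(\<Sum>\<kappa>\<in>N. of_bool (\<kappa> \<in> S) * \<sigma> \<kappa> x) = (\<Sum>\<kappa>\<in>S. \<sigma> \<kappa> x)" if "S \<subseteq> N" for S x
  proof -
    have "(\<Sum>\<kappa>\<in>S. \<sigma> \<kappa> x) = (\<Sum>\<kappa>\<in>S. of_bool (\<kappa> \<in> S) * \<sigma> \<kappa> x)" by simp
    also have "\<dots> = (\<Sum>\<kappa>\<in>N. of_bool (\<kappa> \<in> S) * \<sigma> \<kappa> x)"
      using that finite_N by (intro sum.mono_neutral_left) auto
    finally show ?thesis by simp
  qed
  \<comment> \<open>Independence is applied to the difference of the two characteristic functions,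
    with values in \<open>L\<close>.\<close>
  have "(\<Sum>\<kappa>\<in>N. (of_bool (\<kappa> \<in> ?g \<eta> ` M) - of_bool (\<kappa> \<in> M)) * \<sigma> \<kappa> x) = 0" for x
    by (simp only: left_diff_distrib sum_subtractf ind[OF gN] ind[OF MN] eq) simp
  from Dedekind_N[OF this \<eta>] have "\<eta> \<in> ?g \<eta> ` M \<longleftrightarrow> \<eta> \<in> M"
    by (auto simp: of_bool_def split: if_splits)
  moreover have "\<eta> = ?g \<eta> id" using ac_id_perm[OF \<sigma>_Gal[OF \<eta>]] by simp
  moreover have "id \<in> M" using M by (simp add: stable_subgroup_def)
  ultimately show ?thesis by (metis imageI)
qed

lemma fixed_field_inj:
  assumes "stable_subgroup M" "stable_subgroup M'"
    and "fixed_field emb H gp_act (sub_of M) = fixed_field emb H gp_act (sub_of M')"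
  shows "M = M'"
proof (intro equalityI subsetI)
  have eq: "(\<forall>\<theta>\<in>M. \<sigma> \<theta> x = x) \<longleftrightarrow> (\<forall>\<theta>\<in>M'. \<sigma> \<theta> x = x)" for x
    using assms(3) unfolding fixed_field_sub_of[OF assms(1)] fixed_field_sub_of[OF assms(2)] by blast
  show "\<eta> \<in> M" if "\<eta> \<in> M'" for \<eta>
    using assms(2) that eq by (intro fixed_field_subset_imp[OF assms(1)]) (auto simp: stable_subgroup_def)
  show "\<eta> \<in> M'" if "\<eta> \<in> M" for \<eta>
    using assms(1) that eq by (intro fixed_field_subset_imp[OF assms(2)]) (auto simp: stable_subgroup_def)
qed

end

section \<open>Ideals of the primitive algebra\<close>

text \<open>The power \<open>A^i\<close>. Degrees start at 1, so \<open>i = 1\<close> gives all of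
  \<open>A\<close> and \<open>i = n + 1\<close> the zero ideal.\<close>

definition prim_ideal :: "nat \<Rightarrow> nat \<Rightarrow> nat \<Rightarrow> (nat \<Rightarrow> int) set" where
  "prim_ideal p n i = {a \<in> prim_carrier p n. \<forall>k<i. a k = 0}"

text \<open>The basis element \<open>z^e\<close>.\<close>

definition prim_gen :: "nat \<Rightarrow> nat \<Rightarrow> int" where
  "prim_gen e = (\<lambda>k. if k = e then 1 else 0)"

context
  fixes p n :: nat
  assumes p: "prime p"
begin

lemma p_gt_1: "int p > 1"
  using prime_gt_1_nat[OF p] by simp

lemma prim_carrier_mod:
  assumes "a \<in> prim_carrier p n"
  shows "a k mod int p = a k"
  using assms p_gt_1 by (cases "k \<in> {1..n}") (auto simp: prim_carrier_def)

lemma prim_add_closed: "a \<in> prim_carrier p n \<Longrightarrow> b \<in> prim_carrier p n \<Longrightarrow> prim_add p a b \<in> prim_carrier p n"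
  using p_gt_1 by (auto simp: prim_carrier_def prim_add_def)

lemma prim_mult_closed: "prim_mult p n a b \<in> prim_carrier p n"
  using p_gt_1 by (auto simp: prim_carrier_def prim_mult_def)

lemma zero_prim_carrier: "(\<lambda>k. 0) \<in> prim_carrier p n"
  using p_gt_1 by (auto simp: prim_carrier_def)

lemma prim_gen_closed: "e \<in> {1..n} \<Longrightarrow> prim_gen e \<in> prim_carrier p n"
  using p_gt_1 by (auto simp: prim_carrier_def prim_gen_def)

lemma prim_mult_add_right: "prim_mult p n a (prim_add p b c) = prim_add p (prim_mult p n a b) (prim_mult p n a c)"
proof
  fix k
  have "(\<Sum>i=1..<k. a i * ((b (k - i) + c (k - i)) mod int p)) mod int p =
    (\<Sum>i=1..<k. (a i * ((b (k - i) + c (k - i)) mod int p)) mod int p) mod int p"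
    by (rule mod_sum_eq[symmetric])
  also have "\<dots> = (\<Sum>i=1..<k. (a i * (b (k - i) + c (k - i))) mod int p) mod int p"
    by (simp add: mod_mult_right_eq)
  also have "\<dots> = (\<Sum>i=1..<k. a i * (b (k - i) + c (k - i))) mod int p"
    by (rule mod_sum_eq)
  also have "\<dots> = ((\<Sum>i=1..<k. a i * b (k - i)) mod int p + (\<Sum>i=1..<k. a i * c (k - i)) mod int p) mod int p"
    by (simp add: distrib_left sum.distrib mod_add_eq)
  finally show "prim_mult p n a (prim_add p b c) k = prim_add p (prim_mult p n a b) (prim_mult p n a c) k"
    by (simp add: prim_mult_def prim_add_def)
qed

lemma prim_mult_gen:
  assumes "s \<in> prim_carrier p n" "e \<ge> 1" "k \<in> {1..n}"
  shows "prim_mult p n (prim_gen e) s k = (if e < k then s (k - e) else 0)"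
proof -
  have "(\<Sum>i=1..<k. prim_gen e i * s (k - i)) = (\<Sum>i=1..<k. if i = e then s (k - e) else 0)"
    by (rule sum.cong) (auto simp: prim_gen_def)
  then show ?thesis using assms by (simp add: prim_mult_def prim_carrier_mod)
qed

lemma prim_ideal_1: "prim_ideal p n 1 = prim_carrier p n"
  by (auto simp: prim_ideal_def prim_carrier_def)

lemma prim_ideal_Suc_n: "prim_ideal p n (n + 1) = {\<lambda>k. 0}"
  using zero_prim_carrier by (auto simp: prim_ideal_def prim_carrier_def fun_eq_iff)
    (metis atLeastAtMost_iff le_imp_less_Suc)

lemma prim_ideal_mono: "i \<le> j \<Longrightarrow> prim_ideal p n j \<subseteq> prim_ideal p n i"
  by (auto simp: prim_ideal_def)

lemma prim_gen_ideal:
  assumes "i \<in> {1..n}" "i < j"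
  shows "prim_gen i \<in> prim_ideal p n i" "prim_gen i \<notin> prim_ideal p n j"
  using assms prim_gen_closed[OF assms(1)] by (auto simp: prim_ideal_def prim_gen_def)

lemma prim_ideal_add: "a \<in> prim_ideal p n i \<Longrightarrow> b \<in> prim_ideal p n i \<Longrightarrow> prim_add p a b \<in> prim_ideal p n i"
  using prim_add_closed by (auto simp: prim_ideal_def) (simp add: prim_add_def)

lemma prim_ideal_neg:
  assumes "a \<in> prim_ideal p n i"
  obtains b where "b \<in> prim_ideal p n i" "prim_add p a b = (\<lambda>k. 0)"
proof (rule that[of "\<lambda>k. (- a k) mod int p"])
  show "(\<lambda>k. (- a k) mod int p) \<in> prim_ideal p n i"
    using assms p_gt_1 by (auto simp: prim_ideal_def prim_carrier_def)
  show "prim_add p a (\<lambda>k. (- a k) mod int p) = (\<lambda>k. 0)"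
    by (simp add: prim_add_def mod_add_right_eq)
qed

lemma prim_ideal_mult:
  assumes "s \<in> prim_ideal p n i"
  shows "prim_mult p n a s \<in> prim_ideal p n i"
  using prim_mult_closed assms by (auto simp: prim_ideal_def) (auto simp: prim_mult_def)

text \<open>
  Multiplying an element of least order \<open>i\<close> by powers of \<open>z\<close> yields elements of every order \<open>j \<ge> i\<close>,
  whose multiples remove leading coefficients.
\<close>

lemma prim_ideal_cases:
  assumes S: "S \<subseteq> prim_carrier p n" and 0: "(\<lambda>k. 0) \<in> S"
    and add: "\<And>a b. a \<in> S \<Longrightarrow> b \<in> S \<Longrightarrow> prim_add p a b \<in> S"
    and mult: "\<And>a s. a \<in> prim_carrier p n \<Longrightarrow> s \<in> S \<Longrightarrow> prim_mult p n a s \<in> S"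
  obtains i where "i \<in> {1..n + 1}" "S = prim_ideal p n i"
proof (cases "S = {\<lambda>k. 0}")
  case True
  then show ?thesis using that[of "n + 1"] prim_ideal_Suc_n by simp
next
  case False
  \<comment> \<open>\<open>S\<close> is only assumed to be additive and \<open>A\<close> has no
    unit, so scalar multiples arise by repeated addition.\<close>
  have multiple: "(\<lambda>k. (int u * s k) mod int p) \<in> S" if s: "s \<in> S" for u s
  proof (induction u)
    case 0
    then show ?case using \<open>(\<lambda>k. 0) \<in> S\<close> by simp
  next
    case (Suc u)
    have "prim_add p s (\<lambda>k. (int u * s k) mod int p) = (\<lambda>k. (int (Suc u) * s k) mod int p)"
      by (simp add: prim_add_def mod_add_right_eq algebra_simps)
    with add[OF s Suc] show ?case by simp
  qed
  have ex: "\<exists>k. \<exists>s\<in>S. s k \<noteq> 0" using False 0 by auto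
  define i where "i = (LEAST k. \<exists>s\<in>S. s k \<noteq> 0)"
  obtain s where s: "s \<in> S" "s i \<noteq> 0" using LeastI_ex[OF ex] unfolding i_def by blast
  have least: "t k = 0" if "t \<in> S" "k < i" for t k
    using not_less_Least[of k "\<lambda>k. \<exists>s\<in>S. s k \<noteq> 0"] that unfolding i_def by blast
  have sP: "s \<in> prim_carrier p n" using s(1) S by blast
  have i: "i \<in> {1..n}" using sP s(2) by (auto simp: prim_carrier_def)
  have leading: "\<exists>t\<in>S. t \<in> prim_ideal p n j \<and> t j \<noteq> 0" if j: "i \<le> j" "j \<le> n" for j
  proof (cases "j = i")
    case True
    then show ?thesis using s sP least by (auto simp: prim_ideal_def)
  next
    case False
    with j i have e: "j - i \<in> {1..n}" by auto
    let ?t = "prim_mult p n (prim_gen (j - i)) s"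
    have "?t \<in> S" by (rule mult[OF prim_gen_closed[OF e] s(1)])
    moreover have t: "?t k = (if k \<in> {1..n} \<and> j - i < k then s (k - (j - i)) else 0)" for k
      using prim_mult_gen[OF sP, of "j - i" k] e by (auto simp: prim_mult_def)
    have "?t k = 0" if "k < j" for k
      using that j least[OF s(1), of "k - (j - i)"] e unfolding t by auto
    moreover have "?t j \<noteq> 0"
      using j i s(2) e unfolding t by auto
    ultimately show ?thesis using S by (auto simp: prim_ideal_def)
  qed
  \<comment> \<open>Induction upwards from the zero ideal at degree \<open>n + 1\<close>; each step
    lowers the degree by one, until \<open>i\<close> is reached.\<close>
  have "prim_ideal p n (n + 1 - t) \<subseteq> S" if "t \<le> n + 1 - i" for t
    using that
  proof (induction t)
    case 0
    then show ?case using \<open>(\<lambda>k. 0) \<in> S\<close> prim_ideal_Suc_n by simp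
  next
    case (Suc t)
    define j where "j = n + 1 - Suc t"
    have j: "i \<le> j" "j \<le> n" "n + 1 - t = j + 1" using Suc.prems i by (auto simp: j_def)
    then have IH: "prim_ideal p n (j + 1) \<subseteq> S" using Suc by simp
    obtain s' where s': "s' \<in> S" "s' \<in> prim_ideal p n j" "s' j \<noteq> 0" using leading[OF j(1,2)] by blast
    have "0 \<le> s' j" "s' j < int p" using s'(2) j i by (auto simp: prim_ideal_def prim_carrier_def)
    with s'(3) have "\<not> int p dvd s' j" using zdvd_not_zless by force
    then have "coprime (s' j) (int p)"
      using p by (simp add: coprime_commute prime_imp_coprime)
    then obtain y where y: "[s' j * y = 1] (mod int p)" using cong_solve_coprime_int by blast
    show ?case unfolding j_def[symmetric]
    proof
      fix x assume x: "x \<in> prim_ideal p n j"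
      \<comment> \<open>The quotient of \<open>x j\<close> by \<open>s' j\<close> modulo
        \<open>p\<close>, taken as a natural number because \<open>multiple\<close> counts
        additions. Subtracting \<open>u\<close> times \<open>s'\<close> from \<open>x\<close> raises
        its order above \<open>j\<close>.\<close>
      define u where "u = nat ((y * x j) mod int p)"
      have u: "int u = (y * x j) mod int p" using p_gt_1 by (simp add: u_def)
      have "(int u * s' j) mod int p = (s' j * y * x j) mod int p"
        unfolding u by (simp add: mod_mult_left_eq mod_mult_right_eq mult_ac)
      also have "\<dots> = x j mod int p"
        using cong_scalar_right[OF y, of "x j"] by (simp add: cong_def)
      finally have uj: "(x j - int u * s' j) mod int p = 0"
        by (metis mod_diff_eq diff_self mod_0)
      let ?us = "\<lambda>k. (int u * s' k) mod int p" and ?y = "\<lambda>k. (x k - int u * s' k) mod int p"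
      have "?y \<in> prim_ideal p n (j + 1)"
        using x s'(2) uj p_gt_1 by (auto simp: prim_ideal_def prim_carrier_def less_Suc_eq)
      then have "prim_add p ?us ?y \<in> S" using add multiple[OF s'(1)] IH by blast
      moreover have "prim_add p ?us ?y = x"
      proof
        fix k
        have "prim_add p ?us ?y k = x k mod int p" by (simp add: prim_add_def mod_add_eq)
        also have "\<dots> = x k" using x by (intro prim_carrier_mod) (simp add: prim_ideal_def)
        finally show "prim_add p ?us ?y k = x k" .
      qed
      ultimately show "x \<in> S" by simp
    qed
  qed
  from this[of "n + 1 - i"] i have "prim_ideal p n i \<subseteq> S" by simp
  moreover have "S \<subseteq> prim_ideal p n i" using S least by (auto simp: prim_ideal_def)
  ultimately show ?thesis using that[of i] i by auto
qed

end

section \<open>The regular subgroup of a primitive algebra structure\<close>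

locale primitive_galois = finite_galois emb for emb :: "'k::field \<Rightarrow> 'l::field" +
  fixes p n :: nat and mul :: "'g::ab_group_add \<Rightarrow> 'g \<Rightarrow> 'g" and \<phi> :: "(nat \<Rightarrow> int) \<Rightarrow> 'g"
    and \<xi> :: "('l \<Rightarrow> 'l) \<Rightarrow> 'g"
  assumes p: "prime p"
    and finite_G: "finite (UNIV :: 'g set)"
    and \<phi>_bij: "bij_betw \<phi> (prim_carrier p n) UNIV"
    and \<phi>_add: "\<And>a b. a \<in> prim_carrier p n \<Longrightarrow> b \<in> prim_carrier p n \<Longrightarrow> \<phi> (prim_add p a b) = \<phi> a + \<phi> b"
    and \<phi>_mult: "\<And>a b. a \<in> prim_carrier p n \<Longrightarrow> b \<in> prim_carrier p n \<Longrightarrow> \<phi> (prim_mult p n a b) = mul (\<phi> a) (\<phi> b)"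
    and \<xi>_iso: "\<xi> \<in> iso (galois_group emb) (circle_group mul)"
begin

lemma \<phi>_surj:
  obtains a where "a \<in> prim_carrier p n" "x = \<phi> a"
  using bij_betw_imp_surj_on[OF \<phi>_bij] by (metis UNIV_I imageE)

lemma mul_add: "mul x (y + z) = mul x y + mul x z"
proof -
  obtain a where a: "a \<in> prim_carrier p n" "x = \<phi> a" by (rule \<phi>_surj)
  obtain b where b: "b \<in> prim_carrier p n" "y = \<phi> b" by (rule \<phi>_surj)
  obtain c where c: "c \<in> prim_carrier p n" "z = \<phi> c" by (rule \<phi>_surj)
  note abc = a b c
  have "mul x (y + z) = \<phi> (prim_mult p n a (prim_add p b c))"
    using abc by (simp add: \<phi>_add \<phi>_mult prim_add_closed[OF p])
  also have "\<dots> = mul x y + mul x z"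
    using abc by (simp add: prim_mult_add_right[OF p] \<phi>_add \<phi>_mult prim_mult_closed[OF p])
  finally show ?thesis .
qed

lemma \<phi>_0: "\<phi> (\<lambda>k. 0) = 0"
  using \<phi>_add[OF zero_prim_carrier[OF p] zero_prim_carrier[OF p]] by (simp add: prim_add_def)

lemma \<xi>_bij: "bij_betw \<xi> (Gal emb) UNIV"
  using \<xi>_iso by (simp add: iso_def galois_group_def circle_group_def)

lemma \<xi>_comp: "\<gamma> \<in> Gal emb \<Longrightarrow> \<delta> \<in> Gal emb \<Longrightarrow> \<xi> (\<gamma> \<circ> \<delta>) = \<xi> \<gamma> + \<xi> \<delta> + mul (\<xi> \<gamma>) (\<xi> \<delta>)"
  using \<xi>_iso by (auto simp: iso_def hom_def galois_group_def circle_group_def)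

definition r where "r = inv_into (Gal emb) \<xi>"

lemma r_Gal [simp]: "r g \<in> Gal emb"
  using \<xi>_bij unfolding r_def by (metis UNIV_I bij_betw_imp_surj_on inv_into_into)

lemma \<xi>_r [simp]: "\<xi> (r g) = g"
  using \<xi>_bij unfolding r_def by (metis UNIV_I bij_betw_imp_surj_on f_inv_into_f)

lemma r_\<xi> [simp]: "\<gamma> \<in> Gal emb \<Longrightarrow> r (\<xi> \<gamma>) = \<gamma>"
  using \<xi>_bij unfolding r_def by (simp add: bij_betw_def)

abbreviation \<alpha> where "\<alpha> \<equiv> alpha emb \<xi>"

lemma \<alpha>_apply: "\<gamma> \<in> Gal emb \<Longrightarrow> \<alpha> g \<gamma> = r (g + \<xi> \<gamma>)" "\<gamma> \<notin> Gal emb \<Longrightarrow> \<alpha> g \<gamma> = \<gamma>"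
  by (simp_all add: alpha_def r_def)

lemma \<alpha>_0: "\<alpha> 0 = id"
  by (auto simp: fun_eq_iff[of "\<alpha> 0"]) (metis \<alpha>_apply add_0 r_\<xi>)

lemma \<alpha>_add: "\<alpha> (g + h) = \<alpha> g \<circ> \<alpha> h"
proof
  fix \<gamma> show "\<alpha> (g + h) \<gamma> = (\<alpha> g \<circ> \<alpha> h) \<gamma>"
    by (cases "\<gamma> \<in> Gal emb") (simp_all add: \<alpha>_apply add.assoc)
qed

lemma \<alpha>_inverse: "\<alpha> g \<circ> \<alpha> (- g) = id" "\<alpha> (- g) \<circ> \<alpha> g = id"
  by (simp_all flip: \<alpha>_add add: \<alpha>_0)

lemma inv_\<alpha>: "inv_into UNIV (\<alpha> g) = \<alpha> (- g)"
  by (rule inv_unique_comp[OF \<alpha>_inverse])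

lemma \<alpha>_permutes: "\<alpha> g permutes Gal emb"
proof (rule bij_imp_permutes)
  show "bij_betw (\<alpha> g) (Gal emb) (Gal emb)"
    by (rule bij_betw_byWitness[where f' = "\<alpha> (- g)"]) (auto simp: \<alpha>_apply add.assoc[symmetric])
qed (simp add: \<alpha>_apply)

lemma \<alpha>_eqD:
  assumes "\<gamma> \<in> Gal emb" "\<alpha> g \<gamma> = \<alpha> h \<gamma>"
  shows "g = h"
proof -
  have "\<xi> (r (g + \<xi> \<gamma>)) = \<xi> (r (h + \<xi> \<gamma>))" using assms by (simp only: \<alpha>_apply)
  then show ?thesis by simp
qed

lemma inj_\<alpha>: "inj \<alpha>"
  using \<alpha>_eqD[OF id_Gal] by (auto intro: injI)

lemma regular_\<alpha>: "regular_subgroup (Gal emb) (range \<alpha>)"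
  unfolding regular_subgroup_def
proof (intro conjI ballI)
  have inv: "inv\<^bsub>perm_group (Gal emb)\<^esub> (\<alpha> g) = \<alpha> (- g)" for g
  proof -
    have "y = \<alpha> (- g)" if "\<alpha> g \<circ> y = id" for y
      using that \<alpha>_inverse(2)[of g] by (metis comp_assoc comp_id id_comp)
    then show ?thesis
      unfolding m_inv_def
      by (intro the_equality) (simp add: perm_group_def \<alpha>_permutes \<alpha>_inverse, simp add: perm_group_def)
  qed
  show "subgroup (range \<alpha>) (perm_group (Gal emb))"
  proof (rule subgroup.intro)
    show "range \<alpha> \<subseteq> carrier (perm_group (Gal emb))"
      using \<alpha>_permutes by (auto simp: perm_group_def)
    show "\<one>\<^bsub>perm_group (Gal emb)\<^esub> \<in> range \<alpha>"
      using \<alpha>_0 by (metis perm_group_def monoid.select_convs(2) rangeI)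
    fix x assume "x \<in> range \<alpha>"
    then show "inv\<^bsub>perm_group (Gal emb)\<^esub> x \<in> range \<alpha>" using inv by auto
    fix y assume "y \<in> range \<alpha>"
    with \<open>x \<in> range \<alpha>\<close> show "x \<otimes>\<^bsub>perm_group (Gal emb)\<^esub> y \<in> range \<alpha>"
      by (auto simp: perm_group_def simp flip: \<alpha>_add)
  qed
  fix \<gamma> \<delta> assume *: "\<gamma> \<in> Gal emb" "\<delta> \<in> Gal emb"
  show "\<exists>!\<eta>. \<eta> \<in> range \<alpha> \<and> \<eta> \<gamma> = \<delta>"
  proof (rule ex1I)
    show "\<alpha> (\<xi> \<delta> - \<xi> \<gamma>) \<in> range \<alpha> \<and> \<alpha> (\<xi> \<delta> - \<xi> \<gamma>) \<gamma> = \<delta>"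
      using * by (simp add: \<alpha>_apply)
    fix \<eta> assume "\<eta> \<in> range \<alpha> \<and> \<eta> \<gamma> = \<delta>"
    then show "\<eta> = \<alpha> (\<xi> \<delta> - \<xi> \<gamma>)"
      using * \<alpha>_eqD[OF *(1)] by (auto simp: \<alpha>_apply)
  qed
qed

lemma regular_embedding_\<alpha>: "regular_embedding emb \<alpha>"
  unfolding regular_embedding_def using inj_\<alpha> regular_\<alpha> \<alpha>_permutes
  by (auto simp: hom_def additive_group_def perm_group_def \<alpha>_add)

text \<open>From \<open>a \<circ> (g + b) = (g + a g) + a \<circ> b\<close>.\<close>

lemma ac_\<alpha>:
  assumes \<gamma>: "\<gamma> \<in> Gal emb"
  shows "ac \<gamma> (\<alpha> g) = \<alpha> (g + mul (\<xi> \<gamma>) g)"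
proof
  fix \<delta>
  show "ac \<gamma> (\<alpha> g) \<delta> = \<alpha> (g + mul (\<xi> \<gamma>) g) \<delta>"
  proof (cases "\<delta> \<in> Gal emb")
    case True
    let ?\<delta> = "inv_into UNIV \<gamma> \<circ> \<delta>"
    have \<delta>: "?\<delta> \<in> Gal emb" using \<gamma> True by (simp add: comp_Gal inv_Gal)
    have "\<xi> \<delta> = \<xi> (\<gamma> \<circ> ?\<delta>)" using inv_Gal(2)[OF \<gamma>] by (simp add: o_assoc)
    also have "\<dots> = \<xi> \<gamma> + \<xi> ?\<delta> + mul (\<xi> \<gamma>) (\<xi> ?\<delta>)" by (rule \<xi>_comp[OF \<gamma> \<delta>])
    finally have "\<xi> (\<gamma> \<circ> r (g + \<xi> ?\<delta>)) = g + mul (\<xi> \<gamma>) g + \<xi> \<delta>"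
      by (simp add: \<xi>_comp[OF \<gamma>] mul_add algebra_simps)
    then have "\<gamma> \<circ> r (g + \<xi> ?\<delta>) = r (g + mul (\<xi> \<gamma>) g + \<xi> \<delta>)"
      using r_\<xi>[OF comp_Gal[OF \<gamma> r_Gal]] by metis
    moreover have "ac \<gamma> (\<alpha> g) \<delta> = \<gamma> \<circ> r (g + \<xi> ?\<delta>)"
      using \<gamma> \<delta> True by (simp add: ac_eq left_regular_def inv_Gal \<alpha>_apply)
    ultimately show ?thesis using True by (simp add: \<alpha>_apply)
  next
    case False
    then show ?thesis using \<gamma> by (simp add: ac_eq left_regular_def inv_Gal \<alpha>_apply)
  qed
qed

lemma normalized_\<alpha>: "normalized_by_left emb (range \<alpha>)"
  unfolding normalized_by_left_def
proof
  fix \<gamma> assume \<gamma>: "\<gamma> \<in> Gal emb"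
  have "finite (range \<alpha>)" using finite_G by simp
  moreover have "ac \<gamma> ` range \<alpha> \<subseteq> range \<alpha>" using ac_\<alpha>[OF \<gamma>] by auto
  moreover have "inj_on (ac \<gamma>) (range \<alpha>)" using ac_eq_iff[OF \<gamma>] by (auto intro: inj_onI)
  ultimately show "ac \<gamma> ` range \<alpha> = range \<alpha>" by (rule endo_inj_surj)
qed

lemma inj_\<alpha>_\<phi>: "inj_on (\<lambda>a. \<alpha> (\<phi> a)) (prim_carrier p n)"
  using inj_\<alpha> bij_betw_imp_inj_on[OF \<phi>_bij] by (auto simp: inj_on_def inj_def)

definition ideal_group :: "nat \<Rightarrow> 'l perm set" where
  "ideal_group i = (\<lambda>a. \<alpha> (\<phi> a)) ` prim_ideal p n i"

lemma ideal_group_1: "ideal_group 1 = range \<alpha>"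
  unfolding ideal_group_def prim_ideal_1[OF p]
  using bij_betw_imp_surj_on[OF \<phi>_bij] by (simp flip: image_image)

lemma ideal_group_Suc_n: "ideal_group (n + 1) = {id}"
  unfolding ideal_group_def prim_ideal_Suc_n[OF p] by (simp add: \<phi>_0 \<alpha>_0)

lemma ideal_group_mono: "i \<le> j \<Longrightarrow> ideal_group j \<subseteq> ideal_group i"
  unfolding ideal_group_def using prim_ideal_mono[OF p] by blast

text \<open>The power \<open>z^i\<close> separates the two ideals, and \<open>\<alpha>\<close> after
  \<open>\<phi>\<close> is injective on the primitive algebra.\<close>

lemma ideal_group_neq:
  assumes "i \<in> {1..n}" "i < j"
  shows "ideal_group i \<noteq> ideal_group j"
proof -
  have "prim_ideal p n i \<noteq> prim_ideal p n j" using prim_gen_ideal[OF p assms] by blast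
  then show ?thesis
    unfolding ideal_group_def
    using inj_on_image_eq_iff[OF inj_\<alpha>_\<phi>, of "prim_ideal p n i" "prim_ideal p n j"]
    by (auto simp: prim_ideal_def)
qed

lemma inj_ideal_group: "inj_on ideal_group {1..n + 1}"
proof (rule linorder_inj_onI)
  fix i j assume "i < j" "i \<in> {1..n + 1}" "j \<in> {1..n + 1}"
  then show "ideal_group i \<noteq> ideal_group j" by (intro ideal_group_neq) auto
qed auto

end

section \<open>Stable subgroups as ideals\<close>

locale primitive_greither_pareigis =
  primitive_galois emb p n mul \<phi> \<xi> + greither_pareigis emb m c d c0 "range (alpha emb \<xi>)"
  for emb :: "'k::field \<Rightarrow> 'l::field" and p n :: nat and mul :: "'g::ab_group_add \<Rightarrow> 'g \<Rightarrow> 'g" and \<phi> \<xi> m c d c0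
begin

lemma stable_ideal_group: "stable_subgroup (ideal_group i)"
  unfolding stable_subgroup_def
proof (intro conjI ballI)
  have car: "a \<in> prim_carrier p n" if "a \<in> prim_ideal p n i" for a using that by (simp add: prim_ideal_def)
  show "ideal_group i \<subseteq> range \<alpha>" by (auto simp: ideal_group_def)
  have "(\<lambda>k. 0) \<in> prim_ideal p n i" using zero_prim_carrier[OF p] by (simp add: prim_ideal_def)
  then show "id \<in> ideal_group i" unfolding ideal_group_def by (metis (no_types, lifting) \<phi>_0 \<alpha>_0 image_eqI)
  fix \<eta> assume "\<eta> \<in> ideal_group i"
  then obtain a where a: "a \<in> prim_ideal p n i" "\<eta> = \<alpha> (\<phi> a)" by (auto simp: ideal_group_def)
  show "\<eta> \<circ> \<theta> \<in> ideal_group i" if \<theta>: "\<theta> \<in> ideal_group i" for \<theta>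
  proof -
    obtain b where b: "b \<in> prim_ideal p n i" "\<theta> = \<alpha> (\<phi> b)" using \<theta> by (auto simp: ideal_group_def)
    have "\<eta> \<circ> \<theta> = \<alpha> (\<phi> (prim_add p a b))" by (simp add: a b \<phi>_add car \<alpha>_add)
    then show ?thesis using prim_ideal_add[OF p a(1) b(1)] by (auto simp: ideal_group_def)
  qed
  obtain b where b: "b \<in> prim_ideal p n i" "prim_add p a b = (\<lambda>k. 0)"
    using prim_ideal_neg[OF p a(1)] by blast
  have "\<phi> a + \<phi> b = 0" using \<phi>_add[OF car car, OF a(1) b(1)] by (simp add: b(2) \<phi>_0)
  then have "\<phi> b = - \<phi> a" by (simp add: eq_neg_iff_add_eq_0 add.commute)
  then have "inv_into UNIV \<eta> = \<alpha> (\<phi> b)" by (simp add: a(2) inv_\<alpha>)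
  then show "inv_into UNIV \<eta> \<in> ideal_group i" using b(1) by (auto simp: ideal_group_def)
  fix \<gamma> assume \<gamma>: "\<gamma> \<in> Gal emb"
  obtain x where x: "x \<in> prim_carrier p n" "\<xi> \<gamma> = \<phi> x"
    using \<phi>_surj[of "\<xi> \<gamma>"] by blast
  have "ac \<gamma> \<eta> = \<alpha> (\<phi> (prim_add p a (prim_mult p n x a)))"
    by (simp add: a(2) ac_\<alpha>[OF \<gamma>] x \<phi>_add \<phi>_mult car[OF a(1)] prim_mult_closed[OF p])
  then show "ac \<gamma> \<eta> \<in> ideal_group i"
    using prim_ideal_add[OF p a(1) prim_ideal_mult[OF p a(1)]] by (auto simp: ideal_group_def)
qed

text \<open>As \<open>\<xi>\<close> is onto, every multiplier from \<open>A\<close> is some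
  \<xi>(\<gamma>). Stability under that \<gamma> puts \<open>s + a s\<close> in the subgroup along
  with \<open>s\<close>, and subtracting \<open>s\<close> leaves \<open>a s\<close>; so the subgroup
  is an ideal and \<open>prim_ideal_cases\<close> applies.\<close>

lemma stable_subgroup_cases:
  assumes M: "stable_subgroup M"
  obtains i where "i \<in> {1..n + 1}" "M = ideal_group i"
proof -
  define S where "S = {a \<in> prim_carrier p n. \<alpha> (\<phi> a) \<in> M}"
  have id: "id \<in> M" and comp: "\<And>\<eta> \<theta>. \<eta> \<in> M \<Longrightarrow> \<theta> \<in> M \<Longrightarrow> \<eta> \<circ> \<theta> \<in> M"
    and inv: "\<And>\<eta>. \<eta> \<in> M \<Longrightarrow> inv_into UNIV \<eta> \<in> M" and ac: "\<And>\<gamma> \<eta>. \<gamma> \<in> Gal emb \<Longrightarrow> \<eta> \<in> M \<Longrightarrow> ac \<gamma> \<eta> \<in> M"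
    and MN: "M \<subseteq> range \<alpha>"
    using M by (auto simp: stable_subgroup_def)
  obtain i where i: "i \<in> {1..n + 1}" "S = prim_ideal p n i"
  proof (rule prim_ideal_cases[OF p, of S n])
    show "S \<subseteq> prim_carrier p n" "(\<lambda>k. 0) \<in> S"
      using id zero_prim_carrier[OF p] by (auto simp: S_def \<phi>_0 \<alpha>_0)
    show "prim_add p a b \<in> S" if "a \<in> S" "b \<in> S" for a b
      using that comp by (auto simp: S_def \<phi>_add \<alpha>_add prim_add_closed[OF p])
    show "prim_mult p n a s \<in> S" if a: "a \<in> prim_carrier p n" and s: "s \<in> S" for a s
    proof -
      have "ac (r (\<phi> a)) (\<alpha> (\<phi> s)) \<in> M" using s by (intro ac) (auto simp: S_def)
      then have "\<alpha> (- \<phi> s) \<circ> \<alpha> (\<phi> s + mul (\<phi> a) (\<phi> s)) \<in> M"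
        using s inv[of "\<alpha> (\<phi> s)"] by (intro comp) (auto simp: S_def inv_\<alpha> ac_\<alpha>)
      then have "\<alpha> (mul (\<phi> a) (\<phi> s)) \<in> M" by (simp flip: \<alpha>_add)
      then show ?thesis using a s by (simp add: S_def \<phi>_mult prim_mult_closed[OF p])
    qed
  qed blast
  have "M = (\<lambda>a. \<alpha> (\<phi> a)) ` S"
  proof (intro equalityI subsetI)
    fix \<eta> assume \<eta>: "\<eta> \<in> M"
    then obtain g where g: "\<eta> = \<alpha> g" using MN by blast
    obtain a where "a \<in> prim_carrier p n" "g = \<phi> a"
      using \<phi>_surj[of g] by blast
    with \<eta> g show "\<eta> \<in> (\<lambda>a. \<alpha> (\<phi> a)) ` S" by (auto simp: S_def)
  qed (auto simp: S_def)
  with i that show ?thesis by (simp add: ideal_group_def)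
qed

lemma sub_hopf_algebras: "{J. sub_hopf_algebra H J} = (\<lambda>i. sub_of (ideal_group i)) ` {1..n + 1}"
proof (intro equalityI subsetI)
  fix J assume "J \<in> {J. sub_hopf_algebra H J}"
  then obtain M where "stable_subgroup M" "J = sub_of M" using sub_hopf_algebra_cases by blast
  then show "J \<in> (\<lambda>i. sub_of (ideal_group i)) ` {1..n + 1}" using stable_subgroup_cases by blast
qed (use sub_hopf_algebra_sub_of[OF stable_ideal_group] in auto)

lemma sub_of_strict:
  assumes "i \<in> {1..n}"
  shows "sub_of (ideal_group (i + 1)) \<subset> sub_of (ideal_group i)"
proof -
  have "ideal_group (i + 1) \<subseteq> ideal_group i" "\<not> ideal_group i \<subseteq> ideal_group (i + 1)"
    using ideal_group_mono[of i "i + 1"] ideal_group_neq[OF assms, of "i + 1"] by auto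
  then show ?thesis using sub_of_subset_iff[OF stable_ideal_group] by blast
qed

lemma card_fixed_fields: "card {fixed_field emb H gp_act J | J. sub_hopf_algebra H J} = n + 1"
proof -
  have "{fixed_field emb H gp_act J | J. sub_hopf_algebra H J} =
    (\<lambda>i. fixed_field emb H gp_act (sub_of (ideal_group i))) ` {1..n + 1}"
    using sub_hopf_algebras by (auto simp: setcompr_eq_image)
  moreover have "inj_on (\<lambda>i. fixed_field emb H gp_act (sub_of (ideal_group i))) {1..n + 1}"
    using fixed_field_inj[OF stable_ideal_group stable_ideal_group] inj_ideal_group
    unfolding inj_on_def by blast
  ultimately show ?thesis by (simp add: card_image)
qed

end

theorem theorem4p2:
  fixes p n :: nat
    and mul :: "'g::ab_group_add \<Rightarrow> 'g \<Rightarrow> 'g"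
    and emb :: "'k::field \<Rightarrow> 'l::field"
    and \<xi> :: "('l \<Rightarrow> 'l) \<Rightarrow> 'g"
  assumes "prime p"
    and "elementary_abelian p n TYPE('g)"
    and "primitive_algebra_structure p n mul"
    and "galois_extension emb"
    and "\<xi> \<in> iso (galois_group emb) (circle_group mul)"
  shows
    "let N = range (alpha emb \<xi>);
         H = gp_hopf emb N;
         \<F> = fixed_field emb H gp_act
     in regular_embedding emb (alpha emb \<xi>) \<and>
        normalized_by_left emb N \<and>
        hopf_galois emb H gp_act \<and>
        (\<exists>Hs :: nat \<Rightarrow> ((('l \<Rightarrow> 'l) \<Rightarrow> ('l \<Rightarrow> 'l)) \<Rightarrow>\<^sub>0 'l) set.
          Hs 1 = carrier H \<and>
          Hs (n + 1) = {scale H c \<one>\<^bsub>H\<^esub> | c. True} \<and>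
          (\<forall>i\<in>{1..n}. Hs (i + 1) \<subset> Hs i) \<and>
          {J. sub_hopf_algebra H J} = Hs ` {1..n + 1}) \<and>
        (\<forall>J. sub_hopf_algebra H J \<longrightarrow> intermediate_field emb (\<F> J)) \<and>
        card {\<F> J | J. sub_hopf_algebra H J} = n + 1"
proof -
  have "card (UNIV :: 'g set) > 0"
    using assms(1,2) by (simp add: elementary_abelian_def prime_gt_0_nat)
  then have finite_G: "finite (UNIV :: 'g set)" by (rule card_ge_0_finite)
  obtain \<phi> where \<phi>: "bij_betw \<phi> (prim_carrier p n) (UNIV :: 'g set)"
    "\<And>a b. a \<in> prim_carrier p n \<Longrightarrow> b \<in> prim_carrier p n \<Longrightarrow>
      \<phi> (prim_add p a b) = \<phi> a + \<phi> b \<and> \<phi> (prim_mult p n a b) = mul (\<phi> a) (\<phi> b)"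
    using assms(3) unfolding primitive_algebra_structure_def by blast
  have "bij_betw \<xi> (Gal emb) UNIV"
    using assms(5) by (simp add: iso_def galois_group_def circle_group_def)
  then have "finite (Gal emb)" using finite_G bij_betw_finite by blast
  then interpret primitive_galois emb p n mul \<phi> \<xi>
    using assms finite_G \<phi> by unfold_locales auto
  obtain m and c d :: "nat \<Rightarrow> 'l" where "\<forall>\<gamma>\<in>Gal emb. (\<Sum>i<m. d i * \<gamma> (c i)) = (if \<gamma> = id then 1 else 0)"
    using galois_coordinates_exist by blast
  moreover obtain c0 where "tr c0 = 1" using trace_one_exists .
  ultimately interpret primitive_greither_pareigis emb p n mul \<phi> \<xi> m c d c0
    using regular_\<alpha> normalized_\<alpha> by unfold_locales auto
  let ?Hs = "\<lambda>i. sub_of (ideal_group i)"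
  have "?Hs 1 = carrier H" by (simp only: ideal_group_1 sub_of_N)
  moreover have "?Hs (n + 1) = {scale H c \<one>\<^bsub>H\<^esub> | c. True}" by (simp only: ideal_group_Suc_n sub_of_id)
  moreover have "\<forall>i\<in>{1..n}. ?Hs (i + 1) \<subset> ?Hs i" using sub_of_strict by blast
  ultimately have chain: "\<exists>Hs. Hs 1 = carrier H \<and> Hs (n + 1) = {scale H c \<one>\<^bsub>H\<^esub> | c. True} \<and>
      (\<forall>i\<in>{1..n}. Hs (i + 1) \<subset> Hs i) \<and> {J. sub_hopf_algebra H J} = Hs ` {1..n + 1}"
    using sub_hopf_algebras by (intro exI[of _ ?Hs] conjI)
  have "\<forall>J. sub_hopf_algebra H J \<longrightarrow> intermediate_field emb (fixed_field emb H gp_act J)"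
    using sub_hopf_algebra_cases intermediate_fixed_field by metis
  then show ?thesis
    unfolding Let_def
    using regular_embedding_\<alpha> normalized_\<alpha> hopf_galois_H chain card_fixed_fields by (intro conjI)
qed

end
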